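(* Let $t\ge1$ and $p\ge3$ be integers, let $\mu$ be a $p$-adic missing digits measure on $\mathbb{R}$ with $t$ missing digits, and let $s=\dim_{\mathrm{H}}\mu$. Assume $p$ is large enough that $\dim_{l^1}\mu>1/2$. Then there is $c=c_{t,p}>0$ and a function $f:(0,c]\to[0,\infty)$ with $f(c')\to0$ as $c'\to0$ such that for $\psi(q)=q^{-1-c'}$, $c'\in(0,c]$, \[ s-\frac{c'}{2+c'}\ge\dim_{\mathrm{H}}\big(W(\psi,0)\cap\mathrm{supp}(\mu)\big)\ge s-f(c'). \] In particular, $\dim_{\mathrm{H}}(W(\psi,0)\cap\mathrm{supp}(\mu))\to s$ as $c'\to0$.
   Context: A $p$-adic missing digits measure with $t$ missing digits is the law of $\sum_{j\ge1}a_jp^{-j}$ with $a_j$ i.i.d. uniform on a set $D\subset\{0,\dots,p-1\}$ with $\#D=p-t\ge2$. $\hat\mu(\xi)=\int e^{-2\pi ix\xi}d\mu(x)$ ($\xi\in\mathbb{Z}$), and $\dim_{l^1}\mu=\sup\{s>0:\sum_{|\xi|\le R}|\hat\mu(\xi)|\ll R^{1-s}\}$. $\|x\|$ is the distance from $x$ to $\mathbb{Z}$ and $W(\psi,0)=\{x\in\mathbb{R}:\|qx\|\le\psi(q)\text{ for infinitely many }q\in\mathbb{N}\}$. *)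

theory Defs
  imports "HOL-Probability.Probability" "HOL-Library.Landau_Symbols"
begin

section \<open>Hausdorff dimension of sets and of measures\<close>

text \<open>The value \<open>diam(U)\<^sup>s\<close>, with the usual conventions at the boundary: the empty set contributes
  \<open>0\<close>, and a nonempty set contributes \<open>1\<close> when \<open>s = 0\<close> (whereas \<^term>\<open>0 powr 0 = (0::real)\<close>).\<close>

definition diam_pow :: "real \<Rightarrow> 'a::metric_space set \<Rightarrow> real" where
  "diam_pow s U = (if U = {} then 0 else if s = 0 then 1 else diameter U powr s)"

text \<open>Boundedness is required because \<^const>\<open>diameter\<close> is meaningless on unbounded sets.
  Finite covers are included, since the sets \<open>U i\<close> may be empty.\<close>

definition hausdorff_premeasure :: "real \<Rightarrow> real \<Rightarrow> 'a::metric_space set \<Rightarrow> ennreal" where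
  "hausdorff_premeasure \<delta> s A =
     (INF U \<in> {U :: nat \<Rightarrow> 'a set. A \<subseteq> (\<Union>i. U i) \<and> (\<forall>i. bounded (U i) \<and> diameter (U i) \<le> \<delta>)}.
        \<Sum>i. ennreal (diam_pow s (U i)))"

definition hausdorff_measure :: "real \<Rightarrow> 'a::metric_space set \<Rightarrow> ennreal" where
  "hausdorff_measure s A = (SUP \<delta> \<in> {0<..}. hausdorff_premeasure \<delta> s A)"

definition hausdorff_dim :: "'a::metric_space set \<Rightarrow> ereal" where
  "hausdorff_dim A = (INF s \<in> {s. 0 \<le> s \<and> hausdorff_measure s A = 0}. ereal s)"

definition measure_hausdorff_dim :: "'a::metric_space measure \<Rightarrow> ereal" where
  "measure_hausdorff_dim \<mu> = (INF A \<in> {A \<in> sets \<mu>. emeasure \<mu> A > 0}. hausdorff_dim A)"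

definition measure_supp :: "'a::topological_space measure \<Rightarrow> 'a set" where
  "measure_supp \<mu> = {x. \<forall>U. open U \<and> x \<in> U \<longrightarrow> emeasure \<mu> U > 0}"


section \<open>Fourier coefficients and the \<open>l\<^sup>1\<close>-dimension\<close>

definition fourier_coeff :: "real measure \<Rightarrow> int \<Rightarrow> complex" where
  "fourier_coeff \<mu> \<xi> = (\<integral>x. exp (- 2 * complex_of_real pi * \<i> * of_real x * of_int \<xi>) \<partial>\<mu>)"

text \<open>Taking the supremum in \<^typ>\<open>ereal\<close> makes it \<open>-\<infinity>\<close> when no \<open>s > 0\<close> qualifies.\<close>

definition l1_dim :: "real measure \<Rightarrow> ereal" where
  "l1_dim \<mu> = (SUP s \<in> {s :: real. s > 0 \<and>
      (\<lambda>R :: real. \<Sum>\<xi> | real_of_int \<bar>\<xi>\<bar> \<le> R. cmod (fourier_coeff \<mu> \<xi>)) \<in> O(\<lambda>R. R powr (1 - s))}.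
      ereal s)"


section \<open>Missing digits measures\<close>

text \<open>The sequence \<open>a\<close> is indexed from \<open>0\<close>, so \<open>a j\<close> is the digit of \<open>p\<^bsup>-(j+1)\<^esup>\<close>.\<close>

definition digit_law :: "nat \<Rightarrow> nat set \<Rightarrow> real measure" where
  "digit_law p D =
     distr (\<Pi>\<^sub>M j\<in>(UNIV :: nat set). measure_pmf (pmf_of_set D)) borel
       (\<lambda>a. \<Sum>j. real (a j) / real p ^ (j + 1))"

definition missing_digits_measure :: "nat \<Rightarrow> nat \<Rightarrow> real measure \<Rightarrow> bool" where
  "missing_digits_measure p t \<mu> \<longleftrightarrow>
     (\<exists>D \<subseteq> {..<p}. card D = p - t \<and> 2 \<le> card D \<and> \<mu> = digit_law p D)"

text \<open>The coding map is measurable, so that \<^const>\<open>digit_law\<close> is a genuine image measure.\<close>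

lemma digit_sum_measurable:
  "(\<lambda>a. \<Sum>j. real (a j) / real p ^ (j + 1))
     \<in> borel_measurable (\<Pi>\<^sub>M j\<in>(UNIV :: nat set). measure_pmf (pmf_of_set D))"
proof -
  have "(\<lambda>a. real (a j) / real p ^ (j + 1))
     \<in> borel_measurable (\<Pi>\<^sub>M j\<in>(UNIV :: nat set). measure_pmf (pmf_of_set D))" for j
    by measurable
  then show ?thesis
    by (rule borel_measurable_suminf)
qed

lemma prob_space_digit_law: "prob_space (digit_law p D)"
proof -
  interpret product_prob_space "\<lambda>_. measure_pmf (pmf_of_set D)" "UNIV :: nat set"
    by unfold_locales
  have "prob_space (\<Pi>\<^sub>M j\<in>(UNIV :: nat set). measure_pmf (pmf_of_set D))"
    by (rule prob_space_axioms)
  then show ?thesis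
    unfolding digit_law_def by (rule prob_space.prob_space_distr[OF _ digit_sum_measurable])
qed


section \<open>Well-approximable numbers\<close>

definition approximable_set :: "(nat \<Rightarrow> real) \<Rightarrow> real set" where
  "approximable_set \<psi> = {x. infinite {q :: nat. q \<ge> 1 \<and> infdist (real q * x) \<int> \<le> \<psi> q}}"

end

theory Submission
  imports Defs "HOL-Computational_Algebra.Primes"
begin

text \<open>Everything is reduced to the \<open>m\<^sup>n\<close> words \<open>w\<close> of length \<open>n\<close> over the digit set, identified with the points
  \<open>w / p\<^sup>n\<close>. The condition \<open>dim\<^sub>l\<^sub>1 \<mu> > 1/2\<close> says that the Fourier coefficients of frequency up to \<open>p\<^sup>n\<close> have
  absolute sum \<open>O(p\<^sup>n\<^sup>\<beta>)\<close> with \<open>\<beta> < 1/2\<close>. When all denominators \<open>q\<close> of size \<open>Q\<close> are tested together, a frequency \<open>\<xi>\<close>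
  occurs once for every \<open>q\<close> dividing it, so the divisor bound makes the total error \<open>o(Q)\<close> at all scales down to \<open>Q\<close> to the
  power \<open>-2 - c\<close>, for small \<open>c\<close>: the words near rationals with denominator about \<open>Q\<close> are as numerous as expected. The
  natural covers then give the upper bound. The estimate survives the restriction to any cylinder of level at most a
  fixed proportion \<open>\<gamma>\<close> of the final level, at the cost of interpolating the Fourier transform between the integers.
  Hence one may alternate between keeping all words, up to level \<open>\<gamma> L\<close>, and keeping at level \<open>L\<close> only the
  well-approximable ones; the resulting Cantor set has dimension at least \<open>s - 4 c / \<gamma>\<close>.\<close>

section \<open>Exponentials and Fejer kernels\<close>

text \<open>The threshold 1/2 reflects Dirichlet's exponent. For the lower bound, denominators of
  size Q are tested at a level L with p^L about Q^(2 + 2c). So Q is about p^(L / (2 + 2c)), and an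
  error p^(\<beta> L) with \<beta> < 1/2 is of lower order than Q once c is small. The obstacle is
  that averaging over words and denominators counts pairs, while points are wanted. A point near a
  fraction of small denominator lies in many pairs; these pairs are bounded by the same exponential
  sums at a smaller radius. The count is also needed from below, where a nonnegative Fejer kernel
  does not suffice. It is replaced by a signed combination of Fejer kernels that lies below a
  multiple of the indicator function. The loss 4c/\<gamma> comes from bookkeeping. A selection at
  level L costs a factor p^(2cL), and L is taken so large that all earlier selections together cost
  no more. The total 4cL is charged to the levels j >= \<gamma> L, where it is at most (4c/\<gamma>)
  j. Since \<gamma> does not depend on c, the loss tends to 0 with c.\<close>

definition ee :: "real \<Rightarrow> complex" where
  "ee t = cis (2 * pi * t)"

lemma ee_0 [simp]: "ee 0 = 1"
  by (simp add: ee_def)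

lemma ee_add: "ee (s + t) = ee s * ee t"
  by (simp add: ee_def cis_mult ring_distribs)

lemma norm_ee [simp]: "norm (ee t) = 1"
  by (simp add: ee_def)

lemma cnj_ee: "cnj (ee t) = ee (- t)"
  by (simp add: ee_def cis_cnj)

lemma ee_nat_mult: "ee (real n * t) = ee t ^ n"
  by (simp only: ee_def Complex.DeMoivre mult.left_commute)

lemma ee_of_int [simp]: "ee (of_int k) = 1"
  by (simp add: ee_def cis_multiple_2pi)

lemma ee_add_of_int [simp]: "ee (t + of_int k) = ee t"
  by (simp add: ee_add)

lemma ee_diff_of_int: "ee (t - of_int k) = ee t"
  using ee_add_of_int[of t "- k"] by simp

lemma Re_ee: "Re (ee t) = cos (2 * pi * t)"
  by (simp add: ee_def)

lemma norm_ee_minus_1_sq: "(norm (ee t - 1))\<^sup>2 = 2 - 2 * Re (ee t)"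
proof -
  have "(norm (ee t - 1))\<^sup>2 = (cos (2 * pi * t) - 1)\<^sup>2 + (sin (2 * pi * t))\<^sup>2"
    by (simp add: ee_def cmod_power2)
  also have "\<dots> = 2 - 2 * cos (2 * pi * t)"
    using sin_cos_squared_add[of "2 * pi * t"] by (simp add: power2_eq_square algebra_simps)
  finally show ?thesis by (simp add: Re_ee)
qed

lemma norm_ee_minus_1: "norm (ee t - 1) = 2 * \<bar>sin (pi * t)\<bar>"
proof -
  have "(norm (ee t - 1))\<^sup>2 = 2 - 2 * cos (2 * (pi * t))"
    using norm_ee_minus_1_sq[of t] by (simp add: Re_ee mult.assoc)
  also have "\<dots> = (2 * \<bar>sin (pi * t)\<bar>)\<^sup>2" unfolding cos_double_sin by (simp add: power_mult_distrib)
  finally show ?thesis by (rule power2_eq_imp_eq) auto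
qed

text \<open>Jordan's inequality: the concave sine lies above its chord from 0 to
  \<open>pi / 2\<close>.\<close>

lemma sin_ge_linear:
  assumes "0 \<le> t" "t \<le> pi / 2"
  shows "sin t \<ge> 2 * t / pi"
proof -
  have "concave_on {0..pi/2} sin"
  proof (rule f''_le0_imp_concave[where f' = cos and f'' = "\<lambda>x. - sin x"])
    fix x :: real assume "x \<in> {0..pi/2}"
    then show "- sin x \<le> 0" using sin_ge_zero[of x] by auto
  qed (auto intro!: derivative_eq_intros)
  then have "sin ((1 - 2 * t / pi) *\<^sub>R 0 + (2 * t / pi) *\<^sub>R (pi / 2))
      \<ge> (1 - 2 * t / pi) * sin 0 + (2 * t / pi) * sin (pi / 2)"
    by (rule concave_onD) (use assms in \<open>auto simp: field_simps\<close>)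
  then show ?thesis by simp
qed

section \<open>Distance to the nearest integer\<close>

abbreviation int_dist :: "real \<Rightarrow> real" where
  "int_dist x \<equiv> infdist x \<int>"

lemma int_dist_le: "int_dist x \<le> \<bar>x - of_int k\<bar>"
  using infdist_le[of "of_int k" "\<int>" x] by (simp add: dist_real_def)

lemma Ints_nonempty: "(\<int> :: real set) \<noteq> {}"
  using Ints_0 by blast

lemma int_dist_round: "int_dist x = \<bar>x - of_int (round x)\<bar>"
proof (rule antisym)
  show "\<bar>x - of_int (round x)\<bar> \<le> int_dist x"
    unfolding infdist_notempty[OF Ints_nonempty]
  proof (rule cINF_greatest)
    fix y :: real assume "y \<in> \<int>"
    then obtain k where "y = of_int k" by (auto elim: Ints_cases)
    then show "\<bar>x - of_int (round x)\<bar> \<le> dist x y"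
      using round_diff_minimal[of x k] by (simp add: dist_real_def)
  qed (rule Ints_nonempty)
qed (rule int_dist_le)

lemma int_dist_diff_le: "int_dist x \<le> int_dist y + \<bar>x - y\<bar>"
  using infdist_triangle[of x "\<int>" y] by (simp add: dist_real_def)

lemma int_dist_le_half: "int_dist x \<le> 1 / 2"
  unfolding int_dist_round using of_int_round_abs_le[of x] by linarith

text \<open>Jordan's inequality, applied to the representative of \<open>x\<close> modulo 1 in
  [-1/2, 1/2].\<close>

lemma norm_ee_minus_1_ge: "norm (ee x - 1) \<ge> 4 * int_dist x"
proof -
  define y where "y = x - of_int (round x)"
  have y: "\<bar>y\<bar> \<le> 1 / 2"
    using int_dist_le_half[of x] unfolding int_dist_round y_def .
  have "norm (ee x - 1) = norm (ee y - 1)" by (simp add: y_def ee_diff_of_int)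
  also have "\<dots> = 2 * sin (pi * \<bar>y\<bar>)"
  proof -
    have "sin (pi * \<bar>y\<bar>) \<ge> 0" using y by (intro sin_ge_zero) (auto simp: field_simps)
    moreover have "\<bar>sin (pi * y)\<bar> = \<bar>sin (pi * \<bar>y\<bar>)\<bar>" by (cases "y \<ge> 0") auto
    ultimately show ?thesis by (simp add: norm_ee_minus_1)
  qed
  also have "sin (pi * \<bar>y\<bar>) \<ge> 2 * (pi * \<bar>y\<bar>) / pi"
    using y by (intro sin_ge_linear) (auto simp: field_simps)
  then have "2 * sin (pi * \<bar>y\<bar>) \<ge> 4 * \<bar>y\<bar>" by simp
  finally show ?thesis by (simp add: int_dist_round y_def)
qed

lemma norm_sum_ee_geometric: "norm (\<Sum>k<n. ee (real k * x)) * norm (ee x - 1) = norm (ee (real n * x) - 1)"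
proof -
  have "(\<Sum>k<n. ee (real k * x)) * (ee x - 1) = ee (real n * x) - 1"
    unfolding ee_nat_mult by (cases "ee x = 1") (auto simp: geometric_sum)
  then show ?thesis by (metis norm_mult)
qed

lemma norm_sum_ee_le: "norm (\<Sum>k<n. ee (real k * x)) * norm (ee x - 1) \<le> 2"
proof -
  have "norm (ee (real n * x) - 1) \<le> 1 + 1" by (rule norm_triangle_le_diff) simp
  then show ?thesis by (simp add: norm_sum_ee_geometric)
qed

text \<open>The square makes nonnegativity evident. Expanded, it is the sum over |h| < n of (1 -
  |h|/n) e(hx), with mean 1.\<close>

definition fejer :: "nat \<Rightarrow> real \<Rightarrow> real" where
  "fejer n x = (norm (\<Sum>k<n. ee (real k * x)))\<^sup>2 / n"

lemma fejer_nonneg: "fejer n x \<ge> 0"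
  by (simp add: fejer_def)

lemma fejer_le: "fejer n x \<le> n"
proof -
  have "norm (\<Sum>k<n. ee (real k * x)) \<le> real (card {..<n}) * 1" by (rule sum_norm_bound) simp
  then have "(norm (\<Sum>k<n. ee (real k * x)))\<^sup>2 \<le> (real n)\<^sup>2" by (intro power_mono) auto
  then show ?thesis by (cases "n = 0") (auto simp: fejer_def divide_le_eq power2_eq_square)
qed

text \<open>All phases \<open>k x\<close> with \<open>k < n\<close> stay within 60 degrees of 0, so
  the exponential sum has real part at least \<open>n / 2\<close>. The 6 turns the full angle
  \<open>2 * pi\<close> into \<open>pi / 3\<close>.\<close>

lemma fejer_ge:
  assumes "n > 0" "int_dist x \<le> 1 / (6 * n)"
  shows "fejer n x \<ge> n / 4"
proof -
  define y where "y = x - of_int (round x)"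
  have y: "\<bar>y\<bar> \<le> 1 / (6 * n)" using assms(2) by (simp add: y_def int_dist_round)
  have "Re (ee (real k * x)) \<ge> 1 / 2" if "k < n" for k
  proof -
    have "real k * x = real k * y + of_int (int k * round x)" by (simp add: y_def algebra_simps)
    then have "ee (real k * x) = ee (real k * y)" by (metis ee_add_of_int)
    then have "Re (ee (real k * x)) = cos \<bar>2 * pi * (real k * y)\<bar>" by (simp add: Re_ee)
    also have "\<bar>2 * pi * (real k * y)\<bar> \<le> pi / 3"
    proof -
      have "real k * \<bar>y\<bar> \<le> real n * (1 / (6 * n))" using that y by (intro mult_mono) auto
      also have "\<dots> = 1 / 6" using assms(1) by simp
      finally have "pi * (real k * \<bar>y\<bar>) \<le> pi * (1 / 6)" by (intro mult_left_mono) auto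
      then show ?thesis by (simp add: abs_mult)
    qed
    then have "cos \<bar>2 * pi * (real k * y)\<bar> \<ge> cos (pi / 3)" by (intro cos_monotone_0_pi_le) auto
    finally show ?thesis by (simp add: cos_60)
  qed
  then have "(\<Sum>k<n. Re (ee (real k * x))) \<ge> (\<Sum>k<n. 1 / 2)" by (intro sum_mono) auto
  then have "n / 2 \<le> Re (\<Sum>k<n. ee (real k * x))" by simp
  also have "\<dots> \<le> norm (\<Sum>k<n. ee (real k * x))" by (rule complex_Re_le_cmod)
  finally have "(n / 2)\<^sup>2 \<le> (norm (\<Sum>k<n. ee (real k * x)))\<^sup>2" by (intro power_mono) auto
  then show ?thesis using assms(1) by (simp add: fejer_def field_simps power2_eq_square)
qed

text \<open>The closed form of the geometric sum, multiplied out so that integers \<open>x\<close>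
  need no separate treatment.\<close>

lemma fejer_eq: "fejer n x * (norm (ee x - 1))\<^sup>2 = (norm (ee (real n * x) - 1))\<^sup>2 / n"
  by (simp add: fejer_def flip: norm_sum_ee_geometric power_mult_distrib)

text \<open>A trigonometric polynomial below \<open>16 * r\<close> times the indicator of
  \<open>int_dist x < 1 / r\<close>. The subtracted term is half the average of \<open>r\<close>
  Fejer kernels, so the mean is 1 - 1/2 = 1/2.\<close>

definition minorant :: "nat \<Rightarrow> real \<Rightarrow> real" where
  "minorant r x = fejer (16 * r) x - (\<Sum>k\<in>{r<..2*r}. fejer k x) / (2 * r)"

lemma minorant_le: "minorant r x \<le> 16 * r"
proof -
  have "minorant r x \<le> fejer (16 * r) x"
    unfolding minorant_def by (simp add: sum_nonneg fejer_nonneg)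
  also have "\<dots> \<le> 16 * r" using fejer_le[of "16 * r" x] by simp
  finally show ?thesis .
qed

text \<open>At distance at least \<open>1/r\<close> from the integers the phases \<open>k x\<close> for \<open>r < k \<le> 2r\<close> are spread out
  enough that the averaged Fejer kernels have no common zero there.\<close>

lemma minorant_nonpos:
  assumes "r > 0" "int_dist x \<ge> 1 / r"
  shows "minorant r x \<le> 0"
proof -
  define s where "s = norm (ee x - 1)"
  have "4 * (1 / r) \<le> 4 * int_dist x" using assms(2) by (intro mult_left_mono) auto
  then have s: "s \<ge> 4 / r" using norm_ee_minus_1_ge[of x] unfolding s_def by simp
  then have s0: "s > 0" using assms(1) by (intro less_le_trans[OF _ s]) auto
  have "(\<Sum>k\<in>{r<..2*r}. ee (real k * x)) = ee (real (Suc r) * x) * (\<Sum>k<r. ee (real k * x))"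
  proof -
    have "(\<Sum>k\<in>{r<..2*r}. ee (real k * x)) = (\<Sum>k<r. ee (real (k + Suc r) * x))"
      by (rule sum.reindex_bij_witness[of _ "\<lambda>k. k + Suc r" "\<lambda>k. k - Suc r"]) auto
    also have "\<dots> = (\<Sum>k<r. ee (real (Suc r) * x) * ee (real k * x))"
      by (intro sum.cong refl) (simp add: ring_distribs ee_add mult_ac)
    finally show ?thesis by (simp add: sum_distrib_left)
  qed
  then have "norm (\<Sum>k\<in>{r<..2*r}. ee (real k * x)) * s \<le> 2"
    using norm_sum_ee_le[where n = r and x = x] by (simp add: norm_mult s_def)
  moreover have "norm (\<Sum>k\<in>{r<..2*r}. ee (real k * x)) * (4 / r)
      \<le> norm (\<Sum>k\<in>{r<..2*r}. ee (real k * x)) * s"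
    using s by (intro mult_left_mono) auto
  ultimately have "norm (\<Sum>k\<in>{r<..2*r}. ee (real k * x)) * (4 / r) \<le> 2" by linarith
  then have "norm (\<Sum>k\<in>{r<..2*r}. ee (real k * x)) \<le> r / 2" using assms(1) by (simp add: field_simps)
  then have re: "(\<Sum>k\<in>{r<..2*r}. Re (ee (real k * x))) \<le> r / 2"
    using complex_Re_le_cmod[of "\<Sum>k\<in>{r<..2*r}. ee (real k * x)"] by simp
  have "(\<Sum>k\<in>{r<..2*r}. fejer k x) * s\<^sup>2
      = (\<Sum>k\<in>{r<..2*r}. (norm (ee (real k * x) - 1))\<^sup>2 / k)"
    unfolding s_def by (simp add: sum_distrib_right fejer_eq)
  also have "\<dots> \<ge> (\<Sum>k\<in>{r<..2*r}. (norm (ee (real k * x) - 1))\<^sup>2 / (2 * r))"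
    using assms(1) by (intro sum_mono divide_left_mono) auto
  also have "(\<Sum>k\<in>{r<..2*r}. (norm (ee (real k * x) - 1))\<^sup>2 / (2 * r))
      = (2 * r - 2 * (\<Sum>k\<in>{r<..2*r}. Re (ee (real k * x)))) / (2 * r)"
    by (simp add: norm_ee_minus_1_sq sum_subtractf flip: sum_divide_distrib sum_distrib_left)
  also have "\<dots> \<ge> 1 / 2" using re assms(1) by (simp add: field_simps)
  finally have 1: "(\<Sum>k\<in>{r<..2*r}. fejer k x) * s\<^sup>2 \<ge> 1 / 2" .
  \<comment> \<open>The factor 16 is chosen for this comparison: 4 / (16 r) equals the lower bound 1
    / (4 r) found for the subtracted half average.\<close>
  have "norm (ee (real (16 * r) * x) - 1) \<le> 1 + 1" by (rule norm_triangle_le_diff) simp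
  then have "(norm (ee (real (16 * r) * x) - 1))\<^sup>2 \<le> 2\<^sup>2" by (intro power_mono) auto
  then have "fejer (16 * r) x * s\<^sup>2 \<le> 1 / (4 * r)"
    unfolding s_def fejer_eq using assms(1) by (simp add: field_simps)
  moreover have "(\<Sum>k\<in>{r<..2*r}. fejer k x) / (2 * r) * s\<^sup>2 \<ge> 1 / (4 * r)"
    using 1 assms(1) by (simp add: field_simps)
  ultimately have "minorant r x * s\<^sup>2 \<le> 0" by (simp add: minorant_def left_diff_distrib)
  then show ?thesis using s0 by (simp add: mult_le_0_iff)
qed

section \<open>Words with restricted digits and their exponential sums\<close>

locale missing_digits =
  fixes p :: nat and D :: "nat set"
  assumes p_ge: "3 \<le> p" and D_subset: "D \<subseteq> {..<p}"
    and card_D_ge: "2 \<le> card D" and card_D_less: "card D < p"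
begin

abbreviation m :: nat where "m \<equiv> card D"

lemma finite_D: "finite D"
  using D_subset finite_subset by blast

lemma p_pos [simp]: "0 < p"
  using p_ge by simp

lemma p_ne_0 [simp]: "p \<noteq> 0"
  using p_ge by simp

lemma m_pos [simp]: "0 < m"
  using card_D_ge by simp

lemma m_ne_0 [simp]: "m \<noteq> 0"
  using card_D_ge by simp

text \<open>A word is encoded by its value in base \<open>p\<close>. Division by
  \<open>p ^ i\<close> then deletes the last \<open>i\<close> digits. Leading zeros are invisible,
  so the length is always carried along.\<close>

primrec words :: "nat \<Rightarrow> nat set" where
  "words 0 = {0}"
| "words (Suc n) = (\<lambda>(w, d). p * w + d) ` (words n \<times> D)"

lemma words_less: "w \<in> words n \<Longrightarrow> w < p ^ n"
proof (induction n arbitrary: w)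
  case (Suc n)
  then obtain v d where w: "w = p * v + d" "v \<in> words n" "d \<in> D" by auto
  then have "v + 1 \<le> p ^ n" "d < p" using Suc.IH[of v] D_subset by auto
  then have "p * (v + 1) \<le> p * p ^ n" by (intro mult_left_mono) auto
  then show ?case using w \<open>d < p\<close> by simp
qed simp

lemma finite_words [simp]: "finite (words n)"
  by (rule finite_subset[of _ "{..<p ^ n}"]) (auto dest: words_less)

lemma words_add: "words (j + n) = (\<lambda>(u, v). p ^ n * u + v) ` (words j \<times> words n)"
proof (induction n)
  case (Suc n)
  have "words (j + Suc n) = (\<Union>u\<in>words j. \<Union>v\<in>words n. \<Union>d\<in>D. {p * (p ^ n * u + v) + d})"
    using Suc by auto
  also have "\<dots> = (\<Union>u\<in>words j. \<Union>v\<in>words n. \<Union>d\<in>D. {p ^ Suc n * u + (p * v + d)})"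
    by (simp add: algebra_simps)
  also have "\<dots> = (\<lambda>(u, v). p ^ Suc n * u + v) ` (words j \<times> words (Suc n))" by auto
  finally show ?case .
qed (auto simp: image_iff)

lemma words_1: "words (Suc 0) = D"
  by (auto simp: image_iff)

lemma inj_on_prefix: "inj_on (\<lambda>(u, v). p ^ n * u + v) (A \<times> words n)"
proof (rule inj_onI, clarify)
  fix u v u' v' assume *: "v \<in> words n" "v' \<in> words n" "p ^ n * u + v = p ^ n * u' + v'"
  have "(p ^ n * u + v) div p ^ n = u" "(p ^ n * u' + v') div p ^ n = u'"
    using words_less[OF *(1)] words_less[OF *(2)] by auto
  then show "u = u' \<and> v = v'" using * by auto
qed

lemma card_words: "card (words n) = m ^ n"
proof (induction n)
  case (Suc n)
  have "words (Suc n) = (\<lambda>(u, v). p ^ 1 * u + v) ` (words n \<times> words 1)"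
    using words_add[of n 1] by simp
  then show ?case
    using card_image[OF inj_on_prefix[of 1 "words n"]] Suc
    by (simp add: card_cartesian_product words_1 del: words.simps)
qed simp

lemma words_div: "w \<in> words (j + n) \<Longrightarrow> w div p ^ n \<in> words j"
  unfolding words_add by (auto dest: words_less)

lemma words_append: "u \<in> words j \<Longrightarrow> v \<in> words n \<Longrightarrow> p ^ n * u + v \<in> words (j + n)"
  unfolding words_add by auto

lemma words_append_div: "v \<in> words n \<Longrightarrow> (p ^ n * u + v) div p ^ n = u"
  by (auto dest: words_less)

text \<open>The Fourier transform, at a real frequency, of the uniform probability on the points
  \<open>w / p ^ n\<close>: the level-\<open>n\<close> approximation to the transform of the
  measure.\<close>

definition char_avg :: "nat \<Rightarrow> real \<Rightarrow> complex" where
  "char_avg n y = (\<Sum>w\<in>words n. ee (- (y * real w / real p ^ n))) / of_nat (m ^ n)"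

lemma norm_char_avg_le: "norm (char_avg n y) \<le> 1"
proof -
  have "norm (\<Sum>w\<in>words n. ee (- (y * real w / real p ^ n))) \<le> real (card (words n)) * 1"
    by (rule sum_norm_bound) simp
  then show ?thesis by (simp add: char_avg_def norm_divide card_words divide_le_eq norm_power)
qed

text \<open>Self-similarity: the uniform measure of level \<open>j + n\<close> is the convolution of
  the one of level \<open>j\<close> with a copy of the one of level \<open>n\<close> scaled by
  \<open>p ^ j\<close>.\<close>

lemma char_avg_add: "char_avg (j + n) y = char_avg j y * char_avg n (y / p ^ j)"
proof -
  have "(\<Sum>w\<in>words (j + n). ee (- (y * real w / real p ^ (j + n))))
      = (\<Sum>(u, v)\<in>words j \<times> words n. ee (- (y * real (p ^ n * u + v) / real p ^ (j + n))))"
    unfolding words_add by (subst sum.reindex[OF inj_on_prefix]) (simp add: split_beta)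
  also have "\<dots> = (\<Sum>(u, v)\<in>words j \<times> words n. ee (- (y * real u / real p ^ j)) * ee (- (y / real p ^ j * real v / real p ^ n)))"
    by (intro sum.cong refl) (auto simp: add_divide_distrib ring_distribs power_add simp flip: ee_add)
  also have "\<dots> = (\<Sum>u\<in>words j. ee (- (y * real u / real p ^ j))) * (\<Sum>v\<in>words n. ee (- (y / real p ^ j * real v / real p ^ n)))"
    by (simp add: sum_product sum.cartesian_product)
  finally show ?thesis by (simp add: char_avg_def power_add)
qed

lemma char_avg_periodic: "char_avg n (y + of_int k * real p ^ n) = char_avg n y"
proof -
  have "ee (- ((y + of_int k * real p ^ n) * real w / real p ^ n)) = ee (- (y * real w / real p ^ n))" for w :: nat
  proof -
    have "- ((y + of_int k * real p ^ n) * real w / real p ^ n) = - (y * real w / real p ^ n) + of_int (- k * int w)"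
      by (simp add: field_simps)
    then show ?thesis by (metis ee_add_of_int)
  qed
  then show ?thesis by (simp add: char_avg_def)
qed

lemma char_avg_minus: "char_avg n (- y) = cnj (char_avg n y)"
  by (simp add: char_avg_def cnj_ee)

lemma norm_char_avg_abs: "norm (char_avg n \<bar>y\<bar>) = norm (char_avg n y)"
  by (cases "y \<ge> 0") (auto simp: char_avg_minus)

text \<open>The prefix \<open>u\<close> contributes only a phase, so every estimate below is uniform
  over the cylinders of level \<open>j\<close>. The price is the fractional frequency
  \<open>t / p ^ j\<close>.\<close>

lemma norm_sum_ee_extensions:
  "norm (\<Sum>v\<in>words n. ee (t * (real (p ^ n * u + v) / p ^ (j + n)))) = m ^ n * norm (char_avg n (t / p ^ j))"
proof -
  have "(\<Sum>v\<in>words n. ee (t * (real (p ^ n * u + v) / p ^ (j + n))))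
      = (\<Sum>v\<in>words n. ee (t * real u / real p ^ j) * ee (- (- t / real p ^ j * real v / real p ^ n)))"
    by (intro sum.cong refl) (auto simp: add_divide_distrib ring_distribs power_add simp flip: ee_add)
  also have "\<dots> = ee (t * real u / real p ^ j) * (\<Sum>v\<in>words n. ee (- (- t / real p ^ j * real v / real p ^ n)))"
    by (simp only: sum_distrib_left)
  also have "(\<Sum>v\<in>words n. ee (- (- t / real p ^ j * real v / real p ^ n)))
      = of_nat (m ^ n) * char_avg n (- t / real p ^ j)"
    by (simp add: char_avg_def)
  finally show ?thesis by (simp add: norm_mult norm_power char_avg_minus)
qed

text \<open>Expanding the square gives differences \<open>k - l\<close>. The diagonal yields the
  main term \<open>m ^ n\<close>, and everything else is an error.\<close>

lemma fejer_sum_extensions: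
  fixes j n :: nat and q u R :: nat
  assumes "0 < R"
  defines "x \<equiv> \<lambda>v. real q * (real (p ^ n * u + v) / p ^ (j + n))"
  shows "\<bar>(\<Sum>v\<in>words n. fejer R (x v)) - m ^ n\<bar>
    \<le> m ^ n * (2 * (\<Sum>k\<in>{1..<R}. norm (char_avg n (k * q / p ^ j))))"
proof -
  define S :: "real \<Rightarrow> complex" where "S t = (\<Sum>v\<in>words n. ee (t * x v))" for t
  define e where "e k = norm (char_avg n (real k * q / p ^ j))" for k
  have S0: "S 0 = of_nat (m ^ n)" by (simp add: S_def card_words)
  have S: "norm (S t) = m ^ n * norm (char_avg n (t * q / p ^ j))" for t :: real
    using norm_sum_ee_extensions[of "t * q" n u j] by (simp add: S_def x_def mult.assoc)
  have Se: "norm (S (real k - real l)) = m ^ n * e (k - l + (l - k))" for k l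
  proof -
    have "\<bar>(real k - real l) * q / p ^ j\<bar> = real (k - l + (l - k)) * q / p ^ j"
      by (cases "k \<le> l") (auto simp: abs_mult)
    then show ?thesis unfolding S e_def by (metis norm_char_avg_abs)
  qed
  have fej: "complex_of_real (fejer R y) = (\<Sum>k<R. \<Sum>l<R. ee ((real k - real l) * y)) / R" for y
  proof -
    have "complex_of_real (fejer R y) = (\<Sum>k<R. ee (real k * y)) * cnj (\<Sum>k<R. ee (real k * y)) / R"
      by (simp add: fejer_def complex_norm_square flip: of_real_power)
    also have "(\<Sum>k<R. ee (real k * y)) * cnj (\<Sum>k<R. ee (real k * y))
        = (\<Sum>k<R. \<Sum>l<R. ee ((real k - real l) * y))"
      by (simp add: sum_product cnj_ee left_diff_distrib flip: ee_add)
    finally show ?thesis .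
  qed
  have "complex_of_real ((\<Sum>v\<in>words n. fejer R (x v)) - m ^ n)
      = (\<Sum>v\<in>words n. \<Sum>k<R. \<Sum>l<R. ee ((real k - real l) * x v)) / R - of_nat (m ^ n)"
    by (simp add: fej sum_divide_distrib)
  also have "(\<Sum>v\<in>words n. \<Sum>k<R. \<Sum>l<R. ee ((real k - real l) * x v))
      = (\<Sum>k<R. \<Sum>v\<in>words n. \<Sum>l<R. ee ((real k - real l) * x v))"
    by (rule sum.swap)
  also have "\<dots> = (\<Sum>k<R. \<Sum>l<R. S (real k - real l))"
    unfolding S_def by (intro sum.cong refl sum.swap)
  also have "(\<Sum>k<R. \<Sum>l<R. S (real k - real l)) / R - of_nat (m ^ n)
      = (\<Sum>k<R. \<Sum>l\<in>{..<R} - {k}. S (real k - real l)) / R"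
  proof -
    have "(\<Sum>k<R. \<Sum>l<R. S (real k - real l))
        = (\<Sum>k<R. of_nat (m ^ n) + (\<Sum>l\<in>{..<R} - {k}. S (real k - real l)))"
      by (intro sum.cong refl, subst sum.remove[of "{..<R}"]) (auto simp: S0)
    then show ?thesis using assms(1) by (simp add: sum.distrib field_simps)
  qed
  finally have "\<bar>(\<Sum>v\<in>words n. fejer R (x v)) - m ^ n\<bar>
      = norm ((\<Sum>k<R. \<Sum>l\<in>{..<R} - {k}. S (real k - real l)) / R)"
    by (metis norm_of_real)
  also have "\<dots> = norm (\<Sum>k<R. \<Sum>l\<in>{..<R} - {k}. S (real k - real l)) / R" by (simp add: norm_divide)
  also have "norm (\<Sum>k<R. \<Sum>l\<in>{..<R} - {k}. S (real k - real l))
      \<le> (\<Sum>k<R. m ^ n * (2 * (\<Sum>h\<in>{1..<R}. e h)))"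
  proof (rule sum_norm_le)
    fix k assume "k \<in> {..<R}"
    then have k: "k < R" by simp
    have e0: "e h \<ge> 0" for h by (simp add: e_def)
    have "norm (\<Sum>l\<in>{..<R} - {k}. S (real k - real l)) \<le> (\<Sum>l\<in>{..<R} - {k}. m ^ n * e (k - l + (l - k)))"
      by (rule sum_norm_le) (simp add: Se)
    \<comment> \<open>For fixed \<open>k\<close> a difference of given size occurs at most once
      below and at most once above \<open>k\<close>, whence the factor 2.\<close>
    also have "(\<Sum>l\<in>{..<R} - {k}. m ^ n * e (k - l + (l - k)))
        = (\<Sum>l\<in>{..<k} \<union> {k<..<R}. m ^ n * e (k - l + (l - k)))"
      using k by (intro sum.cong refl) auto
    also have "\<dots> = (\<Sum>l<k. m ^ n * e (k - l)) + (\<Sum>l\<in>{k<..<R}. m ^ n * e (l - k))"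
      by (subst sum.union_disjoint) (auto intro!: arg_cong2[of _ _ _ _ "(+)"] sum.cong)
    also have "(\<Sum>l<k. m ^ n * e (k - l)) = (\<Sum>h\<in>{1..k}. m ^ n * e h)"
      by (rule sum.reindex_bij_witness[of _ "\<lambda>h. k - h" "\<lambda>l. k - l"]) auto
    also have "(\<Sum>l\<in>{k<..<R}. m ^ n * e (l - k)) = (\<Sum>h\<in>{1..<R - k}. m ^ n * e h)"
      by (rule sum.reindex_bij_witness[of _ "\<lambda>h. k + h" "\<lambda>l. l - k"]) auto
    also have "(\<Sum>h\<in>{1..k}. m ^ n * e h) \<le> (\<Sum>h\<in>{1..<R}. m ^ n * e h)"
      using k e0 by (intro sum_mono2) auto
    also have "(\<Sum>h\<in>{1..<R - k}. m ^ n * e h) \<le> (\<Sum>h\<in>{1..<R}. m ^ n * e h)"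
      using k e0 by (intro sum_mono2) auto
    finally show "norm (\<Sum>l\<in>{..<R} - {k}. S (real k - real l)) \<le> m ^ n * (2 * (\<Sum>h\<in>{1..<R}. e h))"
      by (simp add: sum_distrib_left mult.left_commute)
  qed
  also have "(\<Sum>k<R. m ^ n * (2 * (\<Sum>h\<in>{1..<R}. e h))) / R = m ^ n * (2 * (\<Sum>h\<in>{1..<R}. e h))"
    using assms(1) by simp
  finally show ?thesis by (simp add: e_def divide_right_mono)
qed

text \<open>The main term 1/2 is the mean of \<open>minorant\<close>. The error 3 is 2 from the
  first kernel plus half of 2 from the averaged ones.\<close>

lemma minorant_sum_extensions:
  fixes j n :: nat and q u r :: nat
  assumes "0 < r"
  defines "x \<equiv> \<lambda>v. real q * (real (p ^ n * u + v) / p ^ (j + n))"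
  shows "(\<Sum>v\<in>words n. minorant r (x v))
    \<ge> m ^ n * (1 / 2 - 3 * (\<Sum>k\<in>{1..<16 * r}. norm (char_avg n (k * q / p ^ j))))"
proof -
  define e where "e = (\<Sum>k\<in>{1..<16 * r}. norm (char_avg n (real k * q / p ^ j)))"
  have F: "\<bar>(\<Sum>v\<in>words n. fejer R (x v)) - m ^ n\<bar> \<le> m ^ n * (2 * e)" if R: "0 < R" "R \<le> 16 * r" for R
  proof -
    have "\<bar>(\<Sum>v\<in>words n. fejer R (x v)) - m ^ n\<bar>
        \<le> m ^ n * (2 * (\<Sum>k\<in>{1..<R}. norm (char_avg n (k * q / p ^ j))))"
      unfolding x_def by (rule fejer_sum_extensions[OF R(1)])
    also have "\<dots> \<le> m ^ n * (2 * e)"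
      unfolding e_def using R by (intro mult_left_mono) (auto intro!: sum_mono2)
    finally show ?thesis .
  qed
  have "(\<Sum>k\<in>{r<..2*r}. \<Sum>v\<in>words n. fejer k (x v)) \<le> (\<Sum>k\<in>{r<..2*r}. m ^ n * (1 + 2 * e))"
  proof (rule sum_mono)
    fix k assume "k \<in> {r<..2*r}"
    then show "(\<Sum>v\<in>words n. fejer k (x v)) \<le> m ^ n * (1 + 2 * e)"
      using F[of k] by (simp add: distrib_left abs_le_iff)
  qed
  then have "(\<Sum>k\<in>{r<..2*r}. \<Sum>v\<in>words n. fejer k (x v)) / (2 * r) \<le> m ^ n * (1 / 2 + e)"
    using assms(1) by (simp add: field_simps)
  moreover have "(\<Sum>v\<in>words n. minorant r (x v)) = (\<Sum>v\<in>words n. fejer (16 * r) (x v))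
      - (\<Sum>k\<in>{r<..2*r}. \<Sum>v\<in>words n. fejer k (x v)) / (2 * r)"
    unfolding minorant_def sum_subtractf sum_divide_distrib[symmetric]
    using sum.swap[of "\<lambda>v k. fejer k (x v)" "{r<..2*r}" "words n"] by simp
  moreover have "(\<Sum>v\<in>words n. fejer (16 * r) (x v)) \<ge> m ^ n * (1 - 2 * e)"
    using F[of "16 * r"] assms(1) by (simp add: algebra_simps abs_le_iff)
  ultimately have "(\<Sum>v\<in>words n. minorant r (x v)) \<ge> m ^ n * (1 / 2 - 3 * e)"
    by (simp add: algebra_simps)
  then show ?thesis by (simp add: e_def)
qed

text \<open>The sum runs over one period of the summand's \<open>char_avg\<close> factor, whose
  arguments are fractional because a prefix of length \<open>j\<close> is fixed.\<close>

definition err :: "nat \<Rightarrow> nat \<Rightarrow> real" where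
  "err j n = (\<Sum>\<xi>\<in>{1..<p ^ (j + n)}. card {d. d dvd \<xi>} * norm (char_avg n (\<xi> / p ^ j)))"

text \<open>The pair \<open>(q, k)\<close> is recovered from the product \<open>k * q\<close> and
  its divisor \<open>q\<close>. The cutoff \<open>R\<close> may vary with \<open>q\<close>, as it
  must when small denominators are tested at smaller radii.\<close>

lemma sum_char_avg_le_err:
  fixes Q :: "nat set" and R :: "nat \<Rightarrow> nat"
  assumes "finite Q" "0 \<notin> Q" "\<And>q. q \<in> Q \<Longrightarrow> q * R q \<le> p ^ (j + n)"
  shows "(\<Sum>q\<in>Q. \<Sum>k\<in>{1..<R q}. norm (char_avg n (real k * q / p ^ j))) \<le> err j n"
proof -
  define f where "f \<xi> = norm (char_avg n (real \<xi> / p ^ j))" for \<xi> :: nat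
  have "(\<Sum>q\<in>Q. \<Sum>k\<in>{1..<R q}. norm (char_avg n (real k * q / p ^ j)))
      = (\<Sum>(q, k)\<in>Sigma Q (\<lambda>q. {1..<R q}). f (k * q))"
    using assms(1) by (subst sum.Sigma) (auto simp: f_def)
  also have "\<dots> = (\<Sum>(\<xi>, d)\<in>(\<lambda>(q, k). (k * q, q)) ` Sigma Q (\<lambda>q. {1..<R q}). f \<xi>)"
    using assms(2) by (subst sum.reindex) (auto simp: inj_on_def split_beta)
  also have "\<dots> \<le> (\<Sum>(\<xi>, d)\<in>Sigma {1..<p ^ (j + n)} (\<lambda>\<xi>. {d. d dvd \<xi>}). f \<xi>)"
  proof (rule sum_mono2)
    show "finite (SIGMA \<xi>:{1..<p ^ (j + n)}. {d. d dvd \<xi>})" by (intro finite_SigmaI) auto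
    have "k * q < p ^ (j + n)" if "q \<in> Q" "k < R q" for q k
    proof -
      have "q > 0" using that assms(2) by (cases q) auto
      then have "k * q < q * R q" using that by simp
      then show ?thesis using assms(3)[OF that(1)] by linarith
    qed
    then show "(\<lambda>(q, k). (k * q, q)) ` Sigma Q (\<lambda>q. {1..<R q})
        \<subseteq> (SIGMA \<xi>:{1..<p ^ (j + n)}. {d. d dvd \<xi>})"
      using assms(2) by (auto simp: Suc_le_eq intro: Nat.gr0I)
  qed (auto simp: f_def)
  also have "\<dots> = err j n" by (subst sum.Sigma[symmetric]) (auto simp: err_def f_def)
  finally show ?thesis .
qed

lemma err_nonneg: "err j n \<ge> 0"
  by (simp add: err_def sum_nonneg)

end

section \<open>The error term\<close>

lemma card_divisors_mult_le:
  fixes a b :: nat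
  assumes "0 < a" "0 < b"
  shows "card {d. d dvd a * b} \<le> card {d. d dvd a} * card {d. d dvd b}"
proof -
  have "{d. d dvd a * b} \<subseteq> (\<lambda>(x, y). x * y) ` ({d. d dvd a} \<times> {d. d dvd b})"
    by (auto dest!: division_decomp)
  moreover have fin: "finite ({d. d dvd a} \<times> {d. d dvd b})" using assms by simp
  ultimately have "card {d. d dvd a * b} \<le> card ({d. d dvd a} \<times> {d. d dvd b})"
    by (meson card_image_le card_mono finite_imageI le_trans)
  then show ?thesis by (simp add: card_cartesian_product)
qed

lemma card_divisors_prime_power:
  fixes q :: nat
  assumes "prime q"
  shows "card {d. d dvd q ^ a} \<le> a + 1"
proof -
  have "{d. d dvd q ^ a} \<subseteq> (\<lambda>i. q ^ i) ` {..a}" using assms by (auto simp: divides_primepow_nat)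
  then have "card {d. d dvd q ^ a} \<le> card {..a}"
    by (meson card_image_le card_mono finite_atMost finite_imageI le_trans)
  then show ?thesis by simp
qed

abbreviation small_primes :: "nat \<Rightarrow> nat \<Rightarrow> nat set" where
  "small_primes X n \<equiv> {q. prime q \<and> q \<le> X \<and> q dvd n}"

text \<open>Split off the full power \<open>q ^ a\<close> of a prime factor, which contributes at
  most \<open>a + 1\<close> divisors. If \<open>q > X\<close> then \<open>q powr e\<close> is at
  least 2, so \<open>a + 1 \<le> 2 ^ a\<close> is paid for by \<open>(q ^ a) powr e\<close> alone.
  If \<open>q \<le> X\<close> an extra factor \<open>M\<close> is spent;
  \<open>M * e * ln 2 \<ge> 1\<close> together with \<open>1 + x \<le> exp x\<close> makes it
  sufficient. Only small primes cost a factor, so the constant stays bounded.\<close>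

lemma card_divisors_bound_aux:
  fixes e :: real
  assumes "0 < e"
  defines "M \<equiv> max 1 (1 / (e * ln 2))" and "X \<equiv> nat \<lceil>2 powr (1 / e)\<rceil>"
  shows "0 < n \<Longrightarrow> card {d. d dvd n} \<le> M ^ card (small_primes X n) * real n powr e"
proof (induction n rule: less_induct)
  case (less n)
  have M: "M \<ge> 1" by (simp add: M_def)
  have finX: "finite (small_primes X k)" for k by (rule finite_subset[of _ "{..X}"]) auto
  show ?case
  proof (cases "n = 1")
    case True
    then show ?thesis using M by simp
  next
    case False
    then obtain q where q: "prime q" "q dvd n" using prime_factor_nat by blast
    define a where "a = multiplicity q n"
    obtain k where k: "n = q ^ a * k" "\<not> q dvd k"
      using multiplicity_decompose'[of n q] q less.prems unfolding a_def by (metis not_prime_unit gr_implies_not0)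
    have a: "a \<ge> 1"
      unfolding a_def using q less.prems by (simp add: prime_multiplicity_gt_zero_iff Suc_le_eq)
    have q2: "q \<ge> 2" using q prime_ge_2_nat by blast
    have k0: "k > 0" using k by (cases k) auto
    have "q ^ 1 \<le> q ^ a" using q2 a by (intro power_increasing) auto
    then have "1 < q ^ a" using q2 by simp
    then have "1 * k < q ^ a * k" using k0 by (intro mult_strict_right_mono) auto
    then have kn: "k < n" using k by simp
    have qa: "(real q ^ a) powr e = (real q powr e) ^ a"
    proof -
      have *: "x ^ a = x powr real a" if "x > 0" for x :: real
        using that by (simp add: powr_realpow)
      have "real q > 0" "real q powr e > 0" using q2 by auto
      then show ?thesis by (simp only: * powr_powr mult.commute)
    qed
    have "card {d. d dvd n} \<le> card {d. d dvd q ^ a} * card {d. d dvd k}"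
      unfolding k using q2 k0 by (intro card_divisors_mult_le) auto
    also have "\<dots> \<le> (a + 1) * card {d. d dvd k}"
      using card_divisors_prime_power[OF q(1)] by (intro mult_right_mono) auto
    finally have "real (card {d. d dvd n}) \<le> real ((a + 1) * card {d. d dvd k})"
      by (simp only: of_nat_le_iff)
    then have "real (card {d. d dvd n}) \<le> (real a + 1) * card {d. d dvd k}"
      by (simp only: of_nat_mult of_nat_add of_nat_1)
    also have "\<dots> \<le> (real a + 1) * (M ^ card (small_primes X k) * real k powr e)"
      using less.IH[OF kn k0] by (intro mult_left_mono) auto
    also have "\<dots> = (real a + 1) * M ^ card (small_primes X k) * real k powr e" by simp
    also have "(real a + 1) * M ^ card (small_primes X k)
        \<le> M ^ card (small_primes X n) * real (q ^ a) powr e"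
    proof (cases "q \<le> X")
      case True
      have "insert q (small_primes X k) \<subseteq> (small_primes X n)" using True q k by auto
      then have "card (insert q (small_primes X k)) \<le> card (small_primes X n)"
        by (rule card_mono[OF finX])
      then have "M * M ^ card (small_primes X k) \<le> M ^ card (small_primes X n)"
        using power_increasing[OF _ M, of "Suc (card (small_primes X k))"] k(2) finX[of k] by simp
      moreover have "real a + 1 \<le> M * real (q ^ a) powr e"
      proof -
        have "1 + a * (e * ln 2) \<le> exp (a * (e * ln 2))" by (rule exp_ge_add_one_self)
        also have "\<dots> = (2 powr e) ^ a" by (simp add: powr_def exp_of_nat_mult)
        also have "\<dots> \<le> (real q powr e) ^ a" using q2 assms(1) by (intro power_mono powr_mono2) auto
        finally have *: "1 + a * (e * ln 2) \<le> real (q ^ a) powr e" by (simp add: qa)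
        have "real a + 1 \<le> M * 1 + M * (a * (e * ln 2))"
        proof -
          have "1 / (e * ln 2) * (a * (e * ln 2)) \<le> M * (a * (e * ln 2))"
            using assms(1) by (intro mult_right_mono) (auto simp: M_def)
          moreover have "1 / (e * ln 2) * (a * (e * ln 2)) = a" using assms(1) by simp
          ultimately show ?thesis using M by linarith
        qed
        also have "\<dots> = M * (1 + a * (e * ln 2))" by (simp add: distrib_left)
        also have "\<dots> \<le> M * real (q ^ a) powr e" using * M by (intro mult_left_mono) auto
        finally show ?thesis .
      qed
      ultimately have "(real a + 1) * M ^ card (small_primes X k)
          \<le> M * real (q ^ a) powr e * M ^ card (small_primes X k)"
        using M by (intro mult_right_mono) auto
      also have "\<dots> = (M * M ^ card (small_primes X k)) * real (q ^ a) powr e" by simp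
      also have "\<dots> \<le> M ^ card (small_primes X n) * real (q ^ a) powr e"
        using \<open>M * _ \<le> _\<close> by (intro mult_right_mono) auto
      finally show ?thesis .
    next
      case False
      then have "2 powr (1 / e) \<le> q" unfolding X_def by linarith
      then have "(2 powr (1 / e)) powr e \<le> real q powr e" using assms(1) by (intro powr_mono2) auto
      then have "2 \<le> real q powr e" using assms(1) by (simp add: powr_powr)
      then have "2 ^ a \<le> (real q powr e) ^ a" by (intro power_mono) auto
      moreover have "real a + 1 \<le> 2 ^ a"
        using Suc_leI[OF less_exp[of a]] by (simp flip: of_nat_le_iff[where 'a = real])
      ultimately have *: "real a + 1 \<le> real (q ^ a) powr e" by (simp add: qa)
      have "card (small_primes X k) \<le> card (small_primes X n)"
        using k by (intro card_mono finX) auto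
      then have "M ^ card (small_primes X k) \<le> M ^ card (small_primes X n)"
        using M by (intro power_increasing) auto
      from mult_mono[OF * this] show ?thesis using M by (simp add: mult.commute)
    qed
    finally have "real (card {d. d dvd n}) \<le> M ^ card (small_primes X n)
        * (real (q ^ a) powr e * real k powr e)"
      by (simp add: mult_right_mono mult.assoc)
    also have "real (q ^ a) powr e * real k powr e = real n powr e"
      unfolding k(1) by (simp add: powr_mult)
    finally show ?thesis .
  qed
qed

lemma card_divisors_bound:
  assumes "0 < e"
  obtains C :: real where "C > 0" "\<And>n. 0 < n \<Longrightarrow> card {d. d dvd n} \<le> C * real n powr e"
proof -
  define M where "M = max 1 (1 / (e * ln 2))"
  define X where "X = nat \<lceil>2 powr (1 / e)\<rceil>"
  have M: "M \<ge> 1" by (simp add: M_def)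
  show ?thesis
  proof (rule that[of "M ^ (X + 1)"])
    show "M ^ (X + 1) > 0" using M by simp
    fix n :: nat assume n: "0 < n"
    have "card (small_primes X n) \<le> card {..X}" by (intro card_mono) auto
    then have "M ^ card (small_primes X n) \<le> M ^ (X + 1)" using M by (intro power_increasing) auto
    then have "M ^ card (small_primes X n) * real n powr e \<le> M ^ (X + 1) * real n powr e"
      by (intro mult_right_mono) auto
    then show "card {d. d dvd n} \<le> M ^ (X + 1) * real n powr e"
      using card_divisors_bound_aux[OF assms n] unfolding M_def X_def by linarith
  qed
qed

lemma int_dist_ge_min:
  assumes "0 \<le> x" "x \<le> 1"
  shows "int_dist x \<ge> min x (1 - x)"
proof (cases "round x \<le> 0")
  case True
  then have "real_of_int (round x) \<le> 0" by simp
  then show ?thesis using assms unfolding int_dist_round by linarith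
next
  case False
  then have "real_of_int (round x) \<ge> 1"
    by (metis not_le int_one_le_iff_zero_less of_int_1 of_int_le_iff)
  then show ?thesis using assms unfolding int_dist_round by linarith
qed

lemma harm_le: "0 < n \<Longrightarrow> harm n \<le> 1 + ln (real n)"
proof -
  assume "0 < n"
  then obtain k where "n = Suc k" by (cases n) auto
  then show ?thesis using decseqD[OF decseq_harm_diff_ln, of 0 k] by (simp add: harm_expand)
qed

section \<open>Interpolation of the Fourier transform between the integers\<close>

lemma sum_shift_periodic:
  fixes f :: "int \<Rightarrow> real"
  assumes "0 < M" "\<And>x. f (x mod int M) = f x"
  shows "(\<Sum>\<xi><M. f (int \<xi> - c)) = (\<Sum>\<xi><M. f (int \<xi>))"
proof (rule sum.reindex_bij_witness[of _ "\<lambda>\<xi>. nat ((int \<xi> + c) mod int M)" "\<lambda>\<xi>. nat ((int \<xi> - c) mod int M)"])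
  fix \<xi> assume \<xi>: "\<xi> \<in> {..<M}"
  show "nat ((int (nat ((int \<xi> - c) mod int M)) + c) mod int M) = \<xi>"
    using assms(1) \<xi> by (simp add: mod_add_left_eq)
  show "nat ((int (nat ((int \<xi> + c) mod int M)) - c) mod int M) = \<xi>"
    using assms(1) \<xi> by (simp add: mod_diff_left_eq)
  show "nat ((int \<xi> - c) mod int M) \<in> {..<M}" "nat ((int \<xi> + c) mod int M) \<in> {..<M}"
    using assms(1) by (auto simp: nat_less_iff)
  show "f (int (nat ((int \<xi> - c) mod int M))) = f (int \<xi> - c)" using assms by simp
qed

context missing_digits
begin

definition fourier_sum :: "nat \<Rightarrow> real" where
  "fourier_sum n = (\<Sum>l<p ^ n. norm (char_avg n (real l)))"

lemma fourier_sum_nonneg: "fourier_sum n \<ge> 0"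
  by (simp add: fourier_sum_def sum_nonneg)

lemma sum_ee_orthogonal:
  assumes "0 < N" "v < N" "w < N"
  shows "(\<Sum>l<N. ee (real l * ((real v - real w) / N))) = (if v = w then of_nat N else 0)"
proof (cases "v = w")
  case False
  define t where "t = (real v - real w) / N"
  have t: "0 < \<bar>t\<bar>" "\<bar>t\<bar> < 1" using assms False by (auto simp: t_def field_simps abs_if)
  then have "int_dist \<bar>t\<bar> > 0" using int_dist_ge_min[of "\<bar>t\<bar>"] by auto
  then have "ee \<bar>t\<bar> \<noteq> 1" using norm_ee_minus_1_ge[of "\<bar>t\<bar>"] by auto
  then have "ee t \<noteq> 1"
    by (cases "t \<ge> 0") (metis abs_of_nonneg, metis abs_of_neg cnj_ee complex_cnj_one linorder_not_le)
  moreover have "ee (real N * t) = 1"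
  proof -
    have "real N * t = of_int (int v - int w)" using assms(1) by (simp add: t_def)
    then show ?thesis by (metis ee_of_int)
  qed
  then have "norm (\<Sum>l<N. ee (real l * t)) * norm (ee t - 1) = 0"
    by (simp add: norm_sum_ee_geometric)
  ultimately show ?thesis using False by (simp add: t_def)
qed simp

text \<open>The normalised Dirichlet kernel: for positive \<open>N\<close> and integer
  \<open>z\<close> it is 1 if \<open>N\<close> divides \<open>z\<close> and 0 otherwise.\<close>

definition dirichlet :: "nat \<Rightarrow> real \<Rightarrow> complex" where
  "dirichlet N z = (\<Sum>v<N. ee (- (z * real v / real N))) / of_nat N"

text \<open>The frequencies occurring in \<^const>\<open>char_avg\<close> all lie in a window of length one, so its values at
  real arguments are interpolated from those at a full period of integers.\<close>

lemma char_avg_interpolation: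
  "char_avg n y = (\<Sum>l<p ^ n. char_avg n (real l) * dirichlet (p ^ n) (y - real l))"
proof -
  define N where "N = p ^ n"
  have N: "N > 0" by (simp add: N_def)
  have "(\<Sum>l<N. (\<Sum>w\<in>words n. ee (- (real l * real w / N))) * (\<Sum>v<N. ee (- ((y - real l) * real v / N))))
      = (\<Sum>l<N. \<Sum>w\<in>words n. \<Sum>v<N. ee (- (y * real v / N)) * ee (real l * ((real v - real w) / N)))"
    unfolding sum_product
    by (intro sum.cong refl) (simp add: algebra_simps diff_divide_distrib flip: ee_add)
  also have "\<dots> = (\<Sum>w\<in>words n. \<Sum>l<N. \<Sum>v<N. ee (- (y * real v / N)) * ee (real l * ((real v - real w) / N)))"
    by (rule sum.swap)
  also have "\<dots> = (\<Sum>w\<in>words n. \<Sum>v<N. ee (- (y * real v / N)) * (\<Sum>l<N. ee (real l * ((real v - real w) / N))))"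
    unfolding sum_distrib_left by (intro sum.cong refl sum.swap)
  also have "\<dots> = (\<Sum>w\<in>words n. \<Sum>v<N. if v = w then of_nat N * ee (- (y * real v / N)) else 0)"
  proof (intro sum.cong refl)
    fix w v assume "w \<in> words n" "v \<in> {..<N}"
    then show "ee (- (y * real v / N)) * (\<Sum>l<N. ee (real l * ((real v - real w) / N)))
        = (if v = w then of_nat N * ee (- (y * real v / N)) else 0)"
      using sum_ee_orthogonal[OF N, of v w] words_less[of w n] by (simp add: N_def)
  qed
  also have "\<dots> = (\<Sum>w\<in>words n. of_nat N * ee (- (y * real w / N)))"
    by (intro sum.cong refl) (auto simp: sum.delta N_def dest: words_less)
  finally have "(\<Sum>l<N. (\<Sum>w\<in>words n. ee (- (real l * real w / N))) * (\<Sum>v<N. ee (- ((y - real l) * real v / N))))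
      = of_nat N * (\<Sum>w\<in>words n. ee (- (y * real w / N)))"
    by (simp add: sum_distrib_left)
  moreover have "(\<Sum>l<p ^ n. char_avg n (real l) * dirichlet (p ^ n) (y - real l))
      = (\<Sum>l<N. (\<Sum>w\<in>words n. ee (- (real l * real w / N))) * (\<Sum>v<N. ee (- ((y - real l) * real v / N))))
        / (of_nat (m ^ n) * of_nat N)"
    unfolding char_avg_def dirichlet_def N_def sum_divide_distrib
    by (intro sum.cong refl) (simp flip: sum_divide_distrib)
  ultimately show ?thesis using N by (simp add: char_avg_def N_def)
qed

lemma norm_dirichlet_le_1: "0 < N \<Longrightarrow> norm (dirichlet N z) \<le> 1"
proof -
  assume "0 < N"
  moreover have "norm (\<Sum>v<N. ee (- (z * real v / real N))) \<le> real (card {..<N}) * 1"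
    by (rule sum_norm_bound) simp
  ultimately show ?thesis by (simp add: dirichlet_def norm_divide)
qed

lemma norm_dirichlet_le:
  assumes "0 < N" "int_dist (z / N) > 0"
  shows "norm (dirichlet N z) \<le> 1 / (2 * N * int_dist (z / N))"
proof -
  have "norm (\<Sum>v<N. ee (real v * (z / N))) * norm (ee (z / N) - 1) \<le> 2" by (rule norm_sum_ee_le)
  moreover have "norm (\<Sum>v<N. ee (real v * (z / N))) * (4 * int_dist (z / N))
     \<le> norm (\<Sum>v<N. ee (real v * (z / N))) * norm (ee (z / N) - 1)"
    by (intro mult_left_mono norm_ee_minus_1_ge) simp
  ultimately have *: "norm (\<Sum>v<N. ee (real v * (z / N))) * (4 * int_dist (z / N)) \<le> 2" by linarith
  have "(\<Sum>v<N. ee (- (z * real v / real N))) = cnj (\<Sum>v<N. ee (real v * (z / N)))"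
    by (simp add: cnj_ee mult.commute)
  then have "norm (dirichlet N z) = norm (\<Sum>v<N. ee (real v * (z / N))) / N"
    by (simp add: dirichlet_def norm_divide del: cnj_sum)
  then have "norm (dirichlet N z) * (2 * N * int_dist (z / N))
      = norm (\<Sum>v<N. ee (real v * (z / N))) * (4 * int_dist (z / N)) / 2"
    using assms(1) by simp
  then have "norm (dirichlet N z) * (2 * N * int_dist (z / N)) \<le> 1" using * by linarith
  then show ?thesis using assms by (simp add: pos_le_divide_eq)
qed

lemma dirichlet_periodic: "dirichlet N (z + of_int k * N) = dirichlet N z"
proof -
  have "ee (- ((z + of_int k * N) * real v / N)) = ee (- (z * real v / N))" if "v < N" for v
  proof -
    have "- ((z + of_int k * N) * real v / N) = - (z * real v / N) + of_int (- k * int v)"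
      using that by (simp add: field_simps)
    then show ?thesis by (metis ee_add_of_int)
  qed
  then show ?thesis by (simp add: dirichlet_def)
qed

text \<open>The logarithmic size of the mean absolute value of the Dirichlet kernel. At the grid
  point \<open>z / M\<close> the distance to the integers is at least the smaller of
  \<open>z / M\<close> and \<open>1 - z / M\<close>, so two harmonic sums appear. The grid has
  \<open>p ^ j\<close> points per unit, which gives the factor in front.\<close>

lemma sum_norm_dirichlet:
  "(\<Sum>z<p ^ (j + n). norm (dirichlet (p ^ n) (real z / p ^ j))) \<le> p ^ j * (2 + ln (p ^ (j + n)))"
proof -
  define M where "M = p ^ (j + n)"
  have M: "M \<ge> 1" by (simp add: M_def Suc_le_eq)
  have D: "norm (dirichlet (p ^ n) (real z / p ^ j)) \<le> p ^ j / 2 * (1 / z + 1 / (M - z))"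
    if "z \<in> {1..<M}" for z :: nat
  proof -
    have z: "1 \<le> z" "z < M" using that by auto
    have eq: "real z / p ^ j / real (p ^ n) = z / M" by (simp add: M_def power_add)
    have mi: "min (z / M) (1 - z / M) \<le> int_dist (z / M)" using z by (intro int_dist_ge_min) auto
    have pos: "min (z / M) (1 - z / M) > 0" using z by auto
    have "norm (dirichlet (p ^ n) (real z / p ^ j)) \<le> 1 / (2 * real (p ^ n) * int_dist (z / M))"
      using norm_dirichlet_le[of "p ^ n" "real z / p ^ j"] mi pos unfolding eq by simp
    also have "\<dots> \<le> 1 / (2 * real (p ^ n) * min (z / M) (1 - z / M))"
      using mi pos by (intro divide_left_mono mult_left_mono mult_pos_pos) auto
    also have "\<dots> = 1 / (2 * real (p ^ n)) * (1 / min (z / M) (1 - z / M))" by simp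
    also have "\<dots> \<le> 1 / (2 * real (p ^ n)) * (M / z + M / (M - z))"
    proof (intro mult_left_mono)
      have "1 - z / M = real (M - z) / M" using z by (simp add: field_simps of_nat_diff)
      then show "1 / min (z / M) (1 - z / M) \<le> M / z + M / (M - z)" using z by (auto simp: min_def)
    qed simp
    also have "\<dots> = p ^ j / 2 * (1 / z + 1 / (M - z))" by (simp add: M_def power_add field_simps)
    finally show ?thesis .
  qed
  have "(\<Sum>z<M. norm (dirichlet (p ^ n) (real z / p ^ j)))
      = norm (dirichlet (p ^ n) (real 0 / p ^ j)) + (\<Sum>z\<in>{1..<M}. norm (dirichlet (p ^ n) (real z / p ^ j)))"
    using M by (simp add: lessThan_atLeast0 sum.atLeast_Suc_lessThan)
  also have "\<dots> \<le> 1 + (\<Sum>z\<in>{1..<M}. p ^ j / 2 * (1 / z + 1 / (M - z)))"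
    by (intro add_mono sum_mono D norm_dirichlet_le_1) auto
  also have "(\<Sum>z\<in>{1..<M}. p ^ j / 2 * (1 / z + 1 / (M - z)))
      = p ^ j / 2 * ((\<Sum>z\<in>{1..<M}. 1 / real z) + (\<Sum>z\<in>{1..<M}. 1 / real (M - z)))"
    by (simp add: sum.distrib sum_distrib_left distrib_left)
  also have "(\<Sum>z\<in>{1..<M}. 1 / real (M - z)) = (\<Sum>z\<in>{1..<M}. 1 / real z)"
    by (rule sum.reindex_bij_witness[of _ "\<lambda>z. M - z" "\<lambda>z. M - z"]) auto
  also have "(\<Sum>z\<in>{1..<M}. 1 / real z) \<le> harm M"
    unfolding harm_def by (auto intro!: sum_mono2 simp: inverse_eq_divide)
  also have "harm M \<le> 1 + ln (real M)" using M by (intro harm_le) auto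
  finally have "(\<Sum>z<M. norm (dirichlet (p ^ n) (real z / p ^ j))) \<le> 1 + p ^ j * (1 + ln (real M))"
    by (simp add: mult_left_mono distrib_left)
  also have "\<dots> \<le> p ^ j * (2 + ln (real M))" by (simp add: algebra_simps Suc_le_eq)
  finally show ?thesis by (simp add: M_def)
qed

text \<open>By periodicity every integer sample sees the same total kernel mass, so the
  interpolation formula costs only that mass. The factor \<open>p ^ j\<close> is the reason why only
  cylinders of level at most \<open>\<gamma> L\<close> can be treated.\<close>

lemma sum_norm_char_avg_le:
  "(\<Sum>\<xi><p ^ (j + n). norm (char_avg n (\<xi> / p ^ j))) \<le> p ^ j * (2 + ln (p ^ (j + n))) * fourier_sum n"
proof -
  define M where "M = p ^ (j + n)"
  define f where "f x = norm (dirichlet (p ^ n) (of_int x / p ^ j))" for x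
  have M: "M > 0" by (simp add: M_def)
  have f_mod: "f (x mod int M) = f x" for x
  proof -
    have "of_int x / real p ^ j = of_int (x mod int M) / real p ^ j + of_int (x div int M) * real (p ^ n)"
    proof -
      have "real_of_int x = of_int (x mod int M + (x div int M) * int M)" by simp
      also have "\<dots> = of_int (x mod int M) + of_int (x div int M) * real M"
        by (simp only: of_int_add of_int_mult of_int_of_nat_eq)
      finally show ?thesis by (simp add: M_def power_add field_simps)
    qed
    then show ?thesis
      unfolding f_def using dirichlet_periodic[of "p ^ n" "of_int (x mod int M) / real p ^ j" "x div int M"]
      by simp
  qed
  have "(\<Sum>\<xi><M. norm (char_avg n (\<xi> / p ^ j)))
      \<le> (\<Sum>\<xi><M. \<Sum>l<p ^ n. norm (char_avg n (real l)) * f (int \<xi> - int (l * p ^ j)))"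
  proof (rule sum_mono)
    fix \<xi> assume "\<xi> \<in> {..<M}"
    have "norm (char_avg n (\<xi> / p ^ j))
        \<le> (\<Sum>l<p ^ n. norm (char_avg n (real l) * dirichlet (p ^ n) (\<xi> / p ^ j - real l)))"
      by (subst char_avg_interpolation) (rule norm_sum)
    also have "\<dots> = (\<Sum>l<p ^ n. norm (char_avg n (real l)) * f (int \<xi> - int (l * p ^ j)))"
      by (intro sum.cong refl) (simp add: f_def norm_mult diff_divide_distrib)
    finally show "norm (char_avg n (\<xi> / p ^ j))
        \<le> (\<Sum>l<p ^ n. norm (char_avg n (real l)) * f (int \<xi> - int (l * p ^ j)))" .
  qed
  also have "\<dots> = (\<Sum>l<p ^ n. norm (char_avg n (real l)) * (\<Sum>\<xi><M. f (int \<xi> - int (l * p ^ j))))"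
    by (subst sum.swap) (simp add: sum_distrib_left)
  also have "\<dots> = (\<Sum>l<p ^ n. norm (char_avg n (real l)) * (\<Sum>\<xi><M. f (int \<xi>)))"
    by (intro sum.cong refl arg_cong2[of _ _ _ _ "(*)"] sum_shift_periodic M f_mod)
  also have "\<dots> = (\<Sum>\<xi><M. f (int \<xi>)) * fourier_sum n"
    by (simp add: fourier_sum_def sum_distrib_left mult.commute)
  also have "(\<Sum>\<xi><M. f (int \<xi>)) \<le> p ^ j * (2 + ln (p ^ (j + n)))"
    using sum_norm_dirichlet[where j = j and n = n] by (simp add: f_def M_def)
  finally show ?thesis by (simp add: M_def mult_right_mono fourier_sum_nonneg)
qed

lemma err_bound:
  assumes "0 \<le> \<beta>" "\<beta> < 1 / 2" "0 \<le> C" "\<And>n. fourier_sum n \<le> C * p powr (n * \<beta>)"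
  obtains \<gamma> C' :: real where "0 < \<gamma>" "\<gamma> < 1 / 2" "0 < C'"
    "\<And>j n. real j \<le> \<gamma> * (j + n) \<Longrightarrow> err j n \<le> C' * p powr ((j + n) * (1 / 2 - \<gamma>))"
proof -
  \<comment> \<open>The gap between \<open>\<beta>\<close> and 1/2 is cut into four: one part each
    for the divisor bound, the factor \<open>p ^ j\<close> and the logarithm, and one is kept as the
    saving.\<close>
  define \<gamma> where "\<gamma> = (1 / 2 - \<beta>) / 4"
  have \<gamma>: "0 < \<gamma>" "\<gamma> < 1 / 2" using assms by (auto simp: \<gamma>_def)
  obtain C1 where C1: "C1 > 0" "\<And>n. 0 < n \<Longrightarrow> card {d. d dvd n} \<le> C1 * real n powr \<gamma>"
    using card_divisors_bound[OF \<gamma>(1)] by metis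
  have lnp: "ln (real p) > 0" using p_ge by simp
  have "err j n \<le> C1 * (2 + 1 / \<gamma>) * (C + 1) * p powr ((j + n) * (1 / 2 - \<gamma>))"
    if j: "real j \<le> \<gamma> * (j + n)" for j n
  proof -
    define L where "L = j + n"
    have "err j n \<le> (\<Sum>\<xi>\<in>{1..<p ^ L}. C1 * p powr (\<gamma> * L) * norm (char_avg n (\<xi> / p ^ j)))"
      unfolding err_def L_def[symmetric]
    proof (intro sum_mono mult_right_mono)
      fix \<xi> assume \<xi>: "\<xi> \<in> {1..<p ^ L}"
      have "card {d. d dvd \<xi>} \<le> C1 * real \<xi> powr \<gamma>" using \<xi> by (intro C1) auto
      also have "\<dots> \<le> C1 * real (p ^ L) powr \<gamma>"
        using \<xi> \<gamma> C1 by (intro mult_left_mono powr_mono2) (auto simp del: of_nat_power)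
      also have "real (p ^ L) powr \<gamma> = p powr (\<gamma> * L)"
        by (simp add: powr_powr mult.commute flip: powr_realpow)
      finally show "card {d. d dvd \<xi>} \<le> C1 * p powr (\<gamma> * L)" .
    qed simp
    also have "\<dots> \<le> C1 * p powr (\<gamma> * L) * (\<Sum>\<xi><p ^ L. norm (char_avg n (\<xi> / p ^ j)))"
      unfolding sum_distrib_left using C1 by (intro sum_mono2) auto
    also have "(\<Sum>\<xi><p ^ L. norm (char_avg n (\<xi> / p ^ j))) \<le> p ^ j * (2 + ln (p ^ L)) * fourier_sum n"
      unfolding L_def by (rule sum_norm_char_avg_le)
    also have "p ^ j * (2 + ln (p ^ L)) * fourier_sum n
        \<le> p powr (\<gamma> * L) * ((2 + 1 / \<gamma>) * p powr (\<gamma> * L)) * ((C + 1) * p powr (L * \<beta>))"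
    proof (intro mult_mono)
      have "real p ^ j = p powr j" by (simp add: powr_realpow)
      also have "\<dots> \<le> p powr (\<gamma> * L)" using j p_ge by (intro powr_mono) (auto simp: L_def)
      finally show "real (p ^ j) \<le> p powr (\<gamma> * L)" by simp
      define x where "x = L * ln (real p)"
      have x: "ln (p ^ L) = x" "p powr (\<gamma> * L) = exp (\<gamma> * x)"
        by (auto simp: x_def ln_realpow powr_def mult_ac)
      have "1 + \<gamma> * x \<le> exp (\<gamma> * x)" by (rule exp_ge_add_one_self)
      moreover have x0: "x \<ge> 0" using lnp by (simp add: x_def)
      then have "1 \<le> exp (\<gamma> * x)" using \<gamma> by simp
      moreover have "\<gamma> * x \<le> exp (\<gamma> * x)" using calculation by linarith
      then have "x \<le> 1 / \<gamma> * exp (\<gamma> * x)" using \<gamma> by (simp add: field_simps)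
      ultimately show "2 + ln (p ^ L) \<le> (2 + 1 / \<gamma>) * p powr (\<gamma> * L)"
        unfolding x distrib_right by linarith
      show "0 \<le> 2 + ln (real (p ^ L))" using x0 x(1) by simp
      have "fourier_sum n \<le> C * p powr (n * \<beta>)" by (rule assms)
      also have "\<dots> \<le> (C + 1) * p powr (L * \<beta>)"
        using assms p_ge by (intro mult_mono powr_mono mult_right_mono) (auto simp: L_def)
      finally show "fourier_sum n \<le> (C + 1) * p powr (L * \<beta>)" .
    qed (auto simp: fourier_sum_nonneg \<gamma> less_imp_le)
    also have "C1 * p powr (\<gamma> * L) * (p powr (\<gamma> * L) * ((2 + 1 / \<gamma>) * p powr (\<gamma> * L)) * ((C + 1) * p powr (L * \<beta>)))
        = C1 * (2 + 1 / \<gamma>) * (C + 1) * (p powr (\<gamma> * L) * p powr (\<gamma> * L) * p powr (\<gamma> * L) * p powr (L * \<beta>))"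
      by (simp add: mult_ac)
    also have "p powr (\<gamma> * L) * p powr (\<gamma> * L) * p powr (\<gamma> * L) * p powr (L * \<beta>) = p powr (L * (1 / 2 - \<gamma>))"
    proof -
      have "\<gamma> * L + \<gamma> * L + \<gamma> * L + L * \<beta> = L * (1 / 2 - \<gamma>)" by (simp add: \<gamma>_def field_simps)
      then show ?thesis by (simp only: powr_add[symmetric])
    qed
    finally show ?thesis using C1 by (simp add: L_def mult_left_mono)
  qed
  then show ?thesis
    using that[of \<gamma> "C1 * (2 + 1 / \<gamma>) * (C + 1)"] \<gamma> C1 assms by (simp add: add_pos_pos)
qed

end

section \<open>Counting points near rationals\<close>

lemma card_multiples_le:
  fixes b Q :: nat
  assumes "0 < b"
  shows "card {q \<in> {Q<..2 * Q}. b dvd q} \<le> 2 * Q / b"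
proof -
  have "{q \<in> {Q<..2 * Q}. b dvd q} \<subseteq> (\<lambda>k. b * k) ` {1..2 * Q div b}"
    using assms by (auto simp: dvd_def image_iff less_eq_div_iff_mult_less_eq mult.commute Suc_le_eq intro!: Nat.gr0I)
  then have "card {q \<in> {Q<..2 * Q}. b dvd q} \<le> card {1..2 * Q div b}"
    by (meson card_image_le card_mono finite_atLeastAtMost finite_imageI le_trans)
  also have "real \<dots> \<le> 2 * Q / b"
    using real_of_nat_div[of "2 * Q" b] of_nat_div_le_of_nat[of "2 * Q" b, where ?'a = real] by simp
  finally show ?thesis by simp
qed

context missing_digits
begin

text \<open>Markov's inequality for the nonnegative Fejer kernel, which is at least
  \<open>R / 4\<close> at every counted point.\<close>

lemma card_near_le:
  fixes j n q u R :: nat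
  assumes "0 < R"
  shows "card {v \<in> words n. int_dist (real q * (real (p ^ n * u + v) / p ^ (j + n))) \<le> 1 / (6 * R)}
    \<le> 4 / R * (m ^ n * (1 + 2 * (\<Sum>k\<in>{1..<R}. norm (char_avg n (real k * q / p ^ j)))))"
proof -
  define x where "x v = real q * (real (p ^ n * u + v) / p ^ (j + n))" for v
  define A where "A = {v \<in> words n. int_dist (x v) \<le> 1 / (6 * R)}"
  have "card A * (R / 4) = (\<Sum>v\<in>A. R / 4)" by simp
  also have "\<dots> \<le> (\<Sum>v\<in>A. fejer R (x v))" using assms by (intro sum_mono fejer_ge) (auto simp: A_def)
  also have "\<dots> \<le> (\<Sum>v\<in>words n. fejer R (x v))" by (intro sum_mono2) (auto simp: A_def fejer_nonneg)
  also have "\<dots> \<le> m ^ n * (1 + 2 * (\<Sum>k\<in>{1..<R}. norm (char_avg n (real k * q / p ^ j))))"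
    using fejer_sum_extensions[OF assms, where n = n and q = q and u = u and j = j]
    by (simp add: x_def distrib_left abs_le_iff)
  finally show ?thesis using assms by (simp add: A_def x_def field_simps)
qed

abbreviation near_words :: "nat \<Rightarrow> nat \<Rightarrow> real \<Rightarrow> nat set" where
  "near_words i L \<theta> \<equiv> {w \<in> words L. \<exists>q\<in>{p ^ i..<p ^ (i + 1)}. int_dist (real q * (real w / p ^ L)) \<le> \<theta>}"

text \<open>A union bound suffices from above. The errors of the individual denominators together
  make up at most one \<open>err 0 L\<close>.\<close>

lemma card_near_union_le:
  fixes i L R :: nat and \<theta> :: real
  assumes "0 < R" "p ^ (i + 1) * R \<le> p ^ L" "\<theta> \<le> 1 / (6 * R)"
  shows "card (near_words i L \<theta>)
    \<le> 4 / R * (m ^ L * (p ^ (i + 1) + 2 * err 0 L))"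
proof -
  define A where "A q = {w \<in> words L. int_dist (real q * (real w / p ^ L)) \<le> 1 / (6 * R)}" for q
  define e where "e q = (\<Sum>k\<in>{1..<R}. norm (char_avg L (real k * q / p ^ 0)))" for q :: nat
  have "near_words i L \<theta>
      \<subseteq> (\<Union>q\<in>{p ^ i..<p ^ (i + 1)}. A q)"
    using assms(3) by (force simp: A_def)
  then have "card (near_words i L \<theta>)
      \<le> card (\<Union>q\<in>{p ^ i..<p ^ (i + 1)}. A q)"
    by (intro card_mono) (auto simp: A_def)
  also have "\<dots> \<le> (\<Sum>q\<in>{p ^ i..<p ^ (i + 1)}. card (A q))" by (rule card_UN_le) simp
  also have "real \<dots> \<le> (\<Sum>q\<in>{p ^ i..<p ^ (i + 1)}. 4 / R * (m ^ L * (1 + 2 * e q)))"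
    unfolding of_nat_sum
  proof (rule sum_mono)
    fix q
    show "real (card (A q)) \<le> 4 / R * (m ^ L * (1 + 2 * e q))"
      using card_near_le[OF assms(1), of L q 0 0] by (simp add: A_def e_def)
  qed
  also have "\<dots> = 4 / R * (m ^ L * (card {p ^ i..<p ^ (i + 1)} + 2 * (\<Sum>q\<in>{p ^ i..<p ^ (i + 1)}. e q)))"
    by (simp only: sum_distrib_left[symmetric] sum.distrib sum_constant mult_1_right)
  also have "\<dots> \<le> 4 / R * (m ^ L * (p ^ (i + 1) + 2 * err 0 L))"
  proof (intro mult_left_mono add_mono)
    show "(\<Sum>q\<in>{p ^ i..<p ^ (i + 1)}. e q) \<le> err 0 L"
      unfolding e_def
    proof (rule sum_char_avg_le_err)
      fix q assume "q \<in> {p ^ i..<p ^ (i + 1)}"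
      then have "q * R \<le> p ^ (i + 1) * R" by (intro mult_right_mono) auto
      then show "q * R \<le> p ^ (0 + L)" unfolding add_0 using assms(2) by (rule order_trans)
    qed auto
    show "real (card {p ^ i..<p ^ (i + 1)}) \<le> real (p ^ (i + 1))"
      by (simp only: of_nat_le_iff card_atLeastLessThan diff_le_self)
  qed auto
  finally show ?thesis by simp
qed

text \<open>Counting pairs \<open>(v, q)\<close> instead of points overcounts the points near a fraction of small
  denominator \<open>b\<close>, since every multiple of \<open>b\<close> is then a valid \<open>q\<close>. The pairs with \<open>b \<le> Q / 6144\<close> make up
  at most half of the total, and every point occurs in at most 12288 of the others.\<close>

lemma card_near_ge:
  fixes j n Q r u :: nat
  assumes Q: "0 < Q" and r: "4 * Q < r" and L: "32 * Q * r \<le> p ^ (j + n)" and err: "err j n \<le> Q / 25600"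
  shows "card {v \<in> words n. \<exists>q\<in>{Q<..2 * Q}. int_dist (real q * (real (p ^ n * u + v) / p ^ (j + n))) < 1 / r}
    \<ge> m ^ n * Q / (2000000 * r)"
proof -
  define x where "x v = real (p ^ n * u + v) / p ^ (j + n)" for v
  define G where "G = {v \<in> words n. \<exists>q\<in>{Q<..2 * Q}. int_dist (real q * x v) < 1 / r}"
  define P where "P = {(v, q) \<in> words n \<times> {Q<..2 * Q}. int_dist (real q * x v) < 1 / r}"
  \<comment> \<open>The fraction near \<open>x v\<close> has numerator \<open>a\<close> over
    \<open>q\<close>. Cancelling \<open>g\<close> leaves the reduced denominator \<open>b\<close>,
    by which the pairs are sorted.\<close>
  define a where "a v q = round (real q * x v)" for v and q :: nat
  define g where "g v q = nat (gcd (int q) (a v q))" for v and q :: nat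
  define b where "b v q = q div g v q" for v and q :: nat
  \<comment> \<open>6144 = 96 * 64: the term \<open>96 * B\<close> in the bound for the bad pairs is
    then at most \<open>Q / 64\<close>, half of the main term \<open>Q / 32\<close>.\<close>
  define B where "B = Q div 6144"
  have r0: "r > 0" using r by simp
  have finP: "finite P" by (rule finite_subset[of _ "words n \<times> {Q<..2 * Q}"]) (auto simp: P_def)
  have finG: "finite G" by (simp add: G_def)
  have PG: "v \<in> G" if "(v, q) \<in> P" for v q using that by (auto simp: P_def G_def)
  have g: "g v q > 0" "q = g v q * b v q" "b v q > 0" "b v q dvd q"
    "\<exists>a'. a v q = int (g v q) * a' \<and> coprime (int (b v q)) a'" if "(v, q) \<in> P" for v q
  proof -
    have q: "q > 0" using that by (auto simp: P_def)
    then show g0: "g v q > 0" by (simp add: g_def)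
    have gi: "int (g v q) = gcd (int q) (a v q)" by (simp add: g_def)
    have "int (g v q) dvd int q" unfolding gi by simp
    then have gq: "g v q dvd q" by simp
    then show qgb: "q = g v q * b v q" by (simp add: b_def)
    then show "b v q > 0" using q by (metis gr0I mult_0_right less_irrefl)
    show "b v q dvd q" using dvd_triv_right[of "b v q" "g v q"] qgb by simp
    have 1: "int (b v q) = int q div gcd (int q) (a v q)" by (simp add: b_def zdiv_int gi)
    have "coprime (int (b v q)) (a v q div gcd (int q) (a v q))"
      unfolding 1 using q by (intro div_gcd_coprime) auto
    moreover have "a v q = int (g v q) * (a v q div gcd (int q) (a v q))" unfolding gi by simp
    ultimately show "\<exists>a'. a v q = int (g v q) * a' \<and> coprime (int (b v q)) a'" by blast
  qed
  have total: "m ^ n * (Q / 32 - 3 / 16 * err j n) / r \<le> card P"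
  proof -
    have "m ^ n * (Q / 2 - 3 * err j n) \<le> (\<Sum>q\<in>{Q<..2 * Q}. \<Sum>v\<in>words n. minorant r (real q * x v))"
    proof -
      have "(\<Sum>q\<in>{Q<..2 * Q}. \<Sum>k\<in>{1..<16 * r}. norm (char_avg n (real k * q / p ^ j))) \<le> err j n"
      proof (rule sum_char_avg_le_err)
        fix q assume "q \<in> {Q<..2 * Q}"
        then have "q * (16 * r) \<le> (2 * Q) * (16 * r)" by (intro mult_right_mono) auto
        also have "\<dots> = 32 * Q * r" by simp
        finally show "q * (16 * r) \<le> p ^ (j + n)" using L by (rule order_trans)
      qed auto
      then have "m ^ n * (Q / 2 - 3 * err j n)
          \<le> m ^ n * (Q / 2 - 3 * (\<Sum>q\<in>{Q<..2 * Q}. \<Sum>k\<in>{1..<16 * r}. norm (char_avg n (real k * q / p ^ j))))"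
        by (intro mult_left_mono) auto
      also have "\<dots> = (\<Sum>q\<in>{Q<..2 * Q}. m ^ n * (1 / 2 - 3 * (\<Sum>k\<in>{1..<16 * r}. norm (char_avg n (real k * q / p ^ j)))))"
        by (simp only: sum_distrib_left[symmetric] sum_subtractf) simp
      also have "\<dots> \<le> (\<Sum>q\<in>{Q<..2 * Q}. \<Sum>v\<in>words n. minorant r (real q * x v))"
        unfolding x_def using minorant_sum_extensions[OF r0] by (intro sum_mono) auto
      finally show ?thesis .
    qed
    also have "\<dots> = (\<Sum>(v, q)\<in>words n \<times> {Q<..2 * Q}. minorant r (real q * x v))"
      by (subst sum.swap) (simp add: sum.cartesian_product)
    \<comment> \<open>The minorant is used here: a pair outside \<open>P\<close> contributes at most
      0, a pair in \<open>P\<close> at most \<open>16 * r\<close>.\<close>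
    also have "\<dots> \<le> (\<Sum>(v, q)\<in>words n \<times> {Q<..2 * Q}. if (v, q) \<in> P then 16 * real r else 0)"
    proof (rule sum_mono, clarify)
      fix v q assume "v \<in> words n" "q \<in> {Q<..2 * Q}"
      then show "minorant r (real q * x v) \<le> (if (v, q) \<in> P then 16 * real r else 0)"
        using minorant_le[of r "real q * x v"] minorant_nonpos[OF r0, of "real q * x v"]
        by (auto simp: P_def)
    qed
    also have "\<dots> = (\<Sum>z\<in>words n \<times> {Q<..2 * Q}. if z \<in> P then 16 * real r else 0)"
      by (intro sum.cong) auto
    also have "\<dots> = (\<Sum>z\<in>words n \<times> {Q<..2 * Q} \<inter> P. 16 * real r)"
      by (rule sum.inter_restrict[symmetric]) simp
    also have "words n \<times> {Q<..2 * Q} \<inter> P = P" by (auto simp: P_def)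
    finally show ?thesis using r0 by (simp add: field_simps)
  qed
  define Bad where "Bad = {(v, q) \<in> P. b v q \<le> B}"
  have bad: "card Bad \<le> 96 * (m ^ n * (B + 2 * err j n)) / r"
  proof -
    \<comment> \<open>Cancelling \<open>g = q / c\<close> divides the error by \<open>g\<close>, so
      \<open>x v\<close> is within \<open>c / (Q * r)\<close> of an integer after multiplication by
      \<open>c\<close>. The choice of \<open>R c\<close> makes \<open>1 / (6 * R c)\<close> at least
      that radius.\<close>
    define R where "R c = Q * r div (6 * c)" for c
    define A where "A c = {v \<in> words n. int_dist (real c * x v) \<le> 1 / (6 * R c)}" for c
    define M where "M c = {q \<in> {Q<..2 * Q}. c dvd q}" for c
    define e where "e c = (\<Sum>k\<in>{1..<R c}. norm (char_avg n (real k * c / p ^ j)))" for c :: nat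
    have R: "R c > 0" "real Q * real r / (12 * real c) \<le> real (R c)"
      "real (R c) \<le> real Q * real r / (6 * real c)" if "c \<in> {1..B}" for c
    proof -
      have c: "1 \<le> c" "6144 * c \<le> Q" using that by (auto simp: B_def)
      have "6 * c * 1 \<le> Q * r" using c r0 by (intro mult_mono) auto
      then have c6: "6 * c \<le> Q * r" by simp
      then show Rc: "R c > 0" using c by (simp add: R_def div_greater_zero_iff)
      have "Q * r < 6 * c * (R c + 1)"
        using dividend_less_times_div[of "6 * c" "Q * r"] c by (simp add: R_def)
      also have "\<dots> \<le> 6 * c * (2 * R c)" using Rc by (intro mult_left_mono) auto
      finally have "real (Q * r) \<le> real (6 * c * (2 * R c))" by (simp only: of_nat_le_iff)
      then show "real Q * real r / (12 * real c) \<le> real (R c)" using c by (simp add: field_simps)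
      have "6 * c * R c \<le> Q * r" unfolding R_def by simp
      then have "real (6 * c * R c) \<le> real (Q * r)" by (simp only: of_nat_le_iff)
      then show "real (R c) \<le> real Q * real r / (6 * real c)" using c by (simp add: field_simps)
    qed
    have "Bad \<subseteq> (\<Union>c\<in>{1..B}. A c \<times> M c)"
    proof clarify
      fix v q assume "(v, q) \<in> Bad"
      then have P: "(v, q) \<in> P" and "b v q \<le> B" by (auto simp: Bad_def)
      then have c: "b v q \<in> {1..B}" using g(3)[OF P] by auto
      obtain a' where a': "a v q = int (g v q) * a'"
        using g(5)[OF P] by auto
      have q: "Q < q" "q \<le> 2 * Q" "v \<in> words n" "int_dist (real q * x v) < 1 / r"
        using P by (auto simp: P_def)
      have qb: "real q = real (g v q) * real (b v q)" using g(2)[OF P] by (metis of_nat_mult)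
      have "real (g v q) * (real (b v q) * x v - of_int a') = real q * x v - of_int (a v q)"
        unfolding a' qb by (simp add: right_diff_distrib)
      then have "real (g v q) * \<bar>real (b v q) * x v - of_int a'\<bar> = \<bar>real q * x v - of_int (a v q)\<bar>"
        by (metis abs_mult abs_of_nat)
      also have "\<dots> < 1 / r" using q(4) by (simp add: int_dist_round a_def)
      finally have "\<bar>real (b v q) * x v - of_int a'\<bar> < 1 / (r * real (g v q))"
        using g(1)[OF P] r0 by (simp add: field_simps)
      also have "\<dots> = b v q / (r * real q)" unfolding qb using g(1,3)[OF P] by simp
      also have "\<dots> \<le> b v q / (r * real Q)"
        using q r0 Q by (intro divide_left_mono mult_left_mono) auto
      also have "\<dots> \<le> 1 / (6 * R (b v q))"
        using R(1,3)[OF c] g(3)[OF P] r0 Q by (simp add: field_simps)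
      finally have "int_dist (real (b v q) * x v) \<le> 1 / (6 * R (b v q))"
        using int_dist_le[of "real (b v q) * x v" a'] by linarith
      then show "(v, q) \<in> (\<Union>c\<in>{1..B}. A c \<times> M c)" using c q g(4)[OF P] by (auto simp: A_def M_def)
    qed
    then have "card Bad \<le> card (\<Union>c\<in>{1..B}. A c \<times> M c)" by (intro card_mono) (auto simp: A_def M_def)
    also have "\<dots> \<le> (\<Sum>c\<in>{1..B}. card (A c \<times> M c))" by (rule card_UN_le) simp
    also have "real \<dots> \<le> (\<Sum>c\<in>{1..B}. 96 / r * (m ^ n * (1 + 2 * e c)))"
      unfolding of_nat_sum
    proof (rule sum_mono)
      fix c assume c: "c \<in> {1..B}"
      have e0: "e c \<ge> 0" by (simp add: e_def sum_nonneg)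
      have "real (card (A c)) \<le> 4 / R c * (m ^ n * (1 + 2 * e c))"
        unfolding A_def e_def x_def by (rule card_near_le[OF R(1)[OF c]])
      also have "4 / real (R c) \<le> 4 / (real Q * real r / (12 * real c))"
        using R[OF c] Q r0 c by (intro divide_left_mono mult_pos_pos divide_pos_pos) auto
      finally have 1: "real (card (A c)) \<le> 4 / (real Q * real r / (12 * real c)) * (m ^ n * (1 + 2 * e c))"
        using e0 by (simp add: mult_right_mono)
      have 2: "real (card (M c)) \<le> 2 * Q / c"
        unfolding M_def using c by (intro card_multiples_le) auto
      \<comment> \<open>A smaller \<open>c\<close> has more multiples, but its points are confined
        to a smaller radius. The two effects cancel, leaving a bound whose main term does not depend
        on \<open>c\<close>.\<close>
      have "real (card (A c \<times> M c)) \<le> 4 / (real Q * real r / (12 * real c)) * (m ^ n * (1 + 2 * e c)) * (2 * Q / c)"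
        using mult_mono[OF 1 2] e0 by (simp add: card_cartesian_product)
      also have "\<dots> = 96 / r * (m ^ n * (1 + 2 * e c))" using c Q r0 by (simp add: field_simps)
      finally show "real (card (A c \<times> M c)) \<le> 96 / r * (m ^ n * (1 + 2 * e c))" .
    qed
    also have "\<dots> = 96 / r * (m ^ n * (B + 2 * (\<Sum>c\<in>{1..B}. e c)))"
      by (simp only: sum_distrib_left[symmetric] sum.distrib sum_constant card_atLeastAtMost) simp
    also have "\<dots> \<le> 96 / r * (m ^ n * (B + 2 * err j n))"
    proof (intro mult_left_mono add_left_mono)
      show "(\<Sum>c\<in>{1..B}. e c) \<le> err j n"
        unfolding e_def
      proof (rule sum_char_avg_le_err)
        fix c assume "c \<in> {1..B}"
        have "c * R c \<le> 6 * c * R c" by simp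
        also have "\<dots> \<le> Q * r" unfolding R_def by simp
        also have "\<dots> \<le> 32 * Q * r" by simp
        finally show "c * R c \<le> p ^ (j + n)" using L by linarith
      qed auto
    qed auto
    finally show ?thesis by simp
  qed
  have rest: "card (P - Bad) \<le> 12288 * card G"
  proof -
    have fib: "card {q. (v, q) \<in> P - Bad} \<le> 12288" for v
    proof (cases "{q. (v, q) \<in> P - Bad} = {}")
      case False
      then obtain q0 where q0: "(v, q0) \<in> P" "b v q0 > B" by (auto simp: Bad_def)
      define c where "c = b v q0"
      obtain a0 where a0: "a v q0 = int (g v q0) * a0" "coprime (int c) a0"
        using g(5)[OF q0(1)] unfolding c_def by auto
      have "{q. (v, q) \<in> P - Bad} \<subseteq> {q \<in> {Q<..2 * Q}. c dvd q}"
      proof clarify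
        fix q assume q: "(v, q) \<in> P"
        have near: "\<bar>of_int (a v q') - real q' * x v\<bar> < 1 / r" "0 < real q'" "real q' \<le> 2 * Q"
          if "(v, q') \<in> P" for q'
          using that by (auto simp: a_def P_def int_dist_round abs_minus_commute)
        have *: "real q0 * \<bar>of_int (a v q) - real q * x v\<bar> < 2 * Q * (1 / r)"
          "real q * \<bar>of_int (a v q0) - real q0 * x v\<bar> < 2 * Q * (1 / r)"
          using near[OF q] near[OF q0(1)] by (intro mult_le_less_imp_less; simp)+
        \<comment> \<open>Two fractions close to the same point coincide: their cross difference is
          an integer of size below \<open>4 * Q / r\<close>, and \<open>4 * Q < r\<close>. Hence all
          \<open>q\<close> occurring with \<open>v\<close> are multiples of one reduced
          denominator.\<close>
        have "of_int (a v q * int q0 - a v q0 * int q)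
            = real q0 * (of_int (a v q) - real q * x v) - real q * (of_int (a v q0) - real q0 * x v)"
          by (simp add: algebra_simps)
        also have "\<bar>\<dots>\<bar> \<le> real q0 * \<bar>of_int (a v q) - real q * x v\<bar> + real q * \<bar>of_int (a v q0) - real q0 * x v\<bar>"
          by (rule order_trans[OF abs_triangle_ineq4]) (simp add: abs_mult)
        also have "\<dots> < 2 * Q * (1 / r) + 2 * Q * (1 / r)" using * by (rule add_strict_mono)
        also have "\<dots> \<le> 1" using r r0 by (simp add: field_simps)
        finally have "\<bar>a v q * int q0 - a v q0 * int q\<bar> < 1" by linarith
        then have "a v q * int q0 = a v q0 * int q" by simp
        moreover have "int q0 = int (g v q0) * int c"
          using g(2)[OF q0(1)] unfolding c_def by (metis of_nat_mult)
        ultimately have "int (g v q0) * (a v q * int c) = int (g v q0) * (a0 * int q)"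
          using a0(1) by (simp add: algebra_simps)
        then have "a v q * int c = a0 * int q" using g(1)[OF q0(1)] by simp
        then have "int c dvd a0 * int q" by (metis dvd_triv_right)
        then have "int c dvd int q" using a0(2) by (simp add: coprime_dvd_mult_right_iff)
        then show "q \<in> {Q<..2 * Q} \<and> c dvd q" using q by (auto simp: P_def)
      qed
      then have "card {q. (v, q) \<in> P - Bad} \<le> card {q \<in> {Q<..2 * Q}. c dvd q}"
        by (intro card_mono) auto
      also have "real \<dots> \<le> 2 * Q / c" using q0(2) by (intro card_multiples_le) (auto simp: c_def)
      also have "\<dots> \<le> 12288"
      proof -
        have "B + 1 \<le> c" using q0(2) by (simp add: c_def)
        then have "Q \<le> 6144 * c" unfolding B_def by linarith
        then have "real Q \<le> 6144 * real c" by (metis of_nat_le_iff of_nat_mult of_nat_numeral)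
        then show ?thesis using q0(2) by (simp add: c_def field_simps)
      qed
      finally show ?thesis by simp
    qed (simp only: card.empty)
    define F where "F v = {q. (v, q) \<in> P - Bad}" for v
    have "P - Bad = Sigma G F" using PG by (auto simp: F_def)
    moreover have "finite (F v)" for v
      by (rule finite_subset[of _ "snd ` P"]) (use finP in \<open>force simp: F_def\<close>)+
    ultimately have "card (P - Bad) = (\<Sum>v\<in>G. card (F v))" using finG by (simp add: card_SigmaI)
    also have "\<dots> \<le> (\<Sum>v\<in>G. 12288)" by (intro sum_mono) (simp only: F_def fib)
    finally show ?thesis by simp
  qed
  have "Bad \<subseteq> P" by (auto simp: Bad_def)
  then have "card P = card (P - Bad) + card Bad"
    using finP by (metis card_Diff_subset card_mono finite_subset le_add_diff_inverse2)
  then have "real (card P) = real (card (P - Bad)) + real (card Bad)" by simp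
  moreover have "real (card (P - Bad)) \<le> 12288 * real (card G)"
    using rest by (metis of_nat_le_iff of_nat_mult of_nat_numeral)
  ultimately have "m ^ n * (Q / 32 - 3 / 16 * err j n) / r - 96 * (m ^ n * (B + 2 * err j n)) / r \<le> 12288 * real (card G)"
    using total bad by linarith
  also have "m ^ n * (Q / 32 - 3 / 16 * err j n) / r - 96 * (m ^ n * (B + 2 * err j n)) / r
      = m ^ n / r * (Q / 32 - 96 * B - (192 + 3 / 16) * err j n)"
    using r0 by (simp add: field_simps)
  finally have "m ^ n / r * (Q / 32 - 96 * B - (192 + 3 / 16) * err j n) \<le> 12288 * real (card G)" .
  \<comment> \<open>Of \<open>Q / 32\<close> the bad pairs take at most \<open>Q / 64\<close>, and
    the constant 25600 keeps the errors below \<open>Q / 128\<close>. Dividing the rest by the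
    multiplicity 12288 gives the final constant, as 128 * 12288 < 2000000.\<close>
  moreover have "m ^ n / r * (Q / 128) \<le> m ^ n / r * (Q / 32 - 96 * B - (192 + 3 / 16) * err j n)"
  proof (intro mult_left_mono)
    have "6144 * B \<le> Q" by (simp add: B_def)
    then have "6144 * real B \<le> real Q" by (metis of_nat_le_iff of_nat_mult of_nat_numeral)
    then show "Q / 128 \<le> Q / 32 - 96 * B - (192 + 3 / 16) * err j n" using err by simp
  qed auto
  ultimately have "m ^ n / r * (Q / 128) \<le> 12288 * real (card G)" by linarith
  moreover have "m ^ n * Q / (2000000 * r) * 12288 \<le> m ^ n / r * (Q / 128)"
    using r0 by (simp add: field_simps)
  ultimately show ?thesis unfolding G_def x_def by linarith
qed

end

section \<open>Hausdorff dimension\<close>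

lemma eventually_linear_ge:
  fixes \<alpha> :: real
  assumes "0 < \<alpha>"
  shows "\<forall>\<^sub>F L in sequentially. K \<le> \<alpha> * real L"
proof -
  have "\<forall>\<^sub>F L in sequentially. K / \<alpha> \<le> real L"
    by (rule eventually_sequentiallyI[of "nat \<lceil>K / \<alpha>\<rceil>"]) linarith
  then show ?thesis by eventually_elim (use assms in \<open>simp add: field_simps\<close>)
qed

lemma eventually_powr_ge:
  fixes \<alpha> b :: real
  assumes "0 < \<alpha>" "1 < b"
  shows "\<forall>\<^sub>F L in sequentially. K \<le> b powr (\<alpha> * real L)"
proof -
  have "\<forall>\<^sub>F L in sequentially. K \<le> (\<alpha> * ln b) * real L"
    using assms by (intro eventually_linear_ge) simp
  then show ?thesis
  proof eventually_elim
    case (elim L)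
    have "1 + \<alpha> * ln b * real L \<le> exp (\<alpha> * ln b * real L)" by (rule exp_ge_add_one_self)
    also have "\<dots> = b powr (\<alpha> * real L)" using assms by (simp add: powr_def mult_ac)
    finally show ?case using elim by linarith
  qed
qed

text \<open>Closed intervals, so that finite unions are compact; adjacent cylinders therefore share
  an endpoint.\<close>

definition cyl :: "nat \<Rightarrow> nat \<Rightarrow> nat \<Rightarrow> real set" where
  "cyl p n w = {real w / p ^ n..(real w + 1) / p ^ n}"

lemma compact_cyl: "compact (cyl p n w)"
  by (simp add: cyl_def)

lemma cyl_prefix:
  assumes "0 < p"
  shows "cyl p (j + i) w \<subseteq> cyl p j (w div p ^ i)"
proof -
  have pi: "p ^ i > 0" using assms by simp
  have "w div p ^ i * p ^ i \<le> w" by simp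
  then have "real (w div p ^ i) * p ^ i \<le> w" by (metis of_nat_le_iff of_nat_mult of_nat_power)
  then have 1: "real (w div p ^ i) / p ^ j \<le> real w / p ^ (j + i)"
    using assms by (simp add: field_simps power_add)
  have "w + 1 \<le> (w div p ^ i + 1) * p ^ i"
    using dividend_less_times_div[OF pi, of w] by (simp add: algebra_simps)
  then have "real (w + 1) \<le> real ((w div p ^ i + 1) * p ^ i)" by (simp only: of_nat_le_iff)
  then have "real (w + 1) / p ^ (j + i) \<le> real ((w div p ^ i + 1) * p ^ i) / p ^ (j + i)"
    by (rule divide_right_mono) simp
  also have "\<dots> = (real (w div p ^ i) + 1) / p ^ j"
    using assms by (simp only: power_add of_nat_mult of_nat_add of_nat_1 of_nat_power) simp
  finally have "(real w + 1) / p ^ (j + i) \<le> (real (w div p ^ i) + 1) / p ^ j"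
    by (simp add: add.commute)
  with 1 show ?thesis by (auto simp: cyl_def)
qed

section \<open>Monotonicity and covers of sets of Hausdorff measure zero\<close>

lemma hausdorff_premeasure_mono:
  assumes "A \<subseteq> B"
  shows "hausdorff_premeasure \<delta> s A \<le> hausdorff_premeasure \<delta> s B"
  unfolding hausdorff_premeasure_def using assms by (intro INF_superset_mono) auto

lemma hausdorff_measure_mono:
  assumes "A \<subseteq> B"
  shows "hausdorff_measure s A \<le> hausdorff_measure s B"
  unfolding hausdorff_measure_def using hausdorff_premeasure_mono[OF assms] by (intro SUP_mono) blast

lemma hausdorff_dim_mono:
  assumes "A \<subseteq> B"
  shows "hausdorff_dim A \<le> hausdorff_dim B"
  unfolding hausdorff_dim_def
proof (rule INF_superset_mono)
  show "{s. 0 \<le> s \<and> hausdorff_measure s B = 0} \<subseteq> {s. 0 \<le> s \<and> hausdorff_measure s A = 0}"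
    using hausdorff_measure_mono[OF assms] by (metis (mono_tags, lifting) Collect_mono le_zero_eq)
qed simp

lemma hausdorff_measure_0_cover:
  fixes A :: "'a::metric_space set"
  assumes "hausdorff_measure s A = 0" "0 < \<epsilon>"
  obtains U where "A \<subseteq> (\<Union>i. U i)" "\<And>i. bounded (U i)" "\<And>i. diameter (U i) \<le> 1"
    "(\<Sum>i::nat. ennreal (diam_pow s (U i))) < \<epsilon>"
proof -
  have "hausdorff_premeasure 1 s A \<le> hausdorff_measure s A"
    unfolding hausdorff_measure_def by (rule SUP_upper) simp
  then have "hausdorff_premeasure 1 s A < \<epsilon>" using assms by simp
  then show ?thesis using that unfolding hausdorff_premeasure_def INF_less_iff by blast
qed

text \<open>Compactness and counting arguments want open intervals of positive radius. Passing from
  \<open>\<tau>\<close> to a larger exponent leaves the sum controlled, since diameters are at most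
  1, and turns the convention for \<open>\<tau> = 0\<close> into an ordinary power.\<close>

lemma hausdorff_measure_0_interval_cover:
  fixes A :: "real set"
  assumes \<tau>: "0 \<le> \<tau>" "hausdorff_measure \<tau> A = 0" and \<tau>\<sigma>: "\<tau> < \<sigma>" and "0 < \<delta>"
  obtains x d where "A \<subseteq> (\<Union>i. {x i - d i<..<x i + d i})" "\<And>i::nat. 0 < d i" "\<And>i. d i \<le> 2"
    "\<And>M. (\<Sum>i<M. d i powr \<sigma>) \<le> \<delta>"
proof -
  define \<epsilon> where "\<epsilon> = \<delta> / 2"
  have \<epsilon>: "\<epsilon> > 0" "2 * \<epsilon> = \<delta>" using assms(4) by (auto simp: \<epsilon>_def)
  obtain U where U: "A \<subseteq> (\<Union>i. U i)" "\<And>i. bounded (U i)" "\<And>i. diameter (U i) \<le> 1"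
    "(\<Sum>i::nat. ennreal (diam_pow \<tau> (U i))) < ennreal \<epsilon>"
  proof (rule hausdorff_measure_0_cover[OF \<tau>(2), of "ennreal \<epsilon>"])
    show "0 < ennreal \<epsilon>" using \<epsilon>(1) by simp
  qed auto
  have dp0: "diam_pow \<tau> (U i) \<ge> 0" for i by (simp add: diam_pow_def)
  have "\<exists>x d. U i \<subseteq> {x - d<..<x + d} \<and> 0 < d \<and> d \<le> 2 \<and> d powr \<sigma> \<le> diam_pow \<tau> (U i) + \<epsilon> * (1 / 2) ^ Suc i" for i
  proof -
    define D where "D = diameter (U i)"
    have D: "0 \<le> D" "D \<le> 1" using U(2,3) by (auto simp: D_def diameter_ge_0)
    have D\<tau>: "D powr \<sigma> \<le> diam_pow \<tau> (U i)"
    proof (cases "U i = {} \<or> D = 0")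
      case False
      then have "D powr \<sigma> \<le> D powr \<tau>" using D \<tau>\<sigma> by (intro powr_mono') auto
      moreover have "D powr \<sigma> \<le> 1" using D \<tau> \<tau>\<sigma> by (intro powr_le1) auto
      ultimately show ?thesis using False by (simp add: diam_pow_def D_def)
    qed (use \<tau> in \<open>auto simp: D_def diam_pow_def\<close>)
    define e where "e = \<epsilon> * (1 / 2) ^ Suc i"
    have e: "e > 0" using \<epsilon> by (simp add: e_def)
    \<comment> \<open>The enlargement adds exactly \<open>e\<close> to the
      \<open>\<sigma>\<close>-th power, so it is summable over \<open>i\<close>, and sets of
      diameter 0 acquire a positive radius. Truncation at 2 keeps the radius above
      \<open>D \<le> 1\<close>.\<close>
    define d where "d = (D powr \<sigma> + e) powr (1 / \<sigma>)"
    have \<sigma>: "\<sigma> > 0" using \<tau> \<tau>\<sigma> by simp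
    have d\<sigma>: "d powr \<sigma> = D powr \<sigma> + e" using \<sigma> e by (simp add: d_def powr_powr add_nonneg_nonneg)
    have "D = (D powr \<sigma>) powr (1 / \<sigma>)" using \<sigma> D by (simp add: powr_powr)
    also have "\<dots> < d" unfolding d_def using \<sigma> e by (intro powr_less_mono2) auto
    finally have Dd: "D < d" .
    have "\<exists>x. U i \<subseteq> {x - min d 2<..<x + min d 2}"
    proof (cases "U i = {}")
      case False
      then obtain x where x: "x \<in> U i" by blast
      have "\<bar>y - x\<bar> < min d 2" if "y \<in> U i" for y
        using diameter_bounded_bound[OF U(2)[of i] that x] Dd D by (simp add: D_def dist_real_def)
      then have "U i \<subseteq> {x - min d 2<..<x + min d 2}" by (auto simp: abs_less_iff) (smt (verit))+
      then show ?thesis ..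
    qed auto
    moreover have "min d 2 powr \<sigma> \<le> d powr \<sigma>" using D Dd \<sigma> by (intro powr_mono2) auto
    then have "min d 2 powr \<sigma> \<le> diam_pow \<tau> (U i) + \<epsilon> * (1 / 2) ^ Suc i"
      using D\<tau> d\<sigma> by (simp add: e_def)
    moreover have "0 < min d 2" "min d 2 \<le> 2" using D Dd by auto
    ultimately show ?thesis by blast
  qed
  then obtain x d where xd: "\<And>i. U i \<subseteq> {x i - d i<..<x i + d i}" "\<And>i. 0 < d i" "\<And>i. d i \<le> 2"
    "\<And>i. d i powr \<sigma> \<le> diam_pow \<tau> (U i) + \<epsilon> * (1 / 2) ^ Suc i"
    by metis
  have sum_d: "(\<Sum>i<M. d i powr \<sigma>) \<le> 2 * \<epsilon>" for M
  proof -
    have "(\<Sum>i<M. ennreal (diam_pow \<tau> (U i))) \<le> (\<Sum>i. ennreal (diam_pow \<tau> (U i)))"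
      by (rule sum_le_suminf) auto
    then have "ennreal (\<Sum>i<M. diam_pow \<tau> (U i)) \<le> ennreal \<epsilon>"
      using U(4) dp0 by (simp add: sum_ennreal)
    then have "(\<Sum>i<M. diam_pow \<tau> (U i)) \<le> \<epsilon>" using \<epsilon>(1) by (simp add: ennreal_le_iff)
    moreover have "(\<Sum>i<M. (1 / 2 :: real) ^ Suc i) = 1 - (1 / 2) ^ M" by (induction M) auto
    then have "(\<Sum>i<M. \<epsilon> * (1 / 2) ^ Suc i) \<le> \<epsilon>"
      unfolding sum_distrib_left[symmetric] using \<epsilon>(1) by simp
    moreover have "(\<Sum>i<M. d i powr \<sigma>) \<le> (\<Sum>i<M. diam_pow \<tau> (U i) + \<epsilon> * (1 / 2) ^ Suc i)"
      by (intro sum_mono xd)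
    ultimately show ?thesis by (simp add: sum.distrib)
  qed
  show ?thesis
  proof (rule that)
    show "A \<subseteq> (\<Union>i. {x i - d i<..<x i + d i})" using U(1) xd(1) by blast
    show "(\<Sum>i<M. d i powr \<sigma>) \<le> \<delta>" for M using sum_d \<epsilon>(2) by simp
  qed (fact xd)+
qed

section \<open>A counting form of the mass distribution principle\<close>

lemma card_nat_interval_le:
  fixes \<alpha> \<beta> :: real
  assumes "\<alpha> \<le> \<beta>"
  shows "card {v::nat. \<alpha> < v \<and> v < \<beta>} \<le> \<beta> - \<alpha> + 1" "finite {v::nat. \<alpha> < v \<and> v < \<beta>}"
proof -
  have sub: "int ` {v::nat. \<alpha> < v \<and> v < \<beta>} \<subseteq> {\<lfloor>\<alpha>\<rfloor> + 1..\<lceil>\<beta>\<rceil> - 1}" by (auto; linarith)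
  then show "finite {v::nat. \<alpha> < v \<and> v < \<beta>}"
    by (meson finite_atLeastAtMost_int finite_imageD finite_subset inj_on_of_nat)
  have "card {v::nat. \<alpha> < v \<and> v < \<beta>} = card (int ` {v::nat. \<alpha> < v \<and> v < \<beta>})"
    by (simp add: card_image)
  also have "\<dots> \<le> card {\<lfloor>\<alpha>\<rfloor> + 1..\<lceil>\<beta>\<rceil> - 1}" using sub by (intro card_mono) auto
  also have "real \<dots> \<le> \<beta> - \<alpha> + 1" using assms by simp linarith
  finally show "card {v::nat. \<alpha> < v \<and> v < \<beta>} \<le> \<beta> - \<alpha> + 1" by simp
qed

text \<open>The first level whose cylinders are no longer than \<open>d\<close>; the level before it
  shows that they are not much shorter. At level 0, which has no predecessor,
  \<open>d \<le> 2 \<le> p\<close> takes over.\<close>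

lemma exists_scale:
  fixes p :: nat and d :: real
  assumes "2 \<le> p" "0 < d" "d \<le> 2"
  obtains j where "1 / p ^ j \<le> d" "d * p ^ j \<le> p" "\<And>i. 1 / p ^ i \<le> d \<Longrightarrow> j \<le> i"
proof -
  have ex: "\<exists>j. 1 / real p ^ j \<le> d"
  proof -
    have "\<exists>j. (1 / real p) ^ j < d" using assms by (intro real_arch_pow_inv) auto
    then show ?thesis by (auto simp: power_divide intro: less_imp_le)
  qed
  define j where "j = (LEAST j. 1 / real p ^ j \<le> d)"
  have j: "1 / real p ^ j \<le> d" unfolding j_def using ex by (rule LeastI_ex)
  have le: "j \<le> i" if "1 / real p ^ i \<le> d" for i unfolding j_def using that by (rule Least_le)
  have "d * p ^ j \<le> p"
  proof (cases j)
    case (Suc i)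
    then have "\<not> 1 / real p ^ i \<le> d" using le[of i] by auto
    then have "d * p ^ i \<le> 1" using assms by (simp add: field_simps)
    then have "real p * (d * p ^ i) \<le> real p * 1" by (intro mult_left_mono) auto
    then show ?thesis using Suc by (simp add: mult_ac)
  qed (use assms in simp)
  then show ?thesis using that[of j] j le by simp
qed

text \<open>At the first level with cylinders no longer than \<open>d\<close>, at most
  \<open>2 * p + 2\<close> of them can contain a counted point. Each holds at most
  \<open>C * d powr \<sigma>\<close> words by the hypothesis on prefixes.\<close>

lemma card_prefix_near_le:
  fixes p k :: nat and X :: "nat set" and C \<sigma> x d :: real
  assumes p: "2 \<le> p" and fin: "finite X" and d: "0 < d" "d \<le> 2" "1 / p ^ k \<le> d" and C: "0 \<le> C" and \<sigma>: "0 \<le> \<sigma>"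
    and count: "\<And>j v. j \<le> k \<Longrightarrow> card {w \<in> X. w div p ^ (k - j) = v} \<le> C * p powr (- \<sigma> * j)"
  shows "card {w \<in> X. \<bar>real w / p ^ k - x\<bar> < d} \<le> (2 * p + 2) * C * d powr \<sigma>"
proof -
  obtain j where j: "1 / p ^ j \<le> d" "d * p ^ j \<le> p" "\<And>i. 1 / p ^ i \<le> d \<Longrightarrow> j \<le> i"
    using exists_scale[OF p d(1,2)] by metis
  have jk: "j \<le> k" using j(3) d(3) by simp
  define V where "V = {v::nat. (x - d) * p ^ j - 1 < v \<and> v < (x + d) * p ^ j}"
  have le: "(x - d) * p ^ j - 1 \<le> (x + d) * p ^ j"
    using d by (intro order_trans[OF _ mult_right_mono[of "x - d" "x + d"]]) auto
  have finV: "finite V" and "card V \<le> (x + d) * p ^ j - ((x - d) * p ^ j - 1) + 1"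
    using card_nat_interval_le[OF le] unfolding V_def by auto
  then have "card V \<le> 2 * (d * p ^ j) + 2" by (simp add: algebra_simps)
  then have cV: "card V \<le> 2 * p + 2" using j(2) by linarith
  have "{w \<in> X. \<bar>real w / p ^ k - x\<bar> < d} \<subseteq> (\<Union>v\<in>V. {w \<in> X. w div p ^ (k - j) = v})"
  proof clarify
    fix w assume w: "w \<in> X" "\<bar>real w / p ^ k - x\<bar> < d"
    define i where "i = k - j"
    have k: "k = j + i" using jk by (simp add: i_def)
    have "real w / p ^ k \<in> cyl p k w" using p by (auto simp: cyl_def field_simps)
    then have "real w / p ^ k \<in> cyl p j (w div p ^ i)"
      using cyl_prefix[of p j i w] p unfolding k by auto
    then have *: "real (w div p ^ i) \<le> real w / p ^ k * p ^ j" "real w / p ^ k * p ^ j \<le> real (w div p ^ i) + 1"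
      using p unfolding cyl_def by (simp_all add: pos_divide_le_eq pos_le_divide_eq)
    have "real w / p ^ k * p ^ j < (x + d) * p ^ j" "(x - d) * p ^ j < real w / p ^ k * p ^ j"
      using w(2) p by (intro mult_strict_right_mono; simp)+
    with * have "w div p ^ i \<in> V" unfolding V_def by simp
    then show "w \<in> (\<Union>v\<in>V. {w \<in> X. w div p ^ (k - j) = v})" using w(1) by (auto simp: i_def)
  qed
  then have "card {w \<in> X. \<bar>real w / p ^ k - x\<bar> < d} \<le> card (\<Union>v\<in>V. {w \<in> X. w div p ^ (k - j) = v})"
    using fin by (intro card_mono) (auto intro: finite_subset)
  also have "\<dots> \<le> (\<Sum>v\<in>V. card {w \<in> X. w div p ^ (k - j) = v})" using finV by (rule card_UN_le)
  also have "real \<dots> \<le> (\<Sum>v\<in>V. C * p powr (- \<sigma> * j))"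
    unfolding of_nat_sum by (intro sum_mono count jk)
  also have "\<dots> \<le> (2 * p + 2) * (C * p powr (- \<sigma> * j))" using cV C by (simp add: mult_right_mono)
  also have "p powr (- \<sigma> * j) = (1 / p ^ j) powr \<sigma>"
    using p by (simp add: powr_minus_divide powr_divide powr_powr mult.commute flip: powr_realpow)
  also have "(2 * p + 2) * (C * (1 / p ^ j) powr \<sigma>) \<le> (2 * p + 2) * (C * d powr \<sigma>)"
    using j(1) \<sigma> C by (intro mult_left_mono powr_mono2) auto
  finally show ?thesis by (simp add: mult.assoc)
qed

text \<open>A cover of the limit set by open intervals already covers all cylinders of some level, by compactness,
  so that counting cylinders of that level replaces the measure in the mass distribution principle.\<close>

lemma hausdorff_dim_tree_ge:
  fixes p :: nat and k :: "nat \<Rightarrow> nat" and X :: "nat \<Rightarrow> nat set" and C \<sigma> :: real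
  assumes p: "2 \<le> p" and k: "strict_mono k" and fin: "\<And>n. finite (X n)" and ne: "\<And>n. X n \<noteq> {}"
    and refine: "\<And>n w. w \<in> X (Suc n) \<Longrightarrow> w div p ^ (k (Suc n) - k n) \<in> X n"
    and C: "0 < C"
    and count: "\<And>n j v. j \<le> k n \<Longrightarrow> card {w \<in> X n. w div p ^ (k n - j) = v} \<le> C * card (X n) * p powr (- \<sigma> * j)"
  shows "ereal \<sigma> \<le> hausdorff_dim (\<Inter>n. \<Union>w\<in>X n. cyl p (k n) w)"
  unfolding hausdorff_dim_def
proof (rule INF_greatest, clarify)
  fix \<tau> :: real assume \<tau>: "0 \<le> \<tau>" "hausdorff_measure \<tau> (\<Inter>n. \<Union>w\<in>X n. cyl p (k n) w) = 0"
  define E where "E n = (\<Union>w\<in>X n. cyl p (k n) w)" for n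
  have compE: "compact (E n)" for n unfolding E_def using fin by (intro compact_UN compact_cyl)
  have E_Suc: "E (Suc n) \<subseteq> E n" for n
  proof -
    have "cyl p (k (Suc n)) w \<subseteq> cyl p (k n) (w div p ^ (k (Suc n) - k n))" for w
    proof -
      have "k (Suc n) = k n + (k (Suc n) - k n)" using strict_mono_less[OF k, of n "Suc n"] by simp
      then show ?thesis using cyl_prefix[of p "k n" "k (Suc n) - k n" w] p by simp
    qed
    then show ?thesis unfolding E_def using refine by blast
  qed
  have E_mono: "E n \<subseteq> E n'" if "n' \<le> n" for n n'
    using lift_Suc_antimono_le[of E, OF E_Suc that] .
  show "ereal \<sigma> \<le> ereal \<tau>"
  proof (rule ccontr)
    assume "\<not> ereal \<sigma> \<le> ereal \<tau>"
    then have \<tau>\<sigma>: "\<tau> < \<sigma>" by simp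
    have \<tau>E: "hausdorff_measure \<tau> (\<Inter>n. E n) = 0" using \<tau>(2) by (simp only: E_def)
    define K where "K = (2 * p + 2) * C"
    \<comment> \<open>\<open>K\<close> is the constant of \<open>card_prefix_near_le\<close>. With
      total \<open>\<sigma>\<close>-mass at most \<open>\<epsilon>\<close> the cover captures fewer
      than \<open>card (X n)\<close> words, although it covers them all.\<close>
    define \<epsilon> where "\<epsilon> = 1 / (K + 1)"
    have "K > 0" using C by (simp add: K_def)
    then have "\<epsilon> > 0" "K * \<epsilon> < 1" by (auto simp: \<epsilon>_def field_simps)
    then have \<epsilon>: "\<epsilon> > 0" "(2 * p + 2) * C * \<epsilon> < 1" by (auto simp: K_def)
    obtain x d where xd: "(\<Inter>n. E n) \<subseteq> (\<Union>i. {x i - d i<..<x i + d i})" "\<And>i::nat. 0 < d i" "\<And>i. d i \<le> 2"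
      and sum_d: "\<And>M. (\<Sum>i<M. d i powr \<sigma>) \<le> \<epsilon>"
      by (rule hausdorff_measure_0_interval_cover[OF \<tau>(1) \<tau>E \<tau>\<sigma> \<epsilon>(1)]) (rule that)
    have "\<exists>n. E n \<subseteq> (\<Union>i<n. {x i - d i<..<x i + d i})"
    proof (rule ccontr)
      assume no: "\<nexists>n. E n \<subseteq> (\<Union>i<n. {x i - d i<..<x i + d i})"
      have "(\<Inter>n. E n - (\<Union>i<n. {x i - d i<..<x i + d i})) \<noteq> {}"
      proof (rule compact_nest)
        show "compact (E n - (\<Union>i<n. {x i - d i<..<x i + d i}))" for n
          by (intro compact_diff compE open_UN) auto
        show "E n - (\<Union>i<n. {x i - d i<..<x i + d i}) \<noteq> {}" for n using no by blast
        show "E n - (\<Union>i<n. {x i - d i<..<x i + d i}) \<subseteq> E n' - (\<Union>i<n'. {x i - d i<..<x i + d i})"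
          if "n' \<le> n" for n n'
          using E_mono[OF that] that by (intro Diff_mono UN_mono) auto
      qed
      then obtain y where y: "\<And>n. y \<in> E n" "\<And>n. y \<notin> (\<Union>i<n. {x i - d i<..<x i + d i})" by blast
      then obtain i where "y \<in> {x i - d i<..<x i + d i}" using xd(1) by blast
      then show False using y(2)[of "Suc i"] by blast
    qed
    then obtain n0 where n0: "E n0 \<subseteq> (\<Union>i<n0. {x i - d i<..<x i + d i})" ..
    \<comment> \<open>Finitely many intervals have a smallest radius, so one level is fine enough to
      count words in all of them.\<close>
    have "\<exists>n\<ge>n0. \<forall>i<n0. 1 / p ^ k n \<le> d i"
    proof -
      have "\<forall>\<^sub>F n in sequentially. (1 / real p) ^ n < d i" for i
        using xd(2)[of i] p by (intro order_tendstoD(2)[OF LIMSEQ_realpow_zero]) auto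
      then have "\<forall>\<^sub>F n in sequentially. \<forall>i\<in>{..<n0}. (1 / real p) ^ n < d i"
        by (intro eventually_ball_finite) auto
      then have "\<forall>\<^sub>F n in sequentially. n \<ge> n0 \<and> (\<forall>i\<in>{..<n0}. (1 / real p) ^ n < d i)"
        by (intro eventually_conj eventually_ge_at_top)
      then obtain n where n: "n \<ge> n0" "\<forall>i\<in>{..<n0}. (1 / real p) ^ n < d i"
        using eventually_happens'[OF sequentially_bot] by blast
      have "1 / real p ^ k n \<le> (1 / real p) ^ n"
        using strict_mono_imp_increasing[OF k, of n] p by (simp add: power_divide frac_le power_increasing)
      then show ?thesis using n by (intro exI[of _ n]) force
    qed
    then obtain n where n: "n \<ge> n0" "\<And>i. i < n0 \<Longrightarrow> 1 / p ^ k n \<le> d i" by blast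
    define Y where "Y i = {w \<in> X n. \<bar>real w / p ^ k n - x i\<bar> < d i}" for i
    have "X n \<subseteq> (\<Union>i<n0. Y i)"
    proof
      fix w assume w: "w \<in> X n"
      have "real w / p ^ k n \<in> cyl p (k n) w" using p by (auto simp: cyl_def field_simps)
      then have "real w / p ^ k n \<in> E n0" using w E_mono[OF n(1)] unfolding E_def by blast
      then obtain i where "i < n0" "real w / p ^ k n \<in> {x i - d i<..<x i + d i}" using n0 by blast
      then show "w \<in> (\<Union>i<n0. Y i)" using w by (intro UN_I[of i]) (auto simp: Y_def abs_less_iff)
    qed
    then have "card (X n) \<le> card (\<Union>i<n0. Y i)" using fin by (intro card_mono) (auto simp: Y_def)
    also have "\<dots> \<le> (\<Sum>i<n0. card (Y i))" by (rule card_UN_le) simp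
    also have "real \<dots> \<le> (\<Sum>i<n0. (2 * p + 2) * (C * card (X n)) * d i powr \<sigma>)"
      unfolding of_nat_sum Y_def using C \<tau> \<tau>\<sigma> n xd(2,3)
      by (intro sum_mono card_prefix_near_le[OF p fin] count) auto
    also have "\<dots> = (2 * p + 2) * (C * card (X n)) * (\<Sum>i<n0. d i powr \<sigma>)"
      by (simp add: sum_distrib_left)
    also have "\<dots> \<le> (2 * p + 2) * (C * card (X n)) * \<epsilon>" using sum_d C by (intro mult_left_mono) auto
    also have "\<dots> = card (X n) * ((2 * p + 2) * C * \<epsilon>)" by simp
    also have "\<dots> < real (card (X n)) * 1"
      using \<epsilon>(2) fin[of n] ne[of n] by (intro mult_strict_left_mono) (auto simp: card_gt_0_iff)
    finally show False by simp
  qed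
qed

section \<open>The lower bound for the limsup set\<close>

context missing_digits
begin

text \<open>Asked of the whole cylinder, so that every limit point inside it inherits the
  approximation.\<close>

abbreviation well_approx :: "real \<Rightarrow> nat \<Rightarrow> nat \<Rightarrow> nat \<Rightarrow> bool" where
  "well_approx c N L w \<equiv> \<exists>q>N. \<forall>x\<in>cyl p L w. int_dist (real q * x) \<le> real q powr (- 1 - c)"

text \<open>The permitted loss is measured by the final level \<open>L\<close>, uniformly in the
  prefix \<open>u\<close>, which may be any number because it only shifts phases.\<close>

abbreviation many_extensions :: "real \<Rightarrow> real \<Rightarrow> (nat \<Rightarrow> nat \<Rightarrow> bool) \<Rightarrow> nat \<Rightarrow> bool" where
  "many_extensions \<gamma> e P L \<equiv> \<forall>j u. j \<le> L \<longrightarrow> real j \<le> \<gamma> * L \<longrightarrow>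
    m ^ (L - j) * p powr (- e * L) \<le> card {v \<in> words (L - j). P L (p ^ (L - j) * u + v)}"

end

text \<open>Records the conclusion of \<open>err_bound\<close>, through which alone the hypothesis
  on the Fourier coefficients enters the two dimension bounds.\<close>

locale controlled_digits = missing_digits +
  fixes \<gamma> C :: real
  assumes \<gamma>: "0 < \<gamma>" "\<gamma> < 1 / 2" and C: "0 < C"
    and err: "\<And>j n. real j \<le> \<gamma> * (j + n) \<Longrightarrow> err j n \<le> C * p powr ((j + n) * (1 / 2 - \<gamma>))"
begin

text \<open>It says that the error \<open>p powr (L * (1 / 2 - \<gamma>))\<close> is of lower order
  than a denominator of size \<open>p powr (L / (2 + 2 * c))\<close>.\<close>

lemma exponent_bound:
  assumes "c \<le> \<gamma>"
  shows "(2 + 2 * c) * (1 / 2 - \<gamma>) < 1"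
proof -
  have "(2 + 2 * c) * (1 / 2 - \<gamma>) \<le> (2 + 2 * \<gamma>) * (1 / 2 - \<gamma>)"
    using \<gamma> assms by (intro mult_right_mono) auto
  also have "\<dots> = 1 - (\<gamma> + 2 * (\<gamma> * \<gamma>))" by (simp add: algebra_simps)
  also have "\<dots> < 1" using mult_pos_pos[OF \<gamma>(1) \<gamma>(1)] \<gamma> by linarith
  finally show ?thesis .
qed

text \<open>With \<open>Q\<close> about \<open>p powr (\<tau> * L)\<close> and \<open>r\<close>
  about \<open>p ^ L / Q\<close>, the radius \<open>1 / r\<close> is about
  \<open>Q powr (- 1 - 2 * c)\<close>. The second \<open>c\<close> is slack that absorbs the
  constants in comparison with \<open>q powr (- 1 - c)\<close>. The surviving proportion
  \<open>Q / r\<close> is about \<open>p powr (- 2 * c * \<tau> * L)\<close>, which beats the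
  allowed \<open>p powr (- 2 * c * L)\<close> because \<open>\<tau> < 1\<close>.\<close>

lemma eventually_many_well_approximable:
  assumes c: "0 < c" "c \<le> \<gamma>"
  shows "\<forall>\<^sub>F L in sequentially. many_extensions \<gamma> (2 * c) (well_approx c N) L"
proof -
  define \<tau> where "\<tau> = 1 / (2 + 2 * c)"
  have \<tau>: "0 < \<tau>" "\<tau> * (2 + 2 * c) = 1" using c by (auto simp: \<tau>_def)
  have p1: "1 < real p" using p_ge by simp
  have \<delta>: "\<tau> - (1 / 2 - \<gamma>) > 0" using exponent_bound[OF c(2)] c by (simp add: \<tau>_def field_simps)
  have "2 * c - c * (2 * \<tau>) > 0"
  proof -
    have "\<tau> < 1" using c by (simp add: \<tau>_def field_simps)
    then have "c * (2 * \<tau>) < c * 2" using c by (intro mult_strict_left_mono) auto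
    then show ?thesis by simp
  qed
  \<comment> \<open>In order: room for the powers of \<open>p\<close> lost to rounding, the error
    below \<open>Q / 25600\<close>, denominators above \<open>N\<close>, and the constant of
    \<open>card_near_ge\<close>.\<close>
  then have "\<forall>\<^sub>F L in sequentially. c + 8 \<le> (c * \<tau>) * real L
      \<and> C * 25600 * p \<le> p powr ((\<tau> - (1 / 2 - \<gamma>)) * real L)
      \<and> real N + 1 \<le> \<tau> * real L
      \<and> 2000000 \<le> p powr ((2 * c - c * (2 * \<tau>)) * real L)"
    using c \<tau> \<delta> p1 by (intro eventually_conj eventually_linear_ge eventually_powr_ge) auto
  then show ?thesis
  proof (eventually_elim, intro allI impI)
    fix L j u :: nat
    assume A: "c + 8 \<le> (c * \<tau>) * real L \<and> C * 25600 * p \<le> p powr ((\<tau> - (1 / 2 - \<gamma>)) * real L)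
      \<and> real N + 1 \<le> \<tau> * real L \<and> 2000000 \<le> p powr ((2 * c - c * (2 * \<tau>)) * real L)"
      and j: "j \<le> L" "real j \<le> \<gamma> * L"
    define a where "a = nat \<lfloor>\<tau> * L\<rfloor>"
    have a: "real a \<le> \<tau> * L" "\<tau> * L < real a + 1"
    proof -
      have "\<tau> * L \<ge> 0" using \<tau> by simp
      then show "real a \<le> \<tau> * L" "\<tau> * L < real a + 1" unfolding a_def by linarith+
    qed
    have \<tau>L: "2 * (\<tau> * L) + 2 * (c * \<tau> * L) = L"
    proof -
      have "2 * (\<tau> * L) + 2 * (c * \<tau> * L) = \<tau> * (2 + 2 * c) * L" by (simp add: algebra_simps)
      then show ?thesis using \<tau> by simp
    qed
    have ac: "real a * c \<le> c * \<tau> * L" using mult_right_mono[OF a(1), of c] c by (simp add: mult_ac)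
    have aL: "2 * real a + real a * c + c + 8 \<le> L" using a(1) ac \<tau>L A by linarith
    have "real a * c \<ge> 0" using c by simp
    then have "real (2 * a + 8) \<le> real L" using aL c by linarith
    then have aL': "2 * a + 8 \<le> L" by (simp only: of_nat_le_iff)
    have aN: "N \<le> a" using a A by linarith
    define Q where "Q = p ^ a"
    \<comment> \<open>The 4 makes room for the factor 32 in \<open>card_near_ge\<close>, as
      \<open>p ^ 4 \<ge> 81\<close>.\<close>
    define r where "r = p ^ (L - a - 4)"
    define n where "n = L - j"
    have L: "L = j + n" using j by (simp add: n_def)
    have Q0: "Q > 0" "r > 0" by (auto simp: Q_def r_def)
    have NQ: "N < Q" using aN less_exp[of a] power_mono[of 2 p a] p_ge unfolding Q_def by linarith
    have Qr: "32 * Q * r \<le> p ^ L"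
    proof -
      have "(32::nat) \<le> 3 ^ 4" by simp
      also have "\<dots> \<le> p ^ 4" using p_ge by (intro power_mono) auto
      finally have "32 * (Q * r) \<le> p ^ 4 * (Q * r)" by (intro mult_right_mono) auto
      also have "\<dots> = p ^ (4 + (a + (L - a - 4)))" by (simp only: Q_def r_def power_add)
      also have "4 + (a + (L - a - 4)) = L" using aL' by simp
      finally show ?thesis by simp
    qed
    have "3 ^ 2 \<le> p ^ 2" using p_ge by (intro power_mono) auto
    then have "4 < p ^ 2" by simp
    then have "4 * Q < p ^ 2 * Q" using Q0 by (intro mult_strict_right_mono) auto
    also have "\<dots> = p ^ (2 + a)" by (simp only: Q_def power_add)
    also have "\<dots> \<le> r" unfolding r_def using aL' p_ge by (intro power_increasing) auto
    finally have Q4r: "4 * Q < r" .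
    have errQ: "err j n \<le> Q / 25600"
    proof -
      have pw: "p powr (L * (1 / 2 - \<gamma>)) * p powr ((\<tau> - (1 / 2 - \<gamma>)) * L) = p powr (\<tau> * L)"
      proof -
        have "L * (1 / 2 - \<gamma>) + (\<tau> - (1 / 2 - \<gamma>)) * L = \<tau> * L" by (simp add: algebra_simps)
        then show ?thesis by (simp only: powr_add[symmetric])
      qed
      have "C * p powr (L * (1 / 2 - \<gamma>)) * (25600 * p) = p powr (L * (1 / 2 - \<gamma>)) * (C * 25600 * p)"
        by simp
      also have "\<dots> \<le> p powr (L * (1 / 2 - \<gamma>)) * p powr ((\<tau> - (1 / 2 - \<gamma>)) * L)"
        using A by (intro mult_left_mono) auto
      also have "\<dots> \<le> p powr (real a + 1)" unfolding pw using a p1 by (intro powr_mono) auto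
      also have "\<dots> = Q * p" using p1 by (simp add: Q_def powr_add powr_realpow)
      finally have "C * p powr (L * (1 / 2 - \<gamma>)) * 25600 \<le> Q"
        using p1 by (simp add: mult.assoc[symmetric])
      moreover have "err j n \<le> C * p powr (L * (1 / 2 - \<gamma>))"
        using err[of j n] j(2) unfolding L by simp
      ultimately show ?thesis by simp
    qed
    define x where "x v = real (p ^ n * u + v) / p ^ (j + n)" for v
    define G where "G = {v \<in> words n. \<exists>q\<in>{Q<..2 * Q}. int_dist (real q * x v) < 1 / r}"
    have G: "m ^ n * Q / (2000000 * r) \<le> card G"
      using card_near_ge[OF Q0(1) Q4r Qr[unfolded L] errQ] by (simp add: G_def x_def)
    have "m ^ n * p powr (- (2 * c) * L) \<le> m ^ n * Q / (2000000 * r)"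
    proof -
      have pr: "Q / r = p powr (2 * real a + 4 - L)"
      proof -
        have "2 * real a + 4 - L = real a - real (L - a - 4)" using aL' by simp
        moreover have "p powr (real a - real (L - a - 4)) = Q / r"
          using p1 by (simp add: Q_def r_def powr_diff powr_realpow)
        ultimately show ?thesis by metis
      qed
      have "p powr (- (2 * c) * L) * 2000000 \<le> p powr (- (2 * c) * L) * p powr ((2 * c - c * (2 * \<tau>)) * real L)"
        using A by (intro mult_left_mono) auto
      also have "\<dots> = p powr (- (2 * (c * \<tau> * L)))"
      proof -
        have "- (2 * c) * L + (2 * c - c * (2 * \<tau>)) * L = - (2 * (c * \<tau> * L))"
          by (simp add: algebra_simps)
        then show ?thesis by (simp only: powr_add[symmetric])
      qed
      also have "\<dots> \<le> Q / r" unfolding pr using \<tau>L a p1 by (intro powr_mono) auto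
      finally have "m ^ n * (p powr (- (2 * c) * L) * 2000000) \<le> m ^ n * (Q / r)"
        by (intro mult_left_mono) auto
      then show ?thesis using Q0 by (simp add: field_simps)
    qed
    also note G
    also have "card G \<le> card {v \<in> words (L - j). well_approx c N L (p ^ (L - j) * u + v)}"
    proof (intro card_mono subsetI CollectI conjI)
      fix v assume "v \<in> G"
      then obtain q where q: "v \<in> words n" "Q < q" "q \<le> 2 * Q" "int_dist (real q * x v) < 1 / r"
        by (auto simp: G_def)
      show "v \<in> words (L - j)" using q by (simp add: n_def)
      show "well_approx c N L (p ^ (L - j) * u + v)"
      proof (intro exI[of _ q] conjI ballI)
        show "N < q" using NQ q by simp
        fix y assume "y \<in> cyl p L (p ^ (L - j) * u + v)"
        then have "x v \<le> y" "y \<le> x v + 1 / p ^ L"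
          unfolding cyl_def x_def n_def[symmetric] L[symmetric] by (auto simp: add_divide_distrib)
        then have "\<bar>y - x v\<bar> \<le> 1 / p ^ L" by simp
        then have "real q * \<bar>y - x v\<bar> \<le> real (2 * Q) * (1 / p ^ L)"
          using q by (intro mult_mono) auto
        also have "\<dots> \<le> 1 / r"
        proof -
          have "2 * Q * r \<le> p ^ L" using Qr by simp
          then have "real (2 * Q * r) \<le> real (p ^ L)" by (simp only: of_nat_le_iff)
          then show ?thesis using Q0 by (simp add: field_simps)
        qed
        finally have "\<bar>real q * y - real q * x v\<bar> \<le> 1 / r"
          by (simp add: abs_mult flip: right_diff_distrib)
        then have "int_dist (real q * y) \<le> 2 / r"
          using int_dist_diff_le[of "real q * y" "real q * x v"] q(4) by simp
        also have "\<dots> \<le> p powr 1 * p powr (- real (L - a - 4))"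
          using p_ge p1 by (simp add: r_def powr_minus_divide powr_realpow divide_right_mono)
        also have "\<dots> = p powr (1 - real (L - a - 4))" unfolding powr_add[symmetric] by simp
        also have "\<dots> \<le> p powr (- ((real a + 1) * (1 + c)))"
        proof (rule powr_mono)
          have "real (L - a - 4) = real L - real a - 4" using aL' by simp
          moreover have "(real a + 1) * (1 + c) = real a + real a * c + 1 + c"
            by (simp add: algebra_simps)
          ultimately show "1 - real (L - a - 4) \<le> - ((real a + 1) * (1 + c))" using aL by linarith
        qed (use p1 in simp)
        also have "\<dots> = (p powr (real a + 1)) powr (- 1 - c)"
        proof -
          have "- ((real a + 1) * (1 + c)) = (real a + 1) * (- 1 - c)" by (simp add: algebra_simps)
          then show ?thesis by (simp only: powr_powr)
        qed
        also have "\<dots> \<le> real q powr (- 1 - c)"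
        proof (rule powr_mono2')
          have "2 * Q \<le> p * Q" using p_ge by (intro mult_right_mono) auto
          then have "q \<le> Q * p" unfolding mult.commute[of Q p] by (rule order_trans[OF q(3)])
          then have "real q \<le> real (Q * p)" by (simp only: of_nat_le_iff)
          then show "real q \<le> p powr (real a + 1)"
            using p1 by (simp add: Q_def powr_add powr_realpow)
        qed (use c q in auto)
        finally show "int_dist (real q * y) \<le> real q powr (- 1 - c)" .
      qed
    qed auto
    finally show "m ^ (L - j) * p powr (- (2 * c) * L) \<le> card {v \<in> words (L - j). well_approx c N L (p ^ (L - j) * u + v)}"
      by (simp add: n_def)
  qed
qed

end

context missing_digits
begin

text \<open>The similarity dimension; \<open>measure_hausdorff_dim_digit_law\<close> identifies it
  with the dimension of the measure.\<close>

definition dim :: real where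
  "dim = log p m"

lemma dim_pos: "0 < dim"
  unfolding dim_def using p_ge card_D_ge by simp

lemma powr_dim: "p powr (dim * real n) = m ^ n"
proof -
  have "p powr dim = m" using p_ge card_D_ge by (simp add: dim_def)
  then show ?thesis using p_ge by (simp add: powr_realpow flip: powr_powr)
qed

section \<open>The Cantor set of selected words\<close>

lemma card_words_prefix_le: "card {w \<in> words (j + i). w div p ^ i = v} \<le> m ^ i"
proof -
  have "{w \<in> words (j + i). w div p ^ i = v} \<subseteq> (\<lambda>t. p ^ i * v + t) ` words i"
    using words_append_div unfolding words_add by force
  then have "card {w \<in> words (j + i). w div p ^ i = v} \<le> card (words i)"
    by (meson card_image_le card_mono finite_imageI finite_words le_trans)
  then show ?thesis by (simp add: card_words)
qed

lemma card_extensions: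
  assumes "A \<subseteq> words k"
  shows "card {w \<in> words (k + i). w div p ^ i \<in> A} = card A * m ^ i"
proof -
  have "{w \<in> words (k + i). w div p ^ i \<in> A} = (\<lambda>(u, v). p ^ i * u + v) ` (A \<times> words i)"
    using words_append_div assms unfolding words_add by force
  then show ?thesis
    using card_image[OF inj_on_prefix[of i A]] by (simp add: card_cartesian_product card_words)
qed

text \<open>The last clause is the hypothesis of \<open>hausdorff_dim_tree_ge\<close> with constant
  1. The cardinality clause carries it to the next stage: at levels beyond \<open>k\<close> only
  trivial fibre bounds are available, and they are compared with the size of \<open>X\<close>. The
  factor 2 pays for the new loss \<open>e * L\<close> and all old ones.\<close>

definition admissible :: "real \<Rightarrow> real \<Rightarrow> nat \<Rightarrow> nat set \<Rightarrow> bool" where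
  "admissible e \<gamma> k X \<longleftrightarrow> X \<subseteq> words k \<and> X \<noteq> {} \<and> m ^ k * p powr (- (2 * e) * k) \<le> card X
    \<and> (\<forall>j v. j \<le> k \<longrightarrow> card {w \<in> X. w div p ^ (k - j) = v} \<le> card X * p powr (- (dim - 2 * e / \<gamma>) * j))"

text \<open>Between the levels \<open>k\<close> and \<open>\<gamma> L\<close> all extensions are kept; below that, every word is given the same
  number \<open>r\<close> of extensions of level \<open>L\<close> satisfying \<open>P\<close>.\<close>

lemma admissible_step:
  fixes \<gamma> e :: real and P :: "nat \<Rightarrow> nat \<Rightarrow> bool"
  assumes \<gamma>: "0 < \<gamma>" "\<gamma> \<le> 1" and e: "0 < e" and adm: "admissible e \<gamma> k X"
    and P: "\<forall>\<^sub>F L in sequentially. many_extensions \<gamma> e P L"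
  obtains L Y where "k < L" "admissible e \<gamma> L Y" "\<And>w. w \<in> Y \<Longrightarrow> w div p ^ (L - k) \<in> X \<and> P L w"
proof -
  have p1: "1 < real p" using p_ge by simp
  \<comment> \<open>Taking \<open>L\<close> beyond \<open>2 * k\<close> bounds the accumulated loss
    \<open>2 * e * k\<close> by \<open>e * L\<close>, so the invariant reproduces itself with the
    same \<open>e\<close>.\<close>
  have "\<forall>\<^sub>F L in sequentially. 2 * k + 1 \<le> L \<and> real k + 1 \<le> \<gamma> * real L \<and> many_extensions \<gamma> e P L"
    using \<gamma> P by (intro eventually_conj eventually_ge_at_top eventually_linear_ge)
  then obtain L where L: "2 * k + 1 \<le> L" "real k + 1 \<le> \<gamma> * real L"
    "\<And>j u. j \<le> L \<Longrightarrow> real j \<le> \<gamma> * L \<Longrightarrow>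
      m ^ (L - j) * p powr (- e * L) \<le> card {v \<in> words (L - j). P L (p ^ (L - j) * u + v)}"
    using eventually_happens'[OF sequentially_bot] by blast
  define j0 where "j0 = nat \<lfloor>\<gamma> * L\<rfloor>"
  have j0: "real j0 \<le> \<gamma> * L" "\<gamma> * L < real j0 + 1"
  proof -
    have "\<gamma> * L \<ge> 0" using \<gamma> by simp
    then show "real j0 \<le> \<gamma> * L" "\<gamma> * L < real j0 + 1" unfolding j0_def by linarith+
  qed
  have "real j0 \<le> 1 * L" using j0(1) mult_right_mono[OF \<gamma>(2), of "real L"] by linarith
  then have j0L: "j0 \<le> L" by simp
  have kj0: "k \<le> j0" using j0 L(2) by linarith
  define n where "n = L - j0"
  define i where "i = j0 - k"
  have j0i: "j0 = k + i" and Ln: "L = j0 + n" using kj0 j0L by (auto simp: n_def i_def)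
  \<comment> \<open>Equal numbers of extensions make fibre counts multiply exactly; unequal ones
    could concentrate words in a few cylinders.\<close>
  define r where "r = nat \<lceil>m ^ n * p powr (- e * L)\<rceil>"
  have r: "m ^ n * p powr (- e * L) \<le> r" unfolding r_def by linarith
  have r0: "r > 0" unfolding r_def using p1 by (simp add: zero_less_ceiling)
  have "\<exists>T. T \<subseteq> {v \<in> words n. P L (p ^ n * u + v)} \<and> card T = r" for u
  proof -
    have "m ^ n * p powr (- e * L) \<le> card {v \<in> words n. P L (p ^ n * u + v)}"
      using L(3)[OF j0L j0(1)] by (simp add: n_def)
    then have "r \<le> card {v \<in> words n. P L (p ^ n * u + v)}" unfolding r_def by linarith
    then show ?thesis by (rule obtain_subset_with_card_n) blast
  qed
  then obtain T where T: "\<And>u. T u \<subseteq> {v \<in> words n. P L (p ^ n * u + v)}" "\<And>u. card (T u) = r"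
    by metis
  have Tw: "T u \<subseteq> words n" for u using T(1) by blast
  have finT: "finite (T u)" for u by (rule finite_subset[OF Tw finite_words])
  define Z where "Z = {u \<in> words j0. u div p ^ i \<in> X}"
  have X: "X \<subseteq> words k" "X \<noteq> {}" "m ^ k * p powr (- (2 * e) * k) \<le> card X"
    "\<And>j v. j \<le> k \<Longrightarrow> card {w \<in> X. w div p ^ (k - j) = v} \<le> card X * p powr (- (dim - 2 * e / \<gamma>) * j)"
    using adm by (auto simp: admissible_def)
  have finZ: "finite Z" by (simp add: Z_def)
  have cardZ: "card Z = card X * m ^ i" unfolding Z_def j0i by (rule card_extensions[OF X(1)])
  define Y where "Y = (\<lambda>(u, v). p ^ n * u + v) ` (SIGMA u:Z. T u)"
  have inj: "inj_on (\<lambda>(u, v). p ^ n * u + v) (Sigma A T)" for A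
    by (rule inj_on_subset[OF inj_on_prefix[of n UNIV]]) (use Tw in blast)
  have card_sub: "card ((\<lambda>(u, v). p ^ n * u + v) ` Sigma A T) = card A * r" if "finite A" for A
    unfolding card_image[OF inj] using that finT T(2) by (simp add: card_SigmaI)
  have cardY: "card Y = card X * m ^ i * r"
    unfolding Y_def card_sub[OF finZ] cardZ ..
  have cX: "card X > 0" using X(1,2) by (meson card_gt_0_iff finite_subset finite_words)
  have Yw: "Y \<subseteq> words L" unfolding Y_def Ln using Tw by (auto simp: Z_def intro!: words_append)
  have lowY: "m ^ (k + i + n) * p powr (- (2 * e) * k - e * L) \<le> card Y"
  proof -
    have "m ^ k * p powr (- (2 * e) * k) * m ^ i * (m ^ n * p powr (- e * L)) \<le> real (card X) * m ^ i * r"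
      using X(3) r by (intro mult_mono) auto
    moreover have "m ^ k * p powr (- (2 * e) * k) * m ^ i * (m ^ n * p powr (- e * L))
        = m ^ (k + i + n) * p powr (- (2 * e) * k - e * L)"
    proof -
      have "p powr (- (2 * e) * k - e * L) = p powr (- (2 * e) * k) * p powr (- e * L)"
        unfolding powr_add[symmetric] by simp
      then show ?thesis by (simp add: power_add)
    qed
    ultimately show ?thesis unfolding cardY of_nat_mult of_nat_power by linarith
  qed
  have k2: "2 * e * k \<le> e * L" using L(1) e by simp
  have "admissible e \<gamma> L Y"
    unfolding admissible_def
  proof (intro conjI allI impI)
    show "Y \<subseteq> words L" by (fact Yw)
    show "Y \<noteq> {}" using cardY cX r0 by fastforce
    have le: "m ^ L * p powr (- (2 * e) * L) \<le> m ^ L * p powr (- (2 * e) * k - e * L)"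
      using k2 p1 by (intro mult_left_mono powr_mono) auto
    have "k + i + n = L" by (simp add: Ln j0i)
    from order_trans[OF le lowY[unfolded this]] show "m ^ L * p powr (- (2 * e) * L) \<le> card Y" .
    fix j v :: nat assume j: "j \<le> L"
    have pj: "p powr (- (dim - 2 * e / \<gamma>) * j) = p powr (2 * e / \<gamma> * j) / m ^ j"
    proof -
      have "- (dim - 2 * e / \<gamma>) * j = 2 * e / \<gamma> * j - dim * j" by (simp add: left_diff_distrib)
      then show ?thesis by (simp only: powr_diff powr_dim)
    qed
    show "card {w \<in> Y. w div p ^ (L - j) = v} \<le> card Y * p powr (- (dim - 2 * e / \<gamma>) * j)"
    \<comment> \<open>Three ranges of \<open>j\<close>. Up to \<open>k\<close> the old bound is
      multiplied through. From \<open>k\<close> to \<open>j0\<close> the tree is full, and only the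
      old loss \<open>2 * e * k \<le> 2 * e / \<gamma> * j\<close> remains. Beyond \<open>j0\<close>
      the total loss is at most \<open>2 * e * L\<close>, charged to
      \<open>j > \<gamma> * L\<close>; this is where \<open>\<gamma>\<close> enters the
      dimension.\<close>
    proof (cases "j \<le> j0")
      case True
      have "{w \<in> Y. w div p ^ (L - j) = v} = (\<lambda>(u, v). p ^ n * u + v) ` (SIGMA u:{u \<in> Z. u div p ^ (j0 - j) = v}. T u)"
      proof -
        have "(p ^ n * u + t) div p ^ (L - j) = u div p ^ (j0 - j)" if "t \<in> T u" for u t
        proof -
          have "L - j = n + (j0 - j)" using True by (simp add: Ln)
          then have "(p ^ n * u + t) div p ^ (L - j) = (p ^ n * u + t) div p ^ n div p ^ (j0 - j)"
            by (simp add: power_add div_mult2_eq)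
          then show ?thesis using words_append_div[of t n u] subsetD[OF Tw that] by simp
        qed
        then show ?thesis unfolding Y_def by force
      qed
      then have cY: "card {w \<in> Y. w div p ^ (L - j) = v} = card {u \<in> Z. u div p ^ (j0 - j) = v} * r"
        using card_sub finZ by simp
      have "card {u \<in> Z. u div p ^ (j0 - j) = v} \<le> card X * m ^ i * p powr (- (dim - 2 * e / \<gamma>) * j)"
      proof (cases "j \<le> k")
        case jk: True
        have "{u \<in> Z. u div p ^ (j0 - j) = v} = {u \<in> words (k + i). u div p ^ i \<in> {a \<in> X. a div p ^ (k - j) = v}}"
        proof -
          have "j0 - j = i + (k - j)" using jk by (simp add: j0i)
          then have "u div p ^ (j0 - j) = u div p ^ i div p ^ (k - j)" for u
            by (simp add: power_add div_mult2_eq)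
          then show ?thesis by (auto simp: Z_def j0i)
        qed
        then have "card {u \<in> Z. u div p ^ (j0 - j) = v} = card {a \<in> X. a div p ^ (k - j) = v} * m ^ i"
          using card_extensions[of "{a \<in> X. a div p ^ (k - j) = v}" k i] X(1) by auto
        moreover have "real (card {a \<in> X. a div p ^ (k - j) = v}) * m ^ i
            \<le> card X * p powr (- (dim - 2 * e / \<gamma>) * j) * m ^ i"
          by (intro mult_right_mono X(4) jk) simp
        ultimately show ?thesis by (simp add: mult_ac)
      next
        case jk: False
        have "{u \<in> Z. u div p ^ (j0 - j) = v} \<subseteq> {u \<in> words (j + (j0 - j)). u div p ^ (j0 - j) = v}"
          using True by (auto simp: Z_def)
        then have "card {u \<in> Z. u div p ^ (j0 - j) = v} \<le> card {u \<in> words (j + (j0 - j)). u div p ^ (j0 - j) = v}"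
          by (intro card_mono) auto
        also have "\<dots> \<le> m ^ (j0 - j)" by (rule card_words_prefix_le)
        finally have "card {u \<in> Z. u div p ^ (j0 - j) = v} \<le> m ^ (j0 - j)" .
        then have "real (card {u \<in> Z. u div p ^ (j0 - j) = v}) \<le> m ^ (j0 - j)"
          by (metis of_nat_le_iff)
        also have "\<dots> = m ^ k * m ^ i / m ^ j"
        proof -
          have "k + i = j + (j0 - j)" using True by (simp add: j0i)
          then have "real m ^ (k + i) = m ^ j * m ^ (j0 - j)" by (simp add: power_add)
          then show ?thesis by (simp add: power_add)
        qed
        also have "\<dots> = m ^ k * p powr (- (2 * e) * k) * (m ^ i * (p powr (2 * e * k) / m ^ j))"
          using p1 by (simp add: powr_minus)
        also have "\<dots> \<le> card X * (m ^ i * (p powr (2 * e / \<gamma> * j) / m ^ j))"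
        proof (rule mult_mono[OF X(3)])
          have "2 * e * k * \<gamma> \<le> 2 * e * j * 1" using \<gamma> e jk by (intro mult_mono) auto
          then have "2 * e * k \<le> 2 * e / \<gamma> * j" using \<gamma> by (simp add: field_simps)
          then show "m ^ i * (p powr (2 * e * k) / m ^ j) \<le> m ^ i * (p powr (2 * e / \<gamma> * j) / m ^ j)"
            using p1 by (intro mult_left_mono divide_right_mono powr_mono) auto
        qed auto
        finally show ?thesis unfolding pj by simp
      qed
      then have "real (card {u \<in> Z. u div p ^ (j0 - j) = v}) * r
          \<le> card X * m ^ i * p powr (- (dim - 2 * e / \<gamma>) * j) * r"
        by (intro mult_right_mono) auto
      then show ?thesis unfolding cY cardY by (simp add: mult_ac)
    next
      case False
      have "{w \<in> Y. w div p ^ (L - j) = v} \<subseteq> {w \<in> words (j + (L - j)). w div p ^ (L - j) = v}"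
        using Yw j by auto
      then have "card {w \<in> Y. w div p ^ (L - j) = v} \<le> card {w \<in> words (j + (L - j)). w div p ^ (L - j) = v}"
        by (intro card_mono) auto
      also have "\<dots> \<le> m ^ (L - j)" by (rule card_words_prefix_le)
      finally have "card {w \<in> Y. w div p ^ (L - j) = v} \<le> m ^ (L - j)" .
      then have "real (card {w \<in> Y. w div p ^ (L - j) = v}) \<le> m ^ (L - j)" by (metis of_nat_le_iff)
      also have "\<dots> = real m ^ L / real m ^ j"
        using j by (simp only: of_nat_power) (simp add: power_diff)
      also have "\<dots> = m ^ L / m ^ j" by simp
      also have "\<dots> = m ^ (k + i + n) * p powr (- (2 * e) * k - e * L) * (p powr (2 * e * k + e * L) / m ^ j)"
      proof -
        have "p powr (- (2 * e) * k - e * L) * p powr (2 * e * k + e * L) = 1"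
          using p1 by (simp flip: powr_add)
        then show ?thesis by (simp add: Ln j0i mult.assoc)
      qed
      also have "\<dots> \<le> card Y * (p powr (2 * e / \<gamma> * j) / m ^ j)"
      proof (rule mult_mono[OF lowY])
        have "\<gamma> * L \<le> j" using False j0(2) by linarith
        then have "2 * e * (\<gamma> * L) \<le> 2 * e * j" using e by (intro mult_left_mono) auto
        then have "2 * e * L \<le> 2 * e / \<gamma> * j" using \<gamma> by (simp add: field_simps)
        then have "2 * e * k + e * L \<le> 2 * e / \<gamma> * j" using k2 by linarith
        then show "p powr (2 * e * k + e * L) / m ^ j \<le> p powr (2 * e / \<gamma> * j) / m ^ j"
          using p1 by (intro divide_right_mono powr_mono) auto
      qed auto
      finally show ?thesis
        unfolding pj .
    qed
  qed
  moreover have "w div p ^ (L - k) \<in> X \<and> P L w" if wY: "w \<in> Y" for w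
  proof -
    obtain u v where uv: "w = p ^ n * u + v" "u \<in> Z" "v \<in> T u"
      using wY by (auto simp: Y_def)
    have "L - k = n + i" by (simp add: Ln j0i)
    then have "w div p ^ (L - k) = w div p ^ n div p ^ i" by (simp add: power_add div_mult2_eq)
    then show ?thesis
      using uv words_less[OF subsetD[OF Tw uv(3)]] subsetD[OF T(1) uv(3)] by (auto simp: Z_def)
  qed
  moreover have "k < L" using L(1) by simp
  ultimately show ?thesis using that by blast
qed

abbreviation cylinders :: "nat \<Rightarrow> real set" where
  "cylinders n \<equiv> \<Union>w\<in>words n. cyl p n w"

definition limit_set :: "real set" where
  "limit_set = (\<Inter>n. cylinders n)"

text \<open>Step \<open>n\<close> of the construction imposes \<open>P n\<close>, so every point of
  the resulting Cantor set meets all the conditions. The start is the empty word at level 0.\<close>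

lemma hausdorff_dim_limsup_ge:
  fixes \<gamma> e :: real and P :: "nat \<Rightarrow> nat \<Rightarrow> nat \<Rightarrow> bool"
  assumes \<gamma>: "0 < \<gamma>" "\<gamma> \<le> 1" and e: "0 < e"
    and P: "\<And>N. \<forall>\<^sub>F L in sequentially. many_extensions \<gamma> e (P N) L"
  shows "ereal (dim - 2 * e / \<gamma>) \<le> hausdorff_dim {x \<in> limit_set. \<forall>N. \<exists>L w. P N L w \<and> x \<in> cyl p L w}"
proof -
  have "\<exists>f. \<forall>n. (case f n of (k, X) \<Rightarrow> admissible e \<gamma> k X)
      \<and> (case (f n, f (Suc n)) of ((k, X), (k', X')) \<Rightarrow>
          k < k' \<and> (\<forall>w\<in>X'. w div p ^ (k' - k) \<in> X \<and> P n k' w))"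
  proof (rule dependent_nat_choice)
    have "card {w. w = v \<and> w = 0} \<le> Suc 0" for v :: nat
      by (rule order_trans[OF card_mono[of "{0}"]]) auto
    then show "\<exists>f. case f of (k, X) \<Rightarrow> admissible e \<gamma> k X"
      by (intro exI[of _ "(0, {0})"]) (auto simp: admissible_def)
    show "\<exists>g. (case g of (k, X) \<Rightarrow> admissible e \<gamma> k X)
      \<and> (case (f, g) of ((k, X), (k', X')) \<Rightarrow>
          k < k' \<and> (\<forall>w\<in>X'. w div p ^ (k' - k) \<in> X \<and> P n k' w))"
      if "case f of (k, X) \<Rightarrow> admissible e \<gamma> k X" for f n
    proof -
      obtain k X where f: "f = (k, X)" by (cases f)
      obtain L Y where "k < L" "admissible e \<gamma> L Y" "\<And>w. w \<in> Y \<Longrightarrow> w div p ^ (L - k) \<in> X \<and> P n L w"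
        using admissible_step[OF \<gamma> e _ P[of n], of k X] \<open>case f of (k, X) \<Rightarrow> admissible e \<gamma> k X\<close>
        unfolding f by auto
      then show ?thesis unfolding f by (intro exI[of _ "(L, Y)"]) auto
    qed
  qed
  then obtain f where f: "\<forall>n. (case f n of (k, X) \<Rightarrow> admissible e \<gamma> k X)
      \<and> (case (f n, f (Suc n)) of ((k, X), (k', X')) \<Rightarrow>
          k < k' \<and> (\<forall>w\<in>X'. w div p ^ (k' - k) \<in> X \<and> P n k' w))" ..
  define k where "k n = fst (f n)" for n
  define X where "X n = snd (f n)" for n
  have adm: "admissible e \<gamma> (k n) (X n)" for n using f by (simp add: k_def X_def split_beta)
  have step: "k n < k (Suc n)" "\<And>w. w \<in> X (Suc n) \<Longrightarrow> w div p ^ (k (Suc n) - k n) \<in> X n"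
    "\<And>w. w \<in> X (Suc n) \<Longrightarrow> P n (k (Suc n)) w" for n
    using f by (auto simp: k_def X_def split_beta)
  have mono: "strict_mono k" using step(1) by (rule strict_monoI_Suc)
  have Xw: "X n \<subseteq> words (k n)" for n using adm[of n] by (simp add: admissible_def)
  have "ereal (dim - 2 * e / \<gamma>) \<le> hausdorff_dim (\<Inter>n. \<Union>w\<in>X n. cyl p (k n) w)"
  proof (rule hausdorff_dim_tree_ge[where C = 1])
    show "2 \<le> p" using p_ge by simp
    show "finite (X n)" for n by (rule finite_subset[OF Xw finite_words])
    show "X n \<noteq> {}" for n using adm[of n] by (simp add: admissible_def)
    show "card {w \<in> X n. w div p ^ (k n - j) = v} \<le> 1 * real (card (X n)) * p powr (- (dim - 2 * e / \<gamma>) * j)"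
      if "j \<le> k n" for n j v
      using adm[of n] that by (simp add: admissible_def)
  qed (use mono step in auto)
  also have "\<dots> \<le> hausdorff_dim {x \<in> limit_set. \<forall>N. \<exists>L w. P N L w \<and> x \<in> cyl p L w}"
  proof (rule hausdorff_dim_mono, intro subsetI CollectI conjI allI)
    fix x assume "x \<in> (\<Inter>n. \<Union>w\<in>X n. cyl p (k n) w)"
    then have x: "\<exists>w\<in>X n. x \<in> cyl p (k n) w" for n by blast
    \<comment> \<open>\<open>P N\<close> is imposed in passing from stage \<open>N\<close> to stage
      \<open>Suc N\<close>, hence the shift.\<close>
    show "\<exists>L w. P N L w \<and> x \<in> cyl p L w" for N using x[of "Suc N"] step(3)[of _ N] by blast
    show "x \<in> limit_set"
      unfolding limit_set_def
    proof (intro InterI, clarify)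
      fix n
      obtain w where w: "w \<in> X n" "x \<in> cyl p (k n) w"
        using x by blast
      have "n \<le> k n" using mono by (rule strict_mono_imp_increasing)
      then have kn: "k n = n + (k n - n)" by simp
      then have "w div p ^ (k n - n) \<in> words n"
        using w(1) Xw[of n] words_div[of w n "k n - n"] by auto
      moreover have "x \<in> cyl p n (w div p ^ (k n - n))"
        using cyl_prefix[of p n "k n - n" w] w(2) kn by auto
      ultimately show "x \<in> (\<Union>w\<in>words n. cyl p n w)" by blast
    qed
  qed
  finally show ?thesis .
qed

end

section \<open>The missing digits measure\<close>

lemma norm_ee_diff_le: "norm (ee s - ee t) \<le> 2 * pi * \<bar>s - t\<bar>"
proof -
  have "ee s - ee t = ee t * (ee (s - t) - 1)" by (simp add: right_diff_distrib flip: ee_add)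
  then have "norm (ee s - ee t) = 2 * \<bar>sin (pi * (s - t))\<bar>" by (simp add: norm_mult norm_ee_minus_1)
  also have "\<dots> \<le> 2 * \<bar>pi * (s - t)\<bar>" using abs_sin_x_le_abs_x by (intro mult_left_mono) auto
  finally show ?thesis by (simp add: abs_mult)
qed

context missing_digits
begin

section \<open>Digit sequences and their cylinders\<close>

primrec prefix :: "nat \<Rightarrow> (nat \<Rightarrow> nat) \<Rightarrow> nat" where
  "prefix 0 a = 0"
| "prefix (Suc n) a = p * prefix n a + a n"

lemma prefix_cong: "(\<And>j. j < n \<Longrightarrow> a j = b j) \<Longrightarrow> prefix n a = prefix n b"
  by (induction n) auto

lemma prefix_in_words: "(\<And>j. j < n \<Longrightarrow> a j \<in> D) \<Longrightarrow> prefix n a \<in> words n"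
proof (induction n)
  case (Suc n)
  then have "(prefix n a, a n) \<in> words n \<times> D" by simp
  then show ?case by force
qed simp

lemma words_prefixE:
  assumes "w \<in> words n"
  obtains a where "\<And>j. a j \<in> D" "prefix n a = w"
proof -
  have "\<exists>a. (\<forall>j. a j \<in> D) \<and> prefix n a = w"
    using assms
  proof (induction n arbitrary: w)
    case 0
    obtain d where "d \<in> D"
      using card_D_ge by fastforce
    then show ?case using 0 by (intro exI[of _ "\<lambda>_. d"]) simp
  next
    case (Suc n)
    then obtain v d where v: "v \<in> words n" "d \<in> D" "w = p * v + d" by auto
    then obtain a where a: "\<forall>j. a j \<in> D" "prefix n a = v" using Suc.IH by blast
    have "prefix n (a(n := d)) = prefix n a" by (rule prefix_cong) simp
    then have "prefix (Suc n) (a(n := d)) = w" by (simp only: prefix.simps a v fun_upd_same)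
    moreover have "\<forall>j. (a(n := d)) j \<in> D" using a v by simp
    ultimately show ?case by blast
  qed
  then show ?thesis using that by blast
qed

lemma prefix_inj:
  assumes "prefix n a = prefix n b" "\<And>j. j < n \<Longrightarrow> a j \<in> D" "\<And>j. j < n \<Longrightarrow> b j \<in> D" "j < n"
  shows "a j = b j"
  using assms
proof (induction n)
  case (Suc n)
  have less: "a n < p" "b n < p" using Suc.prems(2,3)[of n] D_subset by auto
  have "(p * prefix n a + a n) mod p = (p * prefix n b + b n) mod p"
    "(p * prefix n a + a n) div p = (p * prefix n b + b n) div p"
    using Suc.prems(1) by auto
  then have "a n = b n" "prefix n a = prefix n b" using less by auto
  then show ?case using Suc by (cases "j = n") auto
qed simp

definition digit_sum :: "(nat \<Rightarrow> nat) \<Rightarrow> real" where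
  "digit_sum a = (\<Sum>j. real (a j) / real p ^ (j + 1))"

lemma sum_prefix: "(\<Sum>j<n. real (a j) / real p ^ (j + 1)) = prefix n a / p ^ n"
  by (induction n) (auto simp: field_simps)

text \<open>The digits after the first \<open>n\<close> are at most \<open>p - 1\<close>, so their
  geometric series lies between 0 and \<open>1 / p ^ n\<close>.\<close>

lemma digit_sum_in_cyl:
  assumes "\<And>j. a j \<in> D"
  shows "digit_sum a \<in> cyl p n (prefix n a)"
proof -
  define f where "f j = real (a j) / real p ^ (j + 1)" for j
  have p1: "real p > 1" using p_ge by simp
  have f: "0 \<le> f j" "f j \<le> (real p - 1) / p * (1 / p) ^ j" for j
  proof -
    have "a j + 1 \<le> p" using assms[of j] D_subset by (simp add: Suc_le_eq subset_iff)
    then have "real (a j + 1) \<le> real p" by (simp only: of_nat_le_iff)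
    then have "real (a j) \<le> real p - 1" by simp
    then have "f j \<le> (real p - 1) / real p ^ (j + 1)"
      unfolding f_def by (rule divide_right_mono) simp
    then show "f j \<le> (real p - 1) / p * (1 / p) ^ j" by (simp add: power_divide)
  qed (simp add: f_def)
  have geo: "summable (\<lambda>j. (real p - 1) / p * (1 / p) ^ j)"
    using p1 by (intro summable_mult summable_geometric) auto
  have sf: "summable f" by (rule summable_comparison_test'[OF geo, of 0]) (use f in auto)
  have split: "digit_sum a = (\<Sum>j. f (j + n)) + (\<Sum>j<n. f j)"
    unfolding digit_sum_def f_def[symmetric] by (rule suminf_split_initial_segment[OF sf])
  have "(\<Sum>j. f (j + n)) \<le> (\<Sum>j. (real p - 1) / p * (1 / p) ^ n * (1 / p) ^ j)"
  proof (rule suminf_le)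
    show "f (j + n) \<le> (real p - 1) / p * (1 / p) ^ n * (1 / p) ^ j" for j
      using f(2)[of "j + n"] by (simp add: power_add mult_ac)
    show "summable (\<lambda>j. f (j + n))" using sf by (rule summable_ignore_initial_segment)
    show "summable (\<lambda>j. (real p - 1) / p * (1 / p) ^ n * (1 / p) ^ j)"
      using p1 by (intro summable_mult summable_geometric) auto
  qed
  also have "\<dots> = (real p - 1) / p * (1 / p) ^ n * (1 / (1 - 1 / p))"
    using p1 by (subst suminf_mult) (auto simp: suminf_geometric intro!: summable_geometric)
  also have "\<dots> = 1 / p ^ n" using p1 by (simp add: field_simps power_divide)
  finally have "(\<Sum>j. f (j + n)) \<le> 1 / p ^ n" .
  moreover have "(\<Sum>j. f (j + n)) \<ge> 0"
    using f sf by (intro suminf_nonneg summable_ignore_initial_segment) auto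
  moreover have "(\<Sum>j<n. f j) = prefix n a / p ^ n" unfolding f_def by (rule sum_prefix)
  ultimately show ?thesis by (auto simp: cyl_def split add_divide_distrib)
qed

section \<open>The product measure on digit sequences\<close>

abbreviation digit_measure :: "(nat \<Rightarrow> nat) measure" where
  "digit_measure \<equiv> (\<Pi>\<^sub>M j\<in>(UNIV :: nat set). measure_pmf (pmf_of_set D))"

abbreviation law :: "real measure" where
  "law \<equiv> digit_law p D"

lemma digit_law_eq: "law = distr digit_measure borel digit_sum"
  unfolding digit_law_def digit_sum_def ..

lemma measurable_digit_sum [measurable]: "digit_sum \<in> borel_measurable digit_measure"
  using digit_sum_measurable[of p D] by (simp add: digit_sum_def[abs_def])

lemma prob_space_digit_measure: "prob_space digit_measure"
  by (intro prob_space_PiM prob_space_measure_pmf)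

lemma D_nonempty: "D \<noteq> {}"
  using card_D_ge by auto

text \<open>The product space contains all sequences of naturals, also those for which the digit
  series diverges and \<open>suminf\<close> carries no information. They are discarded here once and
  for all.\<close>

lemma AE_digits: "AE a in digit_measure. \<forall>j. a j \<in> D"
proof -
  have "AE a in digit_measure. a j \<in> D" for j
  proof (rule AE_PiM_component)
    show "AE x in measure_pmf (pmf_of_set D). x \<in> D"
      using D_nonempty finite_D by (auto simp: AE_measure_pmf_iff)
  qed (auto intro: prob_space_measure_pmf)
  then show ?thesis by (simp add: AE_all_countable)
qed

text \<open>Requiring digits in \<open>D\<close> lets the word determine the digits, so for a word
  \<open>w\<close> the event is a cylinder of the product and the events are disjoint for different
  words.\<close>

definition prefix_event :: "nat \<Rightarrow> nat \<Rightarrow> (nat \<Rightarrow> nat) set" where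
  "prefix_event n w = {a \<in> space digit_measure. (\<forall>j<n. a j \<in> D) \<and> prefix n a = w}"

lemma prefix_event:
  assumes "w \<in> words n"
  shows "prefix_event n w \<in> sets digit_measure" "emeasure digit_measure (prefix_event n w) = ennreal (1 / m ^ n)"
proof -
  interpret product_prob_space "\<lambda>_. measure_pmf (pmf_of_set D)" "UNIV :: nat set"
    by unfold_locales
  obtain c where c: "\<And>j. c j \<in> D" "prefix n c = w"
    using words_prefixE[OF assms] by metis
  have eq: "prefix_event n w = {a \<in> space digit_measure. \<forall>j\<in>{..<n}. a j \<in> {c j}}"
  proof -
    have "(\<forall>j<n. a j \<in> D) \<and> prefix n a = w \<longleftrightarrow> (\<forall>j<n. a j = c j)" for a
      using c prefix_inj[of n a c] prefix_cong[of n a c] by metis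
    then show ?thesis unfolding prefix_event_def by auto
  qed
  show "prefix_event n w \<in> sets digit_measure"
    unfolding eq by (intro sets.sets_Collect_finite_All sets_Collect_single') auto
  have "emeasure digit_measure (prefix_event n w) = (\<Prod>j<n. emeasure (measure_pmf (pmf_of_set D)) {c j})"
    unfolding eq by (rule emeasure_PiM_Collect) auto
  also have "\<dots> = (\<Prod>j<n. ennreal (1 / m))"
    using c(1) D_nonempty finite_D by (simp add: emeasure_pmf_single pmf_of_set indicator_def)
  also have "\<dots> = ennreal (1 / m ^ n)" by (simp add: ennreal_power power_divide)
  finally show "emeasure digit_measure (prefix_event n w) = ennreal (1 / m ^ n)" .
qed

lemma emeasure_digit_law_cyl_ge:
  assumes "w \<in> words n"
  shows "ennreal (1 / m ^ n) \<le> emeasure law (cyl p n w)"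
proof -
  have "emeasure digit_measure (prefix_event n w) \<le> emeasure digit_measure (digit_sum -` cyl p n w \<inter> space digit_measure)"
  proof (rule emeasure_mono_AE)
    show "AE a in digit_measure. a \<in> prefix_event n w \<longrightarrow> a \<in> digit_sum -` cyl p n w \<inter> space digit_measure"
      using AE_digits by eventually_elim (auto simp: prefix_event_def digit_sum_in_cyl)
    show "digit_sum -` cyl p n w \<inter> space digit_measure \<in> sets digit_measure"
      by (rule measurable_sets[OF measurable_digit_sum]) (simp add: cyl_def)
  qed
  then show ?thesis
    using prefix_event(2)[OF assms] by (simp add: digit_law_eq emeasure_distr cyl_def)
qed

text \<open>Almost every sequence whose sum lies in \<open>B\<close> has a prefix whose cylinder
  meets \<open>B\<close>, and each prefix has mass \<open>1 / m ^ n\<close>.\<close>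

lemma emeasure_digit_law_le:
  assumes "B \<in> sets borel"
  shows "emeasure law B \<le> ennreal (card {w \<in> words n. cyl p n w \<inter> B \<noteq> {}} / m ^ n)"
proof -
  define S where "S = {w \<in> words n. cyl p n w \<inter> B \<noteq> {}}"
  have S: "finite S" "S \<subseteq> words n" by (auto simp: S_def)
  have "emeasure law B = emeasure digit_measure (digit_sum -` B \<inter> space digit_measure)"
    unfolding digit_law_eq using assms by (intro emeasure_distr) auto
  also have "\<dots> \<le> emeasure digit_measure (\<Union>w\<in>S. prefix_event n w)"
  proof (rule emeasure_mono_AE)
    show "AE a in digit_measure. a \<in> digit_sum -` B \<inter> space digit_measure \<longrightarrow> a \<in> (\<Union>w\<in>S. prefix_event n w)"
      using AE_digits
    proof eventually_elim
      case (elim a)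
      then show ?case
        using digit_sum_in_cyl[of a n] prefix_in_words[of n a] by (auto simp: prefix_event_def S_def)
    qed
    show "(\<Union>w\<in>S. prefix_event n w) \<in> sets digit_measure"
      using S prefix_event(1) by (intro sets.finite_UN) auto
  qed
  also have "\<dots> \<le> (\<Sum>w\<in>S. emeasure digit_measure (prefix_event n w))"
    using S prefix_event(1) by (intro emeasure_subadditive_finite) auto
  also have "\<dots> = (\<Sum>w\<in>S. ennreal (1 / m ^ n))" using S by (intro sum.cong prefix_event(2)) auto
  also have "\<dots> = ennreal (card S / m ^ n)"
    by (simp add: ennreal_of_nat_eq_real_of_nat flip: ennreal_mult)
  finally show ?thesis by (simp add: S_def)
qed

section \<open>Fourier coefficients of the measure\<close>

lemma fourier_coeff_eq: "fourier_coeff law \<xi> = (\<integral>a. ee (- (of_int \<xi> * digit_sum a)) \<partial>digit_measure)"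
proof -
  have "exp (- 2 * complex_of_real pi * \<i> * of_real x * of_int \<xi>) = ee (- (of_int \<xi> * x))" for x
    by (simp add: ee_def cis_conv_exp mult_ac)
  then have "fourier_coeff law \<xi> = (\<integral>x. ee (- (of_int \<xi> * x)) \<partial>law)"
    by (simp add: fourier_coeff_def)
  also have "\<dots> = (\<integral>a. ee (- (of_int \<xi> * digit_sum a)) \<partial>digit_measure)"
    unfolding digit_law_eq
  proof (rule integral_distr)
    have "continuous_on UNIV (\<lambda>x::real. ee (- (of_int \<xi> * x)))"
      unfolding ee_def cis_conv_exp by (intro continuous_intros)
    then show "(\<lambda>x. ee (- (of_int \<xi> * x))) \<in> borel_measurable borel"
      by (rule borel_measurable_continuous_onI)
  qed measurable
  finally show ?thesis .
qed

lemma measurable_ee [measurable]: "ee \<in> borel_measurable borel"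
  unfolding ee_def[abs_def] cis_conv_exp by (intro borel_measurable_continuous_onI continuous_intros)

text \<open>Moving each point to the left end of its level-\<open>n\<close> cylinder changes the
  phase by at most the bound. The exponential becomes the step function \<open>g\<close>, with
  integral \<open>char_avg n\<close>.\<close>

lemma fourier_coeff_approx:
  "norm (fourier_coeff law \<xi> - char_avg n (of_int \<xi>)) \<le> 2 * pi * \<bar>of_int \<xi>\<bar> / p ^ n"
proof -
  interpret prob_space digit_measure
    by (rule prob_space_digit_measure)
  define g where "g a = (\<Sum>w\<in>words n. indicator (prefix_event n w) a *\<^sub>R ee (- (of_int \<xi> * real w / real p ^ n)))" for a
  have g_int: "integrable digit_measure (\<lambda>a. indicator (prefix_event n w) a *\<^sub>R ee (- (of_int \<xi> * real w / real p ^ n)))"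
    if "w \<in> words n" for w
    using prefix_event[OF that] by (intro integrable_scaleR_left) (simp add: integrable_indicator_iff)
  have "(\<integral>a. g a \<partial>digit_measure) = (\<Sum>w\<in>words n. \<integral>a. indicator (prefix_event n w) a *\<^sub>R ee (- (of_int \<xi> * real w / real p ^ n)) \<partial>digit_measure)"
    unfolding g_def by (rule Bochner_Integration.integral_sum[OF g_int])
  also have "\<dots> = (\<Sum>w\<in>words n. (1 / real m ^ n) *\<^sub>R ee (- (of_int \<xi> * real w / real p ^ n)))"
  proof (rule sum.cong[OF refl])
    fix w assume w: "w \<in> words n"
    have "measure digit_measure (prefix_event n w) = 1 / m ^ n"
      using prefix_event(2)[OF w] by (simp add: measure_def)
    then show "(\<integral>a. indicator (prefix_event n w) a *\<^sub>R ee (- (of_int \<xi> * real w / real p ^ n)) \<partial>digit_measure)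
        = (1 / real m ^ n) *\<^sub>R ee (- (of_int \<xi> * real w / real p ^ n))"
      using prefix_event[OF w] by (subst integral_scaleR_left) (auto simp: integrable_indicator_iff)
  qed
  also have "\<dots> = char_avg n (of_int \<xi>)"
    by (simp add: char_avg_def sum_divide_distrib scaleR_conv_of_real)
  finally have int_g: "(\<integral>a. g a \<partial>digit_measure) = char_avg n (of_int \<xi>)" .
  have ig: "integrable digit_measure g"
    unfolding g_def by (rule Bochner_Integration.integrable_sum[OF g_int])
  have "integrable digit_measure (\<lambda>a. ee (- (of_int \<xi> * digit_sum a)))"
    by (rule integrable_const_bound[of _ 1]) auto
  then have "fourier_coeff law \<xi> - char_avg n (of_int \<xi>)
      = (\<integral>a. ee (- (of_int \<xi> * digit_sum a)) - g a \<partial>digit_measure)"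
    using ig by (simp add: fourier_coeff_eq int_g)
  also have "norm \<dots> \<le> (\<integral>a. norm (ee (- (of_int \<xi> * digit_sum a)) - g a) \<partial>digit_measure)"
    by (rule integral_norm_bound)
  also have "\<dots> \<le> 2 * pi * \<bar>of_int \<xi>\<bar> / p ^ n"
  proof (rule integral_le_const)
    show "integrable digit_measure (\<lambda>a. norm (ee (- (of_int \<xi> * digit_sum a)) - g a))"
      using ig \<open>integrable digit_measure (\<lambda>a. ee (- (of_int \<xi> * digit_sum a)))\<close>
      by (intro integrable_norm Bochner_Integration.integrable_diff)
    show "AE a in digit_measure. norm (ee (- (of_int \<xi> * digit_sum a)) - g a) \<le> 2 * pi * \<bar>of_int \<xi>\<bar> / p ^ n"
      using AE_digits AE_space
    proof eventually_elim
      case (elim a)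
      define w0 where "w0 = prefix n a"
      have w0: "w0 \<in> words n" unfolding w0_def using elim by (intro prefix_in_words) auto
      have "g a = (\<Sum>w\<in>words n. if w = w0 then ee (- (of_int \<xi> * real w / real p ^ n)) else 0)"
        unfolding g_def using elim by (intro sum.cong refl) (auto simp: prefix_event_def w0_def)
      then have ga: "g a = ee (- (of_int \<xi> * real w0 / real p ^ n))" using w0 by simp
      have "digit_sum a \<in> cyl p n w0" unfolding w0_def using elim by (intro digit_sum_in_cyl) auto
      then have "\<bar>digit_sum a - real w0 / real p ^ n\<bar> \<le> 1 / real p ^ n"
        by (auto simp: cyl_def add_divide_distrib)
      then have "\<bar>of_int \<xi>\<bar> * \<bar>digit_sum a - real w0 / real p ^ n\<bar> \<le> \<bar>of_int \<xi>\<bar> * (1 / real p ^ n)"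
        by (intro mult_left_mono) auto
      also have "\<bar>of_int \<xi>\<bar> * \<bar>digit_sum a - real w0 / real p ^ n\<bar>
          = \<bar>- (of_int \<xi> * digit_sum a) - - (of_int \<xi> * real w0 / real p ^ n)\<bar>"
      proof -
        have "- (of_int \<xi> * digit_sum a) - - (of_int \<xi> * real w0 / real p ^ n)
            = - (of_int \<xi> * (digit_sum a - real w0 / real p ^ n))"
          by (simp add: right_diff_distrib)
        then show ?thesis by (simp only: abs_minus_cancel abs_mult)
      qed
      finally have "2 * pi * \<bar>- (of_int \<xi> * digit_sum a) - - (of_int \<xi> * real w0 / real p ^ n)\<bar>
          \<le> 2 * pi * (\<bar>of_int \<xi>\<bar> * (1 / real p ^ n))"
        by (intro mult_left_mono) auto
      then show ?case
        unfolding ga using norm_ee_diff_le[of "- (of_int \<xi> * digit_sum a)" "- (of_int \<xi> * real w0 / real p ^ n)"]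
        by simp
    qed
  qed
  finally show ?thesis .
qed

text \<open>Rotation by \<open>ee (y * h)\<close> recentres the phases at \<open>h\<close> without
  changing the norm, and then the real part is a lower bound.\<close>

lemma norm_char_avg_ge:
  assumes "\<And>w. w \<in> words n \<Longrightarrow> \<kappa> \<le> cos (2 * pi * (y * (h - real w / p ^ n)))"
  shows "\<kappa> \<le> norm (char_avg n y)"
proof -
  have "ee (y * h) * char_avg n y = (\<Sum>w\<in>words n. ee (y * (h - real w / p ^ n))) / of_nat (m ^ n)"
    by (simp add: char_avg_def sum_distrib_left right_diff_distrib flip: ee_add)
  then have "Re (ee (y * h) * char_avg n y) = (\<Sum>w\<in>words n. cos (2 * pi * (y * (h - real w / p ^ n)))) / m ^ n"
    by (simp add: Re_divide_of_nat Re_ee flip: of_nat_power)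
  also have "\<dots> \<ge> (\<Sum>w\<in>words n. \<kappa>) / m ^ n" using assms by (intro divide_right_mono sum_mono) auto
  also have "(\<Sum>w\<in>words n. \<kappa>) / m ^ n = \<kappa>" by (simp add: card_words)
  finally have "\<kappa> \<le> Re (ee (y * h) * char_avg n y)" .
  also have "\<dots> \<le> norm (ee (y * h) * char_avg n y)" by (rule complex_Re_le_cmod)
  finally show ?thesis by (simp add: norm_mult)
qed

text \<open>For \<open>\<bar>\<xi>\<bar> \<le> p\<^sup>n / 2\<close> the factors of the Fourier transform at the scales beyond \<open>p\<^sup>-\<^sup>n\<close> are bounded below: the
  phases of the first one lie within an open half circle, those of the others within a third of it.\<close>

lemma norm_fourier_coeff_ge:
  obtains \<kappa> :: real where "0 < \<kappa>"
    "\<And>n \<xi>. 2 * \<bar>\<xi>\<bar> \<le> int (p ^ n) \<Longrightarrow> \<kappa> * norm (char_avg n (of_int \<xi>)) \<le> norm (fourier_coeff law \<xi>)"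
proof -
  \<comment> \<open>Digits between 0 and \<open>p - 1\<close>, recentred at their midpoint, give
    phases of at most this angle when the argument is at most 1/2. The angle is below
    \<open>pi / 2\<close>, so \<open>\<kappa>\<close> is positive.\<close>
  define \<kappa> where "\<kappa> = cos (pi * ((real p - 1) / (2 * p)))"
  have p3: "real p \<ge> 3" using p_ge by simp
  have ang: "pi * ((real p - 1) / (2 * p)) < pi / 2" "0 \<le> pi * ((real p - 1) / (2 * p))"
    using p3 by (auto simp: field_simps)
  have \<kappa>: "0 < \<kappa>" unfolding \<kappa>_def using ang by (intro cos_gt_zero_pi) auto
  have low1: "\<kappa> \<le> norm (char_avg 1 y)" if y: "\<bar>y\<bar> \<le> 1 / 2" for y
  proof (rule norm_char_avg_ge)
    fix w assume "w \<in> words 1"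
    then have "w + 1 \<le> p" using words_less[of w 1] by simp
    then have "real (w + 1) \<le> real p" by (simp only: of_nat_le_iff)
    then have "real w \<le> real p - 1" by simp
    then have "\<bar>(real p - 1) / 2 - real w\<bar> \<le> (real p - 1) / 2"
      using of_nat_0_le_iff[of w, where ?'a = real] by (simp add: abs_if field_simps)
    then have "\<bar>(real p - 1) / 2 - real w\<bar> / p \<le> ((real p - 1) / 2) / p"
      by (rule divide_right_mono) simp
    moreover have "(real p - 1) / (2 * p) - real w / p ^ 1 = ((real p - 1) / 2 - real w) / p"
      by (simp add: diff_divide_distrib)
    ultimately have "\<bar>(real p - 1) / (2 * p) - real w / p ^ 1\<bar> \<le> (real p - 1) / (2 * p)"
      by (simp add: abs_divide)
    then have "\<bar>y\<bar> * \<bar>(real p - 1) / (2 * p) - real w / p ^ 1\<bar> \<le> 1 / 2 * ((real p - 1) / (2 * p))"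
      using y by (intro mult_mono) auto
    then have "2 * pi * (\<bar>y\<bar> * \<bar>(real p - 1) / (2 * p) - real w / p ^ 1\<bar>) \<le> 2 * pi * (1 / 2 * ((real p - 1) / (2 * p)))"
      by (intro mult_left_mono) auto
    then have "\<bar>2 * pi * (y * ((real p - 1) / (2 * p) - real w / p ^ 1))\<bar> \<le> pi * ((real p - 1) / (2 * p))"
      by (simp add: abs_mult)
    then have "\<kappa> \<le> cos \<bar>2 * pi * (y * ((real p - 1) / (2 * p) - real w / p ^ 1))\<bar>"
      unfolding \<kappa>_def using ang pi_gt_zero by (intro cos_monotone_0_pi_le) linarith+
    then show "\<kappa> \<le> cos (2 * pi * (y * ((real p - 1) / (2 * p) - real w / p ^ 1)))"
      by (simp only: cos_abs_real)
  qed
  have low2: "1 / 2 \<le> norm (char_avg k y)" if y: "\<bar>y\<bar> \<le> 1 / 6" for k y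
  proof (rule norm_char_avg_ge[where h = 0])
    fix w assume "w \<in> words k"
    then have "real w / p ^ k \<le> 1" using words_less[of w k] by (simp flip: of_nat_power)
    then have "\<bar>y\<bar> * (real w / p ^ k) \<le> 1 / 6 * 1" using y by (intro mult_mono) auto
    then have "2 * pi * (\<bar>y\<bar> * (real w / p ^ k)) \<le> 2 * pi * (1 / 6 * 1)"
      by (intro mult_left_mono) auto
    then have "\<bar>2 * pi * (y * (0 - real w / p ^ k))\<bar> \<le> pi / 3" by (simp add: abs_mult)
    then have "cos (pi / 3) \<le> cos \<bar>2 * pi * (y * (0 - real w / p ^ k))\<bar>"
      using pi_gt_zero by (intro cos_monotone_0_pi_le) linarith+
    then show "1 / 2 \<le> cos (2 * pi * (y * (0 - real w / p ^ k)))"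
      by (simp only: cos_abs_real cos_60)
  qed
  show ?thesis
  proof (rule that[of "\<kappa> * (1 / 2)"])
    show "0 < \<kappa> * (1 / 2)" using \<kappa> by simp
    fix n :: nat and \<xi> :: int assume \<xi>: "2 * \<bar>\<xi>\<bar> \<le> int (p ^ n)"
    have "real_of_int (2 * \<bar>\<xi>\<bar>) \<le> real_of_int (int (p ^ n))" using \<xi> by (simp only: of_int_le_iff)
    then have \<theta>: "\<bar>of_int \<xi> / real (p ^ n)\<bar> \<le> 1 / 2" by (simp add: abs_divide field_simps)
    have \<theta>p: "\<bar>of_int \<xi> / real (p ^ n) / real p ^ 1\<bar> \<le> 1 / 6"
    proof -
      have "\<bar>of_int \<xi> / real (p ^ n)\<bar> / p \<le> (1 / 2) / 3" using \<theta> p3 by (intro frac_le) auto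
      then show ?thesis by (simp add: abs_divide)
    qed
    \<comment> \<open>Level \<open>n + (1 + k)\<close> splits into level \<open>n\<close>, one digit
      at an argument of at most 1/2, and \<open>k\<close> digits at an argument of at most 1/6,
      where \<open>p \<ge> 3\<close> enters. The lower bound for the last factor does not depend on
      \<open>k\<close>, so \<open>k\<close> can tend to infinity.\<close>
    have ge: "\<kappa> * (1 / 2) * norm (char_avg n (of_int \<xi>)) - 2 * pi * \<bar>of_int \<xi>\<bar> / p ^ (n + (1 + k))
        \<le> norm (fourier_coeff law \<xi>)" for k
    proof -
      have "norm (char_avg (n + (1 + k)) (of_int \<xi>)) = norm (char_avg n (of_int \<xi>))
          * (norm (char_avg 1 (of_int \<xi> / real (p ^ n))) * norm (char_avg k (of_int \<xi> / real (p ^ n) / real p ^ 1)))"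
        by (simp only: char_avg_add norm_mult of_nat_power)
      also have "\<dots> \<ge> norm (char_avg n (of_int \<xi>)) * (\<kappa> * (1 / 2))"
        using low1[OF \<theta>] low2[OF \<theta>p, of k] \<kappa> by (intro mult_left_mono mult_mono) auto
      finally show ?thesis
        using fourier_coeff_approx[of \<xi> "n + (1 + k)"]
          norm_triangle_ineq2[of "char_avg (n + (1 + k)) (of_int \<xi>)" "fourier_coeff law \<xi>"]
        by (simp add: norm_minus_commute mult.commute)
    qed
    have "(\<lambda>k. (1 / real p) ^ (k + (n + 1))) \<longlonglongrightarrow> 0"
      using p3 by (intro LIMSEQ_ignore_initial_segment LIMSEQ_realpow_zero) auto
    then have "(\<lambda>k. \<kappa> * (1 / 2) * norm (char_avg n (of_int \<xi>)) - 2 * pi * \<bar>of_int \<xi>\<bar> * (1 / real p) ^ (k + (n + 1)))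
        \<longlonglongrightarrow> \<kappa> * (1 / 2) * norm (char_avg n (of_int \<xi>)) - 2 * pi * \<bar>of_int \<xi>\<bar> * 0"
      by (intro tendsto_intros)
    then have "\<kappa> * (1 / 2) * norm (char_avg n (of_int \<xi>)) - 2 * pi * \<bar>of_int \<xi>\<bar> * 0
        \<le> norm (fourier_coeff law \<xi>)"
    proof (rule LIMSEQ_le_const2, intro exI allI impI)
      fix k
      show "\<kappa> * (1 / 2) * norm (char_avg n (of_int \<xi>)) - 2 * pi * \<bar>of_int \<xi>\<bar> * (1 / real p) ^ (k + (n + 1))
          \<le> norm (fourier_coeff law \<xi>)"
        using ge[of k] by (simp add: power_divide add_ac)
    qed
    then show "\<kappa> * (1 / 2) * norm (char_avg n (of_int \<xi>)) \<le> norm (fourier_coeff law \<xi>)" by simp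
  qed
qed

abbreviation coeff_sum :: "real \<Rightarrow> real" where
  "coeff_sum R \<equiv> \<Sum>\<xi> | real_of_int \<bar>\<xi>\<bar> \<le> R. norm (fourier_coeff law \<xi>)"

text \<open>By periodicity each frequency below \<open>p ^ n\<close> may be replaced by its
  representative of absolute value at most \<open>p ^ n / 2\<close>, where
  \<open>norm_fourier_coeff_ge\<close> applies.\<close>

lemma fourier_sum_le:
  obtains K :: real where "0 < K"
    "\<And>n. fourier_sum n \<le> K * coeff_sum (real p ^ n)"
proof -
  obtain \<kappa> where \<kappa>: "0 < \<kappa>"
    "\<And>n \<xi>. 2 * \<bar>\<xi>\<bar> \<le> int (p ^ n) \<Longrightarrow> \<kappa> * norm (char_avg n (of_int \<xi>)) \<le> norm (fourier_coeff law \<xi>)"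
    using norm_fourier_coeff_ge by metis
  show ?thesis
  proof (rule that[of "1 / \<kappa>"])
    show "0 < 1 / \<kappa>" using \<kappa> by simp
    fix n
    define M where "M = p ^ n"
    define h where "h l = (if 2 * l \<le> M then int l else int l - int M)" for l
    have h: "2 * \<bar>h l\<bar> \<le> int M" if "l < M" for l using that by (auto simp: h_def)
    have hE: "char_avg n (of_int (h l)) = char_avg n (real l)" for l
      using char_avg_periodic[of n "of_int (h l)" 1] by (auto simp: h_def M_def)
    have inj: "inj_on h {..<M}" by (rule inj_onI) (auto simp: h_def split: if_splits)
    have eq: "{\<xi>. real_of_int \<bar>\<xi>\<bar> \<le> real p ^ n} = {- int M..int M}"
    proof -
      have "real p ^ n = real_of_int (int M)" by (simp add: M_def)
      then show ?thesis by (simp only: of_int_le_iff) (auto simp: abs_le_iff)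
    qed
    have fin: "finite {\<xi>. real_of_int \<bar>\<xi>\<bar> \<le> real p ^ n}" unfolding eq by simp
    have sub: "h ` {..<M} \<subseteq> {\<xi>. real_of_int \<bar>\<xi>\<bar> \<le> real p ^ n}"
    proof
      fix \<xi> assume "\<xi> \<in> h ` {..<M}"
      then have "2 * \<bar>\<xi>\<bar> \<le> int M" using h by auto
      then show "\<xi> \<in> {\<xi>. real_of_int \<bar>\<xi>\<bar> \<le> real p ^ n}" unfolding eq by auto
    qed
    have "\<kappa> * fourier_sum n = (\<Sum>l<M. \<kappa> * norm (char_avg n (of_int (h l))))"
      by (simp add: fourier_sum_def hE sum_distrib_left M_def)
    also have "\<dots> \<le> (\<Sum>l<M. norm (fourier_coeff law (h l)))"
      using h \<kappa>(2) unfolding M_def by (intro sum_mono) auto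
    also have "\<dots> = (\<Sum>\<xi>\<in>h ` {..<M}. norm (fourier_coeff law \<xi>))" by (simp add: sum.reindex[OF inj])
    also have "\<dots> \<le> coeff_sum (real p ^ n)" by (rule sum_mono2[OF fin sub]) simp
    finally show "fourier_sum n \<le> 1 / \<kappa> * coeff_sum (real p ^ n)"
      using \<kappa>(1) by (simp add: field_simps)
  qed
qed

lemma l1_dim_fourier_sum_bound:
  assumes "l1_dim law > ereal (1 / 2)"
  obtains \<beta> C :: real where "0 \<le> \<beta>" "\<beta> < 1 / 2" "0 \<le> C" "\<And>n. fourier_sum n \<le> C * p powr (n * \<beta>)"
proof -
  obtain s where s: "s > 1 / 2"
    and O: "(\<lambda>R. coeff_sum R) \<in> O(\<lambda>R. R powr (1 - s))"
    using assms unfolding l1_dim_def less_SUP_iff by auto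
  obtain c where c: "c > 0" and ev: "\<forall>\<^sub>F R in at_top. norm (coeff_sum R)
      \<le> c * norm (R powr (1 - s))"
    using landau_o.bigE[OF O] by blast
  obtain R0 where R0: "\<And>R. R \<ge> R0 \<Longrightarrow> norm (coeff_sum R)
      \<le> c * norm (R powr (1 - s))"
    using ev unfolding eventually_at_top_linorder by blast
  obtain K where K: "0 < K"
    "\<And>n. fourier_sum n \<le> K * coeff_sum (real p ^ n)"
    using fourier_sum_le by metis
  \<comment> \<open>A nonnegative exponent keeps the right-hand side at least its constant. This
    covers the small \<open>n\<close>, for which the asymptotic bound says nothing and the trivial
    bound is used.\<close>
  define \<beta> where "\<beta> = max 0 (1 - s)"
  have p1: "real p \<ge> 1" using p_ge by simp
  have "fourier_sum n \<le> (K * c + \<bar>R0\<bar>) * p powr (n * \<beta>)" for n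
  proof (cases "real p ^ n \<ge> R0")
    case True
    have "fourier_sum n \<le> K * (c * (real p ^ n) powr (1 - s))"
      using K(2)[of n] R0[OF True] K(1)
      by (smt (verit, best) abs_of_nonneg mult_left_mono powr_ge_zero real_norm_def)
    also have "(real p ^ n) powr (1 - s) = p powr (n * (1 - s))"
    proof -
      have "real p ^ n = p powr n" using p1 by (simp add: powr_realpow)
      then show ?thesis by (simp only: powr_powr)
    qed
    also have "p powr (n * (1 - s)) \<le> p powr (n * \<beta>)"
      using p1 by (intro powr_mono mult_left_mono) (auto simp: \<beta>_def)
    finally have "fourier_sum n \<le> K * c * p powr (n * \<beta>)"
      using K c by (simp add: mult_left_mono mult.assoc)
    also have "\<dots> \<le> (K * c + \<bar>R0\<bar>) * p powr (n * \<beta>)" by (intro mult_right_mono) auto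
    finally show ?thesis .
  next
    case False
    have "fourier_sum n \<le> (\<Sum>l<p ^ n. 1)"
      unfolding fourier_sum_def by (intro sum_mono norm_char_avg_le)
    also have "\<dots> \<le> \<bar>R0\<bar>" using False by simp
    also have "\<dots> \<le> (K * c + \<bar>R0\<bar>) * 1" using K c by simp
    also have "\<dots> \<le> (K * c + \<bar>R0\<bar>) * p powr (n * \<beta>)"
      using p1 K c by (intro mult_left_mono ge_one_powr_ge_zero) (auto simp: \<beta>_def)
    finally show ?thesis .
  qed
  then show ?thesis
  proof (rule that[of \<beta> "K * c + \<bar>R0\<bar>", rotated 3])
    show "0 \<le> \<beta>" "\<beta> < 1 / 2" using s by (auto simp: \<beta>_def max_def)
    show "0 \<le> K * c + \<bar>R0\<bar>" using K c by simp
  qed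
qed

end

section \<open>Support and dimension of the measure\<close>

lemma diam_pow_cyl:
  assumes "0 < p"
  shows "diam_pow \<sigma> (cyl p n w) = p powr (- \<sigma> * n)"
proof -
  have ne: "cyl p n w \<noteq> {}" using assms by (auto simp: cyl_def divide_right_mono)
  have le: "real w / p ^ n \<le> (real w + 1) / p ^ n" by (rule divide_right_mono) auto
  have "diameter (cyl p n w) = 1 / p ^ n"
    using le unfolding cyl_def by (simp add: diameter_closed_interval add_divide_distrib)
  also have "\<dots> = p powr (- real n)" using assms by (simp add: powr_minus_divide powr_realpow)
  finally have "diameter (cyl p n w) powr \<sigma> = p powr (- real n * \<sigma>)" by (simp only: powr_powr)
  then show ?thesis using ne assms by (simp add: diam_pow_def mult.commute)
qed

lemma diam_pow_empty [simp]: "diam_pow \<sigma> {} = 0"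
  by (simp add: diam_pow_def)

lemma diameter_cyl_le:
  assumes "0 < p"
  shows "diameter (cyl p n w) \<le> 1 / p ^ n"
proof -
  have "real w / p ^ n \<le> (real w + 1) / p ^ n" by (rule divide_right_mono) auto
  then show ?thesis unfolding cyl_def by (simp add: diameter_closed_interval add_divide_distrib)
qed

text \<open>The convergence half of a Borel-Cantelli argument: every tail of the family covers
  \<open>A\<close>, and the tails of the convergent sum become arbitrarily small.\<close>

lemma hausdorff_dim_le_limsup_cover:
  fixes p :: nat and lev :: "nat \<Rightarrow> nat" and S :: "nat \<Rightarrow> nat set" and \<sigma> :: real
  assumes p: "2 \<le> p" and \<sigma>: "0 \<le> \<sigma>" and fin: "\<And>i. finite (S i)" and lev: "\<And>i. i \<le> lev i"
    and sum: "summable (\<lambda>i. card (S i) * p powr (- \<sigma> * lev i))"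
    and cover: "\<And>x N. x \<in> A \<Longrightarrow> \<exists>i\<ge>N. \<exists>w\<in>S i. x \<in> cyl p (lev i) w"
  shows "hausdorff_dim A \<le> ereal \<sigma>"
proof -
  have p0: "0 < p" using p by simp
  define a where "a i = card (S i) * p powr (- \<sigma> * lev i)" for i
  have "hausdorff_premeasure \<delta> \<sigma> A \<le> 0" if \<delta>: "0 < \<delta>" for \<delta>
  proof (rule ennreal_le_epsilon)
    fix e :: real assume e: "0 < e"
    obtain N1 where N1: "\<And>n. n \<ge> N1 \<Longrightarrow> norm (\<Sum>i. a (i + n)) < e"
      using suminf_exist_split[OF e, of a] sum unfolding a_def by blast
    have "\<exists>n. (1 / real p) ^ n < \<delta>" using p \<delta> by (intro real_arch_pow_inv) auto
    then obtain N2 where N2: "(1 / real p) ^ N2 < \<delta>" ..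
    define N where "N = max N1 N2"
    \<comment> \<open>All pairs of a stage and a number are listed in one sequence, with the empty
      set where the number is not selected; its cost is a double series.\<close>
    define U where "U n = (case prod_decode n of (i, w) \<Rightarrow> if w \<in> S (i + N) then cyl p (lev (i + N)) w else {})" for n
    have "hausdorff_premeasure \<delta> \<sigma> A \<le> (\<Sum>n. ennreal (diam_pow \<sigma> (U n)))"
      unfolding hausdorff_premeasure_def
    proof (rule INF_lower, intro CollectI conjI allI subsetI)
      fix x assume "x \<in> A"
      then obtain i w where i: "i \<ge> N" "w \<in> S i" "x \<in> cyl p (lev i) w" using cover by blast
      then have "x \<in> U (prod_encode (i - N, w))" by (simp add: U_def)
      then show "x \<in> (\<Union>n. U n)" by blast
    next
      fix n
      show "bounded (U n)" by (auto simp: U_def cyl_def split: prod.splits)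
      obtain i w where iw: "prod_decode n = (i, w)"
        by fastforce
      have "N2 \<le> lev (i + N)" using lev[of "i + N"] by (simp add: N_def)
      then have "1 / real p ^ lev (i + N) \<le> (1 / real p) ^ N2"
        using p by (simp add: power_divide frac_le power_increasing)
      then have "1 / real p ^ lev (i + N) \<le> \<delta>" using N2 by simp
      then show "diameter (U n) \<le> \<delta>"
        using diameter_cyl_le[OF p0, of "lev (i + N)" w] \<delta> by (simp add: U_def iw)
    qed
    also have "\<dots> = (\<Sum>n. (\<lambda>(i, w). ennreal (if w \<in> S (i + N) then p powr (- \<sigma> * lev (i + N)) else 0)) (prod_decode n))"
      by (intro suminf_cong) (simp add: U_def diam_pow_cyl[OF p0] split_beta)
    also have "\<dots> = (\<Sum>i. ennreal (a (i + N)))"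
    proof (rule suminf_ennreal_2dimen)
      fix i
      have "(\<Sum>w. case (i, w) of (i, w) \<Rightarrow> ennreal (if w \<in> S (i + N) then p powr (- \<sigma> * lev (i + N)) else 0))
          = (\<Sum>w\<in>S (i + N). ennreal (p powr (- \<sigma> * lev (i + N))))"
        by (subst suminf_finite[OF fin[of "i + N"]]) auto
      also have "\<dots> = ennreal (a (i + N))"
        by (simp add: a_def ennreal_of_nat_eq_real_of_nat flip: ennreal_mult)
      finally show "ennreal (a (i + N)) = (\<Sum>w. case (i, w) of (i, w) \<Rightarrow> ennreal (if w \<in> S (i + N) then p powr (- \<sigma> * lev (i + N)) else 0))"
        by simp
    qed
    also have "\<dots> = ennreal (\<Sum>i. a (i + N))"
      using sum by (intro suminf_ennreal2 summable_ignore_initial_segment) (auto simp: a_def[abs_def])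
    also have "\<dots> \<le> ennreal e" using N1[of N] by (intro ennreal_leI) (auto simp: N_def)
    finally show "hausdorff_premeasure \<delta> \<sigma> A \<le> 0 + ennreal e" by simp
  qed
  then have "hausdorff_measure \<sigma> A = 0"
    unfolding hausdorff_measure_def by (simp add: SUP_eq_const le_zero_eq[symmetric] SUP_le_iff del: le_zero_eq)
  then show ?thesis unfolding hausdorff_dim_def using \<sigma> by (intro INF_lower) simp
qed

context missing_digits
begin

lemma hausdorff_dim_limit_set_le: "hausdorff_dim limit_set \<le> ereal dim"
proof (rule ereal_le_epsilon2)
  fix e :: real assume e: "0 < e"
  have p1: "1 < real p" using p_ge by simp
  have "hausdorff_dim limit_set \<le> ereal (dim + e)"
  proof (rule hausdorff_dim_le_limsup_cover[where S = words and lev = "\<lambda>i. i"])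
    have "card (words i) * p powr (- (dim + e) * i) = (p powr (- e)) ^ i" for i
    proof -
      have "card (words i) * p powr (- (dim + e) * i) = p powr (dim * i + - (dim + e) * i)"
        by (simp only: card_words powr_add powr_dim)
      also have "dim * i + - (dim + e) * i = - e * i" by (simp add: algebra_simps)
      also have "p powr (- e * i) = (p powr (- e)) ^ i"
        using p1 by (simp add: powr_powr flip: powr_realpow)
      finally show ?thesis .
    qed
    moreover have "p powr (- e) < 1" using p1 e by (simp add: powr_less_one)
    ultimately show "summable (\<lambda>i. card (words i) * p powr (- (dim + e) * i))"
      by (simp add: summable_geometric)
    fix x and N :: nat assume "x \<in> limit_set"
    then show "\<exists>i\<ge>N. \<exists>w\<in>words i. x \<in> cyl p i w" unfolding limit_set_def by blast
  qed (use p_ge dim_pos e in auto)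
  then show "hausdorff_dim limit_set \<le> ereal dim + ereal e" by simp
qed

section \<open>Support and Hausdorff dimension of the measure\<close>

lemma open_outside_cylinders: "open (- cylinders n)"
  by (intro open_Compl compact_imp_closed compact_UN compact_cyl finite_words)

lemma emeasure_outside_cylinders: "emeasure law (- cylinders n) = 0"
proof -
  have "{w \<in> words n. cyl p n w \<inter> - cylinders n \<noteq> {}} = {}" by auto
  then have "card {w \<in> words n. cyl p n w \<inter> - cylinders n \<noteq> {}} = 0" by (simp only: card.empty)
  moreover have "- cylinders n \<in> sets borel" using open_outside_cylinders by (rule borel_open)
  ultimately show ?thesis
    using emeasure_digit_law_le[of "- cylinders n" n]
    by (simp only: of_nat_0 div_0 ennreal_0 le_zero_eq)
qed

text \<open>Small cylinders at a point of the limit set have positive mass; conversely, the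
  complement of each level is open and null.\<close>

lemma measure_supp_digit_law: "measure_supp law = limit_set"
proof (intro equalityI subsetI)
  fix x assume x: "x \<in> limit_set"
  show "x \<in> measure_supp law"
    unfolding measure_supp_def
  proof (intro CollectI allI impI)
    fix U :: "real set" assume U: "open U \<and> x \<in> U"
    then obtain e where e: "e > 0" "ball x e \<subseteq> U" using open_contains_ball by blast
    have "\<exists>n. (1 / real p) ^ n < e" using p_ge e by (intro real_arch_pow_inv) auto
    then obtain n where n: "1 / real p ^ n < e" by (auto simp: power_divide)
    obtain w where w: "w \<in> words n" "x \<in> cyl p n w"
      using x unfolding limit_set_def by blast
    have "cyl p n w \<subseteq> ball x e"
    proof
      fix y assume "y \<in> cyl p n w"
      then have "\<bar>x - y\<bar> \<le> 1 / p ^ n" using w(2) by (auto simp: cyl_def add_divide_distrib)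
      then show "y \<in> ball x e" using n by (simp add: dist_real_def)
    qed
    then have "emeasure law (cyl p n w) \<le> emeasure law U"
      using e U by (intro emeasure_mono) (auto simp: digit_law_def)
    moreover have "0 < ennreal (1 / m ^ n)" by simp
    ultimately show "0 < emeasure law U"
      using emeasure_digit_law_cyl_ge[OF w(1)] by (metis less_le_trans)
  qed
next
  fix x assume x: "x \<in> measure_supp law"
  show "x \<in> limit_set"
    unfolding limit_set_def
  proof (intro INT_I)
    fix n
    show "x \<in> (cylinders n)"
      using x emeasure_outside_cylinders[of n] open_outside_cylinders[of n] unfolding measure_supp_def by auto
  qed
qed

lemma limit_set_sets: "limit_set \<in> sets borel"
  unfolding limit_set_def
  by (intro borel_closed closed_INT ballI compact_imp_closed compact_UN compact_cyl finite_words)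

lemma emeasure_limit_set: "emeasure law limit_set > 0"
proof -
  interpret prob_space "law"
    by (rule prob_space_digit_law)
  have "(\<Union>n. - cylinders n) \<in> null_sets law"
  proof (intro null_sets_UN null_setsI emeasure_outside_cylinders)
    show "- cylinders n \<in> sets law" for n
      using open_outside_cylinders[of n] by (simp add: digit_law_def)
  qed
  then have "emeasure law (limit_set \<union> (\<Union>n. - cylinders n))
      = emeasure law limit_set"
    using limit_set_sets by (intro emeasure_Un_null_set) (auto simp: digit_law_def)
  moreover have "limit_set \<union> (\<Union>n. - cylinders n) = space law"
    by (auto simp: limit_set_def digit_law_def)
  ultimately show ?thesis using emeasure_space_1 by simp
qed

text \<open>The Frostman condition: the interval meets at most \<open>2 * p + 4\<close> cylinders of
  comparable length, and each accounts for mass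
  \<open>1 / m ^ n = (1 / p ^ n) powr dim\<close>.\<close>

lemma emeasure_interval_le:
  assumes r: "0 < r" "r \<le> 2"
  shows "emeasure law {x - r..x + r} \<le> ennreal ((2 * p + 4) * r powr dim)"
proof -
  have p1: "1 < real p" and p2: "2 \<le> p" using p_ge by auto
  obtain n where n: "1 / p ^ n \<le> r" "r * p ^ n \<le> p"
    using exists_scale[OF p2 r] by metis
  define W where "W = {w \<in> words n. cyl p n w \<inter> {x - r..x + r} \<noteq> {}}"
  define V where "V = {v::nat. (x - r) * p ^ n - 2 < v \<and> v < (x + r) * p ^ n + 1}"
  have "W \<subseteq> V"
  proof
    fix w assume "w \<in> W"
    then obtain y where y: "y \<in> cyl p n w" "x - r \<le> y" "y \<le> x + r" by (auto simp: W_def)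
    have "real w \<le> y * p ^ n" "y * p ^ n \<le> real w + 1"
      using y(1) p1 by (simp_all add: cyl_def pos_divide_le_eq pos_le_divide_eq)
    moreover have "(x - r) * p ^ n \<le> y * p ^ n" "y * p ^ n \<le> (x + r) * p ^ n"
      using y(2,3) by (intro mult_right_mono; simp)+
    ultimately show "w \<in> V" unfolding V_def mem_Collect_eq by linarith
  qed
  have le: "(x - r) * p ^ n - 2 \<le> (x + r) * p ^ n + 1"
  proof -
    have "(x - r) * p ^ n \<le> (x + r) * p ^ n" using r by (intro mult_right_mono) auto
    then show ?thesis by linarith
  qed
  have "finite V" "card V \<le> (x + r) * p ^ n + 1 - ((x - r) * p ^ n - 2) + 1"
    using card_nat_interval_le[OF le] unfolding V_def by auto
  moreover have "(x + r) * p ^ n + 1 - ((x - r) * p ^ n - 2) + 1 = 2 * (r * p ^ n) + 4"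
    by (simp add: algebra_simps)
  ultimately have "card W \<le> 2 * real p + 4" using n(2) card_mono[OF \<open>finite V\<close> \<open>W \<subseteq> V\<close>] by linarith
  then have "card W / m ^ n \<le> (2 * real p + 4) / m ^ n" by (rule divide_right_mono) simp
  also have "\<dots> = (2 * real p + 4) * (1 / p ^ n) powr dim"
  proof -
    have "(1 / p ^ n) powr dim = (p powr (- real n)) powr dim"
      using p1 by (simp add: powr_minus_divide powr_realpow)
    also have "\<dots> = p powr (- (dim * n))" by (simp add: powr_powr mult.commute)
    also have "\<dots> = 1 / m ^ n" by (simp only: powr_minus_divide powr_dim)
    finally show ?thesis by simp
  qed
  also have "\<dots> \<le> (2 * real p + 4) * r powr dim"
    using n(1) dim_pos by (intro mult_left_mono powr_mono2) auto
  finally have "card W / m ^ n \<le> (2 * p + 4) * r powr dim" by simp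
  then show ?thesis
    using emeasure_digit_law_le[of "{x - r..x + r}" n] unfolding W_def
    by (meson borel_closed closed_atLeastAtMost ennreal_leI order_trans)
qed

text \<open>The mass distribution principle: a cover whose radii have too small a
  \<open>dim\<close>-sum would give \<open>A\<close> at most half its own mass.\<close>

lemma hausdorff_dim_ge_of_emeasure_pos:
  assumes "A \<in> sets law" "0 < emeasure law A"
  shows "ereal dim \<le> hausdorff_dim A"
  unfolding hausdorff_dim_def
proof (rule INF_greatest, clarify)
  fix \<tau> :: real assume \<tau>: "0 \<le> \<tau>" "hausdorff_measure \<tau> A = 0"
  interpret prob_space law
    by (rule prob_space_digit_law)
  show "ereal dim \<le> ereal \<tau>"
  proof (rule ccontr)
    assume "\<not> ereal dim \<le> ereal \<tau>"
    then have \<tau>d: "\<tau> < dim" by simp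
    define K where "K = real (2 * p + 4)"
    have K: "0 < K" by (simp add: K_def)
    have pA: "0 < prob A" using assms(2) by (simp add: emeasure_eq_measure)
    then have \<epsilon>: "0 < prob A / (2 * K)" using K by simp
    obtain x d where xd: "A \<subseteq> (\<Union>i. {x i - d i<..<x i + d i})" "\<And>i::nat. 0 < d i" "\<And>i. d i \<le> 2"
      "\<And>M. (\<Sum>i<M. d i powr dim) \<le> prob A / (2 * K)"
      by (rule hausdorff_measure_0_interval_cover[OF \<tau> \<tau>d \<epsilon>]) (rule that)
    have "A \<subseteq> (\<Union>i. {x i - d i..x i + d i})" by (rule order_trans[OF xd(1)]) (intro UN_mono, auto)
    then have "emeasure law A \<le> emeasure law (\<Union>i. {x i - d i..x i + d i})"
      by (intro emeasure_mono) (auto simp: digit_law_def)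
    also have "\<dots> \<le> (\<Sum>i. emeasure law {x i - d i..x i + d i})"
      by (intro emeasure_subadditive_countably) (auto simp: digit_law_def)
    also have "\<dots> \<le> (\<Sum>i. ennreal (K * d i powr dim))"
      unfolding K_def by (intro suminf_le emeasure_interval_le xd) auto
    also have "\<dots> \<le> ennreal (prob A / 2)"
    proof (rule suminf_le_const)
      fix M
      have "(\<Sum>i<M. K * d i powr dim) \<le> K * (prob A / (2 * K))"
        unfolding sum_distrib_left[symmetric] using xd(4) K by (intro mult_left_mono) auto
      then show "(\<Sum>i<M. ennreal (K * d i powr dim)) \<le> ennreal (prob A / 2)"
        using K by (simp add: sum_ennreal ennreal_leI)
    qed auto
    finally show False using pA by (simp add: emeasure_eq_measure)
  qed
qed

text \<open>The infimum is attained at the support, where the cylinder cover and the mass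
  distribution principle meet.\<close>

lemma measure_hausdorff_dim_digit_law: "measure_hausdorff_dim law = ereal dim"
  unfolding measure_hausdorff_dim_def
proof (rule antisym)
  have "limit_set \<in> {A \<in> sets law. 0 < emeasure law A}"
    using limit_set_sets emeasure_limit_set by (simp add: digit_law_def)
  then show "(INF A\<in>{A \<in> sets law. 0 < emeasure law A}. hausdorff_dim A) \<le> ereal dim"
    using hausdorff_dim_limit_set_le by (rule INF_lower2)
  show "ereal dim \<le> (INF A\<in>{A \<in> sets law. 0 < emeasure law A}. hausdorff_dim A)"
    by (rule INF_greatest) (auto intro: hausdorff_dim_ge_of_emeasure_pos)
qed

end

section \<open>The upper bound and the theorem\<close>

context missing_digits
begin

abbreviation approximable :: "real \<Rightarrow> real set" where
  "approximable c \<equiv> approximable_set (\<lambda>q. real q powr (- 1 - c)) \<inter> limit_set"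

end

context controlled_digits
begin

text \<open>About \<open>p ^ i\<close> denominators, each with a proportion
  \<open>p powr (- (1 + c) * i)\<close> of near words, give the saving
  \<open>p powr (- c * i)\<close>. At this level the error is at most of the order of the number of
  denominators.\<close>

lemma card_cylinders_near_rationals_le:
  fixes c :: real and i L :: nat
  assumes c: "0 < c" "c \<le> \<gamma>" and i: "4 \<le> i" and L: "(2 + c) * i \<le> L" "L \<le> (2 + c) * i + 1"
  shows "card (near_words i L (2 * p * p powr (- (1 + c) * i)))
    \<le> 96 * p ^ 2 * (1 + 2 * C) * (m ^ L * p powr (- c * i))"
proof -
  have p1: "1 < real p" and p3: "3 \<le> real p" using p_ge by auto
  \<comment> \<open>Chosen so that \<open>1 / (6 * y)\<close> is the radius in question; once
    \<open>y\<close> is at least 2, taking the floor loses at most a factor 2.\<close>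
  define y where "y = p powr ((1 + c) * i) / (12 * p)"
  define R where "R = nat \<lfloor>y\<rfloor>"
  \<comment> \<open>Here \<open>4 \<le> i\<close> enters: \<open>p ^ 4 \<ge> 24 * p\<close>, as
    already \<open>3 ^ 3 \<ge> 24\<close>.\<close>
  have "2 \<le> y"
  proof -
    have "(3::real) ^ 3 \<le> real p ^ 3" using p3 by (intro power_mono) auto
    then have "24 * real p \<le> real p ^ 3 * p" using p3 by (intro mult_right_mono) auto
    also have "\<dots> = p powr 4" using p1 by (simp add: powr_realpow[symmetric] eval_nat_numeral)
    also have "\<dots> \<le> p powr ((1 + c) * i)"
    proof (rule powr_mono)
      have "1 * real 4 \<le> (1 + c) * i" using i c by (intro mult_mono) auto
      then show "4 \<le> (1 + c) * i" by simp
    qed (use p1 in simp)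
    finally show ?thesis using p1 by (simp add: y_def field_simps)
  qed
  then have R: "0 < R" "R \<le> y" "y / 2 \<le> R" unfolding R_def by linarith+
  have y\<theta>: "1 / (6 * y) = 2 * p * p powr (- (1 + c) * i)"
  proof -
    have eq: "- (1 + c) * i = - ((1 + c) * i)" by (simp add: algebra_simps)
    show ?thesis unfolding eq powr_minus_divide y_def using p1 by simp
  qed
  have "card (near_words i L (2 * p * p powr (- (1 + c) * i)))
      \<le> 4 / R * (m ^ L * (p ^ (i + 1) + 2 * err 0 L))"
  proof (rule card_near_union_le[OF R(1)])
    show "2 * p * p powr (- (1 + c) * i) \<le> 1 / (6 * R)"
      unfolding y\<theta>[symmetric] using R \<open>2 \<le> y\<close> by (intro divide_left_mono) auto
    have "p ^ (i + 1) * real R \<le> p ^ (i + 1) * y" using R by (intro mult_left_mono) auto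
    also have "\<dots> = p powr i * p powr ((1 + c) * i) / 12" using p1 by (simp add: y_def powr_realpow)
    also have "\<dots> \<le> p powr i * p powr ((1 + c) * i)" by simp
    also have "\<dots> = p powr ((2 + c) * i)" by (simp add: algebra_simps flip: powr_add)
    also have "\<dots> \<le> p powr L" using p1 L by (intro powr_mono) auto
    also have "\<dots> = p ^ L" using p1 by (simp add: powr_realpow)
    finally have "real (p ^ (i + 1) * R) \<le> real (p ^ L)" by simp
    then show "p ^ (i + 1) * R \<le> p ^ L" by (simp only: of_nat_le_iff)
  qed
  also have "\<dots> \<le> 96 * p * p powr (- (1 + c) * i) * (m ^ L * ((1 + 2 * C) * (p * p powr i)))"
  proof (rule mult_mono)
    have "4 / real R \<le> 4 / (y / 2)" using R \<open>2 \<le> y\<close> by (intro divide_left_mono) auto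
    also have "\<dots> = 48 * (1 / (6 * y))" by simp
    also have "\<dots> = 96 * p * p powr (- (1 + c) * i)" unfolding y\<theta> by simp
    finally show "4 / real R \<le> 96 * p * p powr (- (1 + c) * i)" .
    have "err 0 L \<le> C * p powr (L * (1 / 2 - \<gamma>))" using err[of 0 L] \<gamma> by simp
    also have "\<dots> \<le> C * p powr (1 + real i)"
    proof (intro mult_left_mono powr_mono)
      have "L * (1 / 2 - \<gamma>) \<le> ((2 + c) * i + 1) * (1 / 2 - \<gamma>)"
        using L \<gamma> by (intro mult_right_mono) auto
      also have "\<dots> = i * ((2 + c) * (1 / 2 - \<gamma>)) + (1 / 2 - \<gamma>)" by (simp add: algebra_simps)
      also have "\<dots> \<le> real i * 1 + 1"
      proof (intro add_mono mult_left_mono)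
        have "(2 + c) * (1 / 2 - \<gamma>) \<le> (2 + 2 * c) * (1 / 2 - \<gamma>)"
          using c \<gamma> by (intro mult_right_mono) auto
        also have "\<dots> \<le> 1" using exponent_bound[OF c(2)] by simp
        finally show "(2 + c) * (1 / 2 - \<gamma>) \<le> 1" .
      qed (use \<gamma> in auto)
      finally show "L * (1 / 2 - \<gamma>) \<le> 1 + real i" by simp
    qed (use C p1 in auto)
    also have "p powr (1 + real i) = p * p powr i" using p1 by (simp add: powr_add)
    finally have "err 0 L \<le> C * (p * p powr i)" .
    moreover have "real (p ^ (i + 1)) = p * p powr i" using p1 by (simp add: powr_realpow)
    ultimately show "m ^ L * (p ^ (i + 1) + 2 * err 0 L) \<le> m ^ L * ((1 + 2 * C) * (p * p powr i))"
      by (intro mult_left_mono) (auto simp: distrib_right)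
  qed (auto simp: err_nonneg)
  also have "\<dots> = 96 * p ^ 2 * (1 + 2 * C) * (m ^ L * (p powr (- (1 + c) * i) * p powr i))"
    by (simp add: power2_eq_square mult_ac)
  also have "p powr (- (1 + c) * i) * p powr i = p powr (- c * i)"
  proof -
    have "- (1 + c) * i + i = - c * i" by (simp add: algebra_simps)
    then show ?thesis by (simp only: powr_add[symmetric])
  qed
  finally show ?thesis .
qed

text \<open>Near words of block \<open>i\<close> have cylinders of level about
  \<open>(2 + c) * i\<close> and number about \<open>p powr (dim * (2 + c) * i - c * i)\<close>. The
  series of their \<open>\<sigma>\<close>-th powers converges as soon as \<open>\<sigma>\<close>
  exceeds \<open>dim - c / (2 + c)\<close>.\<close>

lemma hausdorff_dim_approximable_le:
  fixes c :: real
  assumes c: "0 < c" "c \<le> \<gamma>" "c \<le> dim"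
  shows "hausdorff_dim (approximable c) \<le> ereal (dim - c / (2 + c))"
proof (rule ereal_le_epsilon2)
  fix e :: real assume e: "0 < e"
  \<comment> \<open>Capping \<open>\<delta>\<close> keeps \<open>c / (2 + c) - \<delta>\<close>
    nonnegative, so the upper bound for \<open>lev i\<close> can be multiplied by it.\<close>
  define \<delta> where "\<delta> = min e (c / (2 + c))"
  have \<delta>: "0 < \<delta>" "\<delta> \<le> e" "\<delta> \<le> c / (2 + c)" using e c by (auto simp: \<delta>_def)
  define \<sigma> where "\<sigma> = dim - c / (2 + c) + \<delta>"
  have c2: "c / (2 + c) \<le> c" "c / (2 + c) \<le> 1" using c by (auto simp: field_simps)
  have p1: "1 < real p" using p_ge by simp
  define lev where "lev i = nat \<lceil>(2 + c) * i\<rceil>" for i :: nat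
  have lev: "(2 + c) * i \<le> lev i" "lev i \<le> (2 + c) * i + 1" for i
  proof -
    have "0 \<le> (2 + c) * i" using c by simp
    then show "(2 + c) * i \<le> lev i" "lev i \<le> (2 + c) * i + 1" unfolding lev_def by linarith+
  qed
  define \<theta> where "\<theta> i = 2 * p * p powr (- (1 + c) * i)" for i :: nat
  \<comment> \<open>The counting bound starts at \<open>i = 4\<close>. Dropping finitely many stages
    does not affect a cover by every tail.\<close>
  define S where "S i = (if i < 4 then {} else near_words i (lev i) (\<theta> i))" for i
  define K where "K = 96 * p ^ 2 * (1 + 2 * C)"
  have K: "0 < K" using C p1 by (simp add: K_def)
  have "hausdorff_dim (approximable c) \<le> ereal \<sigma>"
  proof (rule hausdorff_dim_le_limsup_cover[where S = S and lev = lev])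
    show "2 \<le> p" using p_ge by simp
    show "0 \<le> \<sigma>" using c c2 \<delta> by (simp add: \<sigma>_def)
    show "finite (S i)" for i by (simp add: S_def)
    show "i \<le> lev i" for i
    proof -
      have "1 * real i \<le> (2 + c) * i" using c by (intro mult_right_mono) auto
      then have "real i \<le> lev i" using lev(1)[of i] by linarith
      then show ?thesis by simp
    qed
    have bound: "norm (card (S i) * p powr (- \<sigma> * lev i)) \<le> K * p * (p powr (- (\<delta> * (2 + c)))) ^ i" if "4 \<le> i" for i
    proof -
      have "card (S i) * p powr (- \<sigma> * lev i) \<le> K * (m ^ lev i * p powr (- c * i)) * p powr (- \<sigma> * lev i)"
        using card_cylinders_near_rationals_le[OF c(1,2) that lev[of i]] that
        by (intro mult_right_mono) (simp_all add: S_def \<theta>_def K_def)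
      also have "\<dots> = K * p powr (dim * lev i + - c * i + - \<sigma> * lev i)"
        by (simp only: powr_add powr_dim mult.assoc)
      also have "\<dots> \<le> K * p powr (1 + - (\<delta> * (2 + c)) * i)"
      proof (intro mult_left_mono powr_mono)
        have "(c / (2 + c) - \<delta>) * lev i \<le> (c / (2 + c) - \<delta>) * ((2 + c) * i + 1)"
          using lev(2)[of i] \<delta> by (intro mult_left_mono) auto
        also have "\<dots> = c / (2 + c) * (2 + c) * i - \<delta> * (2 + c) * i + (c / (2 + c) - \<delta>)"
        proof -
          have "(z - \<delta>) * (w * i + 1) = z * w * i - \<delta> * w * i + (z - \<delta>)" for z w :: real
            by (simp add: algebra_simps)
          then show ?thesis .
        qed
        also have "c / (2 + c) * (2 + c) = c" using c by simp
        also have "c * i - \<delta> * (2 + c) * i + (c / (2 + c) - \<delta>) \<le> c * i - \<delta> * (2 + c) * i + 1"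
          using c2(2) \<delta>(1) by linarith
        finally show "dim * lev i + - c * i + - \<sigma> * lev i \<le> 1 + - (\<delta> * (2 + c)) * i"
          unfolding \<sigma>_def by (simp add: algebra_simps)
      qed (use K p1 in auto)
      also have "p powr (1 + - (\<delta> * (2 + c)) * i) = p * (p powr (- (\<delta> * (2 + c)))) ^ i"
      proof -
        have "(p powr (- (\<delta> * (2 + c)))) ^ i = p powr (- (\<delta> * (2 + c)) * i)"
          using p1 by (simp only: powr_powr powr_realpow[symmetric] powr_gt_zero)
        then show ?thesis using p1 by (simp only: powr_add powr_one)
      qed
      finally show ?thesis by simp
    qed
    have "p powr (- (\<delta> * (2 + c))) < 1" using p1 \<delta> c by (intro powr_less_one) auto
    then have geo: "summable (\<lambda>i. K * p * (p powr (- (\<delta> * (2 + c)))) ^ i)"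
      by (intro summable_mult summable_geometric) simp
    show "summable (\<lambda>i. card (S i) * p powr (- \<sigma> * lev i))"
      by (rule summable_comparison_test'[OF geo bound])
  next
    fix x and N :: nat assume x: "x \<in> approximable c"
    define M where "M = max N 4"
    obtain q where q: "p ^ M < q" "infdist (real q * x) \<int> \<le> real q powr (- 1 - c)"
      using x unfolding approximable_set_def infinite_nat_iff_unbounded by blast
    have "1 \<le> q" using q(1) by simp
    then obtain i where i: "p ^ i \<le> q" "q < p ^ (i + 1)" using ex_power_ivl1[of p q] p_ge by auto
    have "p ^ M < p ^ (i + 1)" using q(1) i(2) by simp
    then have "M < i + 1" by (rule power_less_imp_less_exp[rotated]) (use p_ge in simp)
    then have Mi: "M \<le> i" by simp
    obtain w where w: "w \<in> words (lev i)" "x \<in> cyl p (lev i) w"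
      using x unfolding limit_set_def by blast
    have "real (p ^ i) \<le> real q" using i(1) by (simp only: of_nat_le_iff)
    then have qi: "p powr i \<le> real q" using p1 by (simp add: powr_realpow)
    have "real q \<le> real (p ^ (i + 1))" using i(2) by (simp only: of_nat_le_iff less_imp_le)
    then have qi1: "real q \<le> p powr (1 + real i)" using p1 by (simp add: powr_realpow powr_add)
    \<comment> \<open>Replacing \<open>x\<close> by the left end of its cylinder adds at most
      \<open>p\<close> times the approximation scale, because \<open>q < p ^ (i + 1)\<close>. This
      is why \<open>\<theta> i\<close> has the factor \<open>2 * p \<ge> 1 + p\<close>.\<close>
    have "\<bar>real w / p ^ lev i - x\<bar> \<le> 1 / p ^ lev i"
      using w(2) by (auto simp: cyl_def add_divide_distrib)
    also have "\<dots> = p powr (- real (lev i))" using p1 by (simp add: powr_minus_divide powr_realpow)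
    also have "\<dots> \<le> p powr (- ((2 + c) * i))" using lev(1)[of i] p1 by (intro powr_mono) auto
    finally have "real q * \<bar>real w / p ^ lev i - x\<bar> \<le> p powr (1 + real i) * p powr (- ((2 + c) * i))"
      using qi1 by (intro mult_mono) auto
    also have "\<dots> = p * p powr (- (1 + c) * i)"
    proof -
      have "1 + real i + - ((2 + c) * i) = 1 + - (1 + c) * i" by (simp add: algebra_simps)
      then have "p powr (1 + real i) * p powr (- ((2 + c) * i)) = p powr 1 * p powr (- (1 + c) * i)"
        by (simp only: powr_add[symmetric])
      then show ?thesis using p1 by simp
    qed
    finally have near: "\<bar>real q * (real w / p ^ lev i) - real q * x\<bar> \<le> p * p powr (- (1 + c) * i)"
      by (simp only: right_diff_distrib[symmetric] abs_mult abs_of_nat)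
    have "real q powr (- 1 - c) \<le> (p powr i) powr (- 1 - c)"
      using qi c p1 by (intro powr_mono2') auto
    also have "\<dots> = p powr (- (1 + c) * i)"
    proof -
      have "real i * (- 1 - c) = - (1 + c) * i" by (simp add: algebra_simps)
      then show ?thesis by (simp only: powr_powr)
    qed
    finally have "int_dist (real q * (real w / p ^ lev i)) \<le> p powr (- (1 + c) * i) + p * p powr (- (1 + c) * i)"
      using int_dist_diff_le[of "real q * (real w / p ^ lev i)" "real q * x"] q(2) near by linarith
    also have "\<dots> = (1 + p) * p powr (- (1 + c) * i)" by (simp add: algebra_simps)
    also have "\<dots> \<le> \<theta> i" unfolding \<theta>_def using p1 by (intro mult_right_mono) auto
    finally have "w \<in> S i" using Mi i w(1) by (auto simp: S_def M_def)
    then show "\<exists>i\<ge>N. \<exists>w\<in>S i. x \<in> cyl p (lev i) w" using Mi w(2) by (auto simp: M_def)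
  qed
  also have "\<dots> \<le> ereal (dim - c / (2 + c)) + ereal e" using \<delta> by (simp add: \<sigma>_def)
  finally show "hausdorff_dim (approximable c) \<le> ereal (dim - c / (2 + c)) + ereal e" .
qed

lemma hausdorff_dim_approximable_ge:
  fixes c :: real
  assumes c: "0 < c" "c \<le> \<gamma>"
  shows "ereal (dim - 4 * c / \<gamma>) \<le> hausdorff_dim (approximable c)"
proof -
  have "ereal (dim - 2 * (2 * c) / \<gamma>) \<le> hausdorff_dim {x \<in> limit_set. \<forall>N. \<exists>L w. well_approx c N L w \<and> x \<in> cyl p L w}"
  proof (rule hausdorff_dim_limsup_ge)
    show "\<forall>\<^sub>F L in sequentially. many_extensions \<gamma> (2 * c) (well_approx c N) L" for N
      by (rule eventually_many_well_approximable[OF c])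
  qed (use \<gamma> c in auto)
  also have "\<dots> \<le> hausdorff_dim (approximable c)"
  proof (rule hausdorff_dim_mono, intro subsetI IntI)
    fix x assume x: "x \<in> {x \<in> limit_set. \<forall>N. \<exists>L w. well_approx c N L w \<and> x \<in> cyl p L w}"
    show "x \<in> approximable_set (\<lambda>q. real q powr (- 1 - c))"
      unfolding approximable_set_def infinite_nat_iff_unbounded
    proof (intro CollectI allI)
      fix N
      obtain q where "N < q" "int_dist (real q * x) \<le> real q powr (- 1 - c)"
        using x by blast
      then show "\<exists>q>N. q \<in> {q. 1 \<le> q \<and> infdist (real q * x) \<int> \<le> real q powr (- 1 - c)}"
        by (intro exI[of _ q]) auto
    qed
  qed auto
  finally show ?thesis by simp
qed

end

context missing_digits
begin

lemma hausdorff_dim_approximable_bounds: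
  assumes "l1_dim law > ereal (1 / 2)"
  obtains c0 K :: real where "0 < c0"
    "\<And>c. 0 < c \<Longrightarrow> c \<le> c0 \<Longrightarrow> hausdorff_dim (approximable c) \<le> ereal (dim - c / (2 + c))"
    "\<And>c. 0 < c \<Longrightarrow> c \<le> c0 \<Longrightarrow> ereal (dim - K * c) \<le> hausdorff_dim (approximable c)"
proof -
  obtain \<beta> C0 where \<beta>: "0 \<le> \<beta>" "\<beta> < 1 / 2" "0 \<le> C0" "\<And>n. fourier_sum n \<le> C0 * p powr (n * \<beta>)"
    using l1_dim_fourier_sum_bound[OF assms] by metis
  obtain \<gamma> C where *: "0 < \<gamma>" "\<gamma> < 1 / 2" "0 < C"
    "\<And>j n. real j \<le> \<gamma> * (j + n) \<Longrightarrow> err j n \<le> C * p powr ((j + n) * (1 / 2 - \<gamma>))"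
    using err_bound[OF \<beta>] by metis
  interpret controlled_digits p D \<gamma> C
    by unfold_locales (fact *)+
  show ?thesis
  proof (rule that[of "min \<gamma> dim" "4 / \<gamma>"])
    show "0 < min \<gamma> dim" using * dim_pos by simp
    fix c :: real assume c: "0 < c" "c \<le> min \<gamma> dim"
    show "hausdorff_dim (approximable c) \<le> ereal (dim - c / (2 + c))"
      using c by (intro hausdorff_dim_approximable_le) auto
    show "ereal (dim - 4 / \<gamma> * c) \<le> hausdorff_dim (approximable c)"
      using c hausdorff_dim_approximable_ge[of c] by simp
  qed
qed

end

section \<open>Uniformity over the digit sets\<close>

definition approximable_bounds :: "real measure \<Rightarrow> real \<Rightarrow> real \<Rightarrow> real \<Rightarrow> bool" where
  "approximable_bounds \<mu> c0 s K \<longleftrightarrow> measure_hausdorff_dim \<mu> = ereal s \<and> (\<forall>c\<in>{0<..c0}.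
    let d = hausdorff_dim (approximable_set (\<lambda>q. real q powr (- 1 - c)) \<inter> measure_supp \<mu>)
    in d \<le> ereal (s - c / (2 + c)) \<and> ereal (s - K * c) \<le> d)"

text \<open>The existential stands outside the implication so that a choice function assigns a
  positive \<open>c0\<close> to every set \<open>D\<close>, with the value 1 where the hypotheses
  fail.\<close>

lemma digit_law_approximable_bounds:
  fixes p :: nat
  assumes "3 \<le> p"
  shows "\<exists>c0>0. D \<subseteq> {..<p} \<and> 2 \<le> card D \<and> card D < p \<and> l1_dim (digit_law p D) > ereal (1 / 2) \<longrightarrow>
    (\<exists>s K. approximable_bounds (digit_law p D) c0 s K)"
proof (cases "D \<subseteq> {..<p} \<and> 2 \<le> card D \<and> card D < p \<and> l1_dim (digit_law p D) > ereal (1 / 2)")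
  case True
  then interpret missing_digits p D using assms by unfold_locales auto
  obtain c0 K where "0 < c0"
    "\<And>c. 0 < c \<Longrightarrow> c \<le> c0 \<Longrightarrow> hausdorff_dim (approximable c) \<le> ereal (dim - c / (2 + c))"
    "\<And>c. 0 < c \<Longrightarrow> c \<le> c0 \<Longrightarrow> ereal (dim - K * c) \<le> hausdorff_dim (approximable c)"
    using hausdorff_dim_approximable_bounds True by metis
  then show ?thesis
    unfolding approximable_bounds_def Let_def measure_supp_digit_law measure_hausdorff_dim_digit_law
    by (intro exI[of _ c0] conjI impI exI[of _ dim] exI[of _ K]) auto
next
  case False
  then show ?thesis by (intro exI[of _ 1]) auto
qed

theorem theorem9p3:
  fixes t p :: nat
  assumes "t \<ge> 1" and "p \<ge> 3"
  shows "\<exists>c>0. \<forall>\<mu>. missing_digits_measure p t \<mu> \<and> l1_dim \<mu> > ereal (1/2) \<longrightarrow>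
    (let s = measure_hausdorff_dim \<mu>;
         d = (\<lambda>c'::real. hausdorff_dim
               (approximable_set (\<lambda>q. real q powr (- 1 - c')) \<inter> measure_supp \<mu>))
     in (\<exists>f::real \<Rightarrow> real.
           (\<forall>c'\<in>{0<..c}. f c' \<ge> 0) \<and> (f \<longlongrightarrow> 0) (at_right 0) \<and>
           (\<forall>c'\<in>{0<..c}. s - ereal (c' / (2 + c')) \<ge> d c' \<and> d c' \<ge> s - ereal (f c')))
        \<and> (d \<longlongrightarrow> s) (at_right 0))"
proof -
  obtain c0 where c0: "\<And>D. 0 < c0 D"
    "\<And>D. D \<subseteq> {..<p} \<and> 2 \<le> card D \<and> card D < p \<and> l1_dim (digit_law p D) > ereal (1 / 2) \<Longrightarrow>
    (\<exists>s K. approximable_bounds (digit_law p D) (c0 D) s K)"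
    using digit_law_approximable_bounds[OF assms(2)] by metis
  \<comment> \<open>The constant has to be fixed before the measure. There are only finitely many
    digit sets, so the minimum is still positive.\<close>
  define c where "c = Min (c0 ` Pow {..<p})"
  have c: "0 < c" "\<And>D. D \<subseteq> {..<p} \<Longrightarrow> c \<le> c0 D" using c0(1) unfolding c_def by (subst Min_gr_iff) auto
  show ?thesis
  proof (intro exI[of _ c] conjI c(1) allI impI)
    fix \<mu> assume \<mu>: "missing_digits_measure p t \<mu> \<and> l1_dim \<mu> > ereal (1/2)"
    then obtain D where D: "D \<subseteq> {..<p}" "card D = p - t" "2 \<le> card D" "\<mu> = digit_law p D"
      unfolding missing_digits_measure_def by blast
    define d where "d c' = hausdorff_dim (approximable_set (\<lambda>q. real q powr (- 1 - c')) \<inter> measure_supp \<mu>)" for c' :: real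
    have "D \<subseteq> {..<p} \<and> 2 \<le> card D \<and> card D < p \<and> l1_dim (digit_law p D) > ereal (1 / 2)"
      using D \<mu> assms by auto
    then obtain s K where s: "measure_hausdorff_dim \<mu> = ereal s"
      and "\<forall>c'\<in>{0<..c0 D}. d c' \<le> ereal (s - c' / (2 + c')) \<and> ereal (s - K * c') \<le> d c'"
      using c0(2)[of D] unfolding approximable_bounds_def Let_def d_def D(4) by blast
    then have sK: "d c' \<le> ereal (s - c' / (2 + c'))" "ereal (s - K * c') \<le> d c'" if "c' \<in> {0<..c}" for c'
      using that c(2)[OF D(1)] by auto
    \<comment> \<open>The witness for \<open>f\<close> is linear in absolute value, which makes it
      nonnegative whatever the sign of \<open>K\<close>.\<close>
    have lim: "((\<lambda>c'. \<bar>K * c'\<bar>) \<longlongrightarrow> \<bar>K * 0\<bar>) (at_right 0)" by (intro tendsto_intros)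
    have ev: "\<forall>\<^sub>F c' in at_right 0. c' \<in> {0<..c}"
      using c(1) by (auto simp: eventually_at_right_field intro!: exI[of _ c])
    have "(d \<longlongrightarrow> ereal s) (at_right 0)"
    proof (rule tendsto_sandwich)
      show "\<forall>\<^sub>F c' in at_right 0. ereal (s - K * c') \<le> d c'" using ev by eventually_elim (rule sK)
      show "\<forall>\<^sub>F c' in at_right 0. d c' \<le> ereal s"
        using ev
      proof eventually_elim
        case (elim c')
        then have "d c' \<le> ereal (s - c' / (2 + c'))" by (rule sK)
        also have "\<dots> \<le> ereal s" using elim by simp
        finally show ?case .
      qed
      have "((\<lambda>c'. s - K * c') \<longlongrightarrow> s - K * 0) (at_right 0)" by (intro tendsto_intros)
      then show "((\<lambda>c'. ereal (s - K * c')) \<longlongrightarrow> ereal s) (at_right 0)" by simp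
    qed simp
    moreover have "ereal s - ereal \<bar>K * c'\<bar> \<le> d c'" if "c' \<in> {0<..c}" for c'
      using sK(2)[OF that] by (rule order_trans[rotated]) simp
    ultimately show "let s = measure_hausdorff_dim \<mu>;
         d = (\<lambda>c'::real. hausdorff_dim
               (approximable_set (\<lambda>q. real q powr (- 1 - c')) \<inter> measure_supp \<mu>))
     in (\<exists>f::real \<Rightarrow> real.
           (\<forall>c'\<in>{0<..c}. f c' \<ge> 0) \<and> (f \<longlongrightarrow> 0) (at_right 0) \<and>
           (\<forall>c'\<in>{0<..c}. s - ereal (c' / (2 + c')) \<ge> d c' \<and> d c' \<ge> s - ereal (f c')))
        \<and> (d \<longlongrightarrow> s) (at_right 0)"
      using lim sK(1) unfolding Let_def s d_def[symmetric]
      by (intro conjI exI[of _ "\<lambda>c'. \<bar>K * c'\<bar>"]) auto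
  qed
qed

end
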